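(* Let $n\ge 3$ and let $\beta\in B_n$ be a braid. The following are equivalent: (i) $\beta$ is conjugate in $B_n$ to a strongly quasipositive braid; (ii) every element $\beta'\in \mathtt{SSS}([\beta])$ satisfies $\inf(\beta')\ge 0$; (iii) there exists an element $\beta'\in \mathtt{SSS}([\beta])$ with $\inf(\beta')\ge 0$. Consequently, there is an algorithm which, given an $n$-braid (as a word in the band generators and their inverses), determines whether it is conjugate to a strongly quasipositive braid in time polynomial in the word length and the number $n$ of strands.
   Context: $B_n$ is the braid group on $n$ strands with Artin generators $\sigma_1,\dots,\sigma_{n-1}$. For $1\le i<j\le n$ the band generator is $a_{ij}=(\sigma_{j-1}\sigma_{j-2}\cdots\sigma_{i+1})\,\sigma_i\,(\sigma_{j-1}\sigma_{j-2}\cdots\sigma_{i+1})^{-1}$ (so $a_{i,i+1}=\sigma_i$). A braid is strongly quasipositive (SQP) if it is represented by a (possibly empty) word in the $a_{ij}$ with only positive exponents; these braids form a monoid $SQP(n)\subset B_n$. For $V,W\in B_n$ write $V\le W$ if $W=PVQ$ for some $P,Q\in SQP(n)$. Let $\delta=\sigma_{n-1}\cdots\sigma_2\sigma_1$. For $\beta\in B_n$ set $\inf(\beta)=\max\{r\in\mathbb Z:\delta^r\le\beta\}$, $\sup(\beta)=\min\{s\in\mathbb Z:\beta\le\delta^s\}$ and canonical length $\ell(\beta)=\sup(\beta)-\inf(\beta)$. $[\beta]$ denotes the conjugacy class of $\beta$ in $B_n$. The super summit set $\mathtt{SSS}([\beta])$ is the set of conjugates $\beta'$ of $\beta$ whose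 canonical length $\ell(\beta')$ is minimal among all conjugates of $\beta$. *)

theory Defs
  imports "HOL-Algebra.Group"
begin

section \<open>The braid group\<close>

text \<open>
  The Artin presentation. The letter \<open>(i, True)\<close> stands for \<open>\<sigma>\<^sub>i\<close> and
  \<open>(i, False)\<close> for its inverse, where \<open>1 \<le> i < n\<close>.
\<close>

type_synonym artin_word = "(nat \<times> bool) list"

definition artin_words :: "nat \<Rightarrow> artin_word set" where
  "artin_words n = lists ({1..<n} \<times> UNIV)"

inductive artin_eq :: "nat \<Rightarrow> artin_word \<Rightarrow> artin_word \<Rightarrow> bool" for n where
  refl: "u \<in> artin_words n \<Longrightarrow> artin_eq n u u"
| sym: "artin_eq n u v \<Longrightarrow> artin_eq n v u"
| trans: "artin_eq n u v \<Longrightarrow> artin_eq n v w \<Longrightarrow> artin_eq n u w"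
| append: "artin_eq n u u' \<Longrightarrow> artin_eq n v v' \<Longrightarrow> artin_eq n (u @ v) (u' @ v')"
| cancel: "1 \<le> i \<Longrightarrow> i < n \<Longrightarrow> artin_eq n [(i, b), (i, \<not> b)] []"
| far: "1 \<le> i \<Longrightarrow> i + 2 \<le> j \<Longrightarrow> j < n \<Longrightarrow>
    artin_eq n [(i, True), (j, True)] [(j, True), (i, True)]"
| braid: "1 \<le> i \<Longrightarrow> i + 1 < n \<Longrightarrow>
    artin_eq n [(i, True), (i + 1, True), (i, True)] [(i + 1, True), (i, True), (i + 1, True)]"

type_synonym braid = "artin_word set"

definition braid_class :: "nat \<Rightarrow> artin_word \<Rightarrow> braid" where
  "braid_class n u = {v. artin_eq n u v}"

definition braid_group :: "nat \<Rightarrow> braid monoid" where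
  "braid_group n =
    \<lparr>carrier = braid_class n ` artin_words n,
     mult = (\<lambda>A B. {w. \<exists>u\<in>A. \<exists>v\<in>B. artin_eq n (u @ v) w}),
     one = braid_class n []\<rparr>"

lemma artin_eq_words: "artin_eq n u v \<Longrightarrow> u \<in> artin_words n \<and> v \<in> artin_words n"
  by (induction rule: artin_eq.induct) (auto simp: artin_words_def)

lemma braid_class_mult:
  assumes "u \<in> artin_words n" "v \<in> artin_words n"
  shows "braid_class n u \<otimes>\<^bsub>braid_group n\<^esub> braid_class n v = braid_class n (u @ v)"
  using assms unfolding braid_class_def braid_group_def
  by (auto intro: artin_eq.refl artin_eq.append artin_eq.trans artin_eq.sym)

lemma artin_inverse:
  "u \<in> artin_words n \<Longrightarrow> artin_eq n (rev (map (\<lambda>(i, b). (i, \<not> b)) u) @ u) []"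
proof (induction u)
  case Nil
  then show ?case by (simp add: artin_eq.refl)
next
  case (Cons x u)
  obtain i b where x: "x = (i, b)" by force
  let ?v = "rev (map (\<lambda>(i, b). (i, \<not> b)) u)"
  from Cons.prems have u: "u \<in> artin_words n" and i: "1 \<le> i" "i < n"
    by (auto simp: artin_words_def x)
  have v: "?v \<in> artin_words n" using u by (auto simp: artin_words_def in_lists_conv_set)
  have "artin_eq n ([(i, \<not> b), (i, b)] @ u) ([] @ u)"
    using artin_eq.cancel[OF i, of "\<not> b"] u by (intro artin_eq.append artin_eq.refl) simp_all
  then have "artin_eq n (?v @ ([(i, \<not> b), (i, b)] @ u)) (?v @ ([] @ u))"
    by (rule artin_eq.append[OF artin_eq.refl[OF v]])
  then show ?case using Cons.IH[OF u] by (auto simp: x intro: artin_eq.trans)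
qed

lemma group_braid_group: "group (braid_group n)"
proof (rule groupI)
  let ?G = "braid_group n"
  have car: "carrier ?G = braid_class n ` artin_words n"
    and one: "\<one>\<^bsub>?G\<^esub> = braid_class n []" by (simp_all add: braid_group_def)
  have app: "u @ v \<in> artin_words n" if "u \<in> artin_words n" "v \<in> artin_words n" for u v
    using that by (auto simp: artin_words_def)
  have nil: "[] \<in> artin_words n" by (simp add: artin_words_def)
  show "x \<otimes>\<^bsub>?G\<^esub> y \<in> carrier ?G" if "x \<in> carrier ?G" "y \<in> carrier ?G" for x y
    using that by (auto simp: car braid_class_mult app)
  show "\<one>\<^bsub>?G\<^esub> \<in> carrier ?G" by (simp add: car one nil)
  show "x \<otimes>\<^bsub>?G\<^esub> y \<otimes>\<^bsub>?G\<^esub> z = x \<otimes>\<^bsub>?G\<^esub> (y \<otimes>\<^bsub>?G\<^esub> z)"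
    if "x \<in> carrier ?G" "y \<in> carrier ?G" "z \<in> carrier ?G" for x y z
    using that by (auto simp: car braid_class_mult app)
  show "\<one>\<^bsub>?G\<^esub> \<otimes>\<^bsub>?G\<^esub> x = x" if "x \<in> carrier ?G" for x
    using that by (auto simp: car one braid_class_mult nil)
  show "\<exists>y\<in>carrier ?G. y \<otimes>\<^bsub>?G\<^esub> x = \<one>\<^bsub>?G\<^esub>" if x: "x \<in> carrier ?G" for x
  proof -
    obtain u where u: "u \<in> artin_words n" "x = braid_class n u" using x by (auto simp: car)
    let ?v = "rev (map (\<lambda>(i, b). (i, \<not> b)) u)"
    have v: "?v \<in> artin_words n" using u by (auto simp: artin_words_def in_lists_conv_set)
    have "braid_class n (?v @ u) = braid_class n []"
      using artin_inverse[OF u(1)] unfolding braid_class_def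
      by (auto intro: artin_eq.trans artin_eq.sym)
    then show ?thesis using u v by (auto simp: car one braid_class_mult)
  qed
qed

definition braid_prod :: "nat \<Rightarrow> braid list \<Rightarrow> braid" where
  "braid_prod n xs = foldr (mult (braid_group n)) xs \<one>\<^bsub>braid_group n\<^esub>"

definition artin_gen :: "nat \<Rightarrow> nat \<Rightarrow> braid" where
  "artin_gen n i = braid_class n [(i, True)]"

definition band_gen :: "nat \<Rightarrow> nat \<Rightarrow> nat \<Rightarrow> braid" where
  "band_gen n i j =
    (let c = braid_prod n (map (artin_gen n) (rev [i + 1..<j]))
     in c \<otimes>\<^bsub>braid_group n\<^esub> artin_gen n i \<otimes>\<^bsub>braid_group n\<^esub> inv\<^bsub>braid_group n\<^esub> c)"

text \<open>
  Words in the band generators: the letter \<open>(i, j, True)\<close> stands for \<open>a\<^sub>i\<^sub>j\<close> and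
  \<open>(i, j, False)\<close> for its inverse.
\<close>

type_synonym band_word = "(nat \<times> nat \<times> bool) list"

definition band_words :: "nat \<Rightarrow> band_word set" where
  "band_words n = {w. \<forall>(i, j, b)\<in>set w. 1 \<le> i \<and> i < j \<and> j \<le> n}"

definition band_eval :: "nat \<Rightarrow> band_word \<Rightarrow> braid" where
  "band_eval n w =
    braid_prod n (map (\<lambda>(i, j, b). if b then band_gen n i j
                                   else inv\<^bsub>braid_group n\<^esub> (band_gen n i j)) w)"

definition SQP :: "nat \<Rightarrow> braid set" where
  "SQP n = {band_eval n w | w. w \<in> band_words n \<and> (\<forall>(i, j, b)\<in>set w. b)}"

definition braid_le :: "nat \<Rightarrow> braid \<Rightarrow> braid \<Rightarrow> bool" where
  "braid_le n V W \<longleftrightarrow>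
    (\<exists>P\<in>SQP n. \<exists>Q\<in>SQP n. W = P \<otimes>\<^bsub>braid_group n\<^esub> V \<otimes>\<^bsub>braid_group n\<^esub> Q)"

definition delta :: "nat \<Rightarrow> braid" where
  "delta n = braid_prod n (map (artin_gen n) (rev [1..<n]))"

definition braid_inf :: "nat \<Rightarrow> braid \<Rightarrow> int" where
  "braid_inf n \<beta> = (GREATEST r. braid_le n (delta n [^]\<^bsub>braid_group n\<^esub> r) \<beta>)"

definition braid_sup :: "nat \<Rightarrow> braid \<Rightarrow> int" where
  "braid_sup n \<beta> = (LEAST s. braid_le n \<beta> (delta n [^]\<^bsub>braid_group n\<^esub> s))"

definition canonical_length :: "nat \<Rightarrow> braid \<Rightarrow> int" where
  "canonical_length n \<beta> = braid_sup n \<beta> - braid_inf n \<beta>"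

definition conj_class :: "nat \<Rightarrow> braid \<Rightarrow> braid set" where
  "conj_class n \<beta> =
    {\<gamma> \<otimes>\<^bsub>braid_group n\<^esub> \<beta> \<otimes>\<^bsub>braid_group n\<^esub> inv\<^bsub>braid_group n\<^esub> \<gamma> | \<gamma>. \<gamma> \<in> carrier (braid_group n)}"

text \<open>The argument of \<open>SSS n\<close> is a conjugacy class.\<close>

definition SSS :: "nat \<Rightarrow> braid set \<Rightarrow> braid set" where
  "SSS n C = {\<beta>'\<in>C. \<forall>\<gamma>\<in>C. canonical_length n \<beta>' \<le> canonical_length n \<gamma>}"

definition conj_to_SQP :: "nat \<Rightarrow> braid \<Rightarrow> bool" where
  "conj_to_SQP n \<beta> \<longleftrightarrow> (\<exists>\<beta>'\<in>conj_class n \<beta>. \<beta>' \<in> SQP n)"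


section \<open>Polynomial-time algorithms\<close>

text \<open>
  The model of computation is pure first-order Lisp, as in N. D. Jones, \<^emph>\<open>Computability and
  Complexity from a Programming Perspective\<close> (1997): data are binary trees, and a program is a
  finite list of mutually recursive functions together with a main expression, evaluated call by
  value. An evaluation is charged one unit for every expression node evaluated, counting repeated
  evaluations. No primitive inspects or builds more than one cell, so every unit of time is a
  bounded number of pointer operations on shared cells; running times therefore agree with those
  of Turing machines up to a polynomial.
\<close>

datatype data = Atom | Dot data data

fun car :: "data \<Rightarrow> data" where
  "car Atom = Atom"
| "car (Dot x y) = x"

fun cdr :: "data \<Rightarrow> data" where
  "cdr Atom = Atom"
| "cdr (Dot x y) = y"

datatype expr =
    Param nat
  | AtomE
  | DotE expr expr
  | CarE expr
  | CdrE expr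
  | IfE expr expr expr
  | Call nat "expr list"

text \<open>
  \<open>evaluates P env e v t\<close>: under the function definitions \<open>P\<close>, with parameters \<open>env\<close>, the expression
  \<open>e\<close> evaluates to \<open>v\<close> in time \<open>t\<close>. The parameters of a function body are exactly the arguments
  of the call, and \<open>Atom\<close> is the truth value ``false''.
\<close>

inductive evaluates :: "expr list \<Rightarrow> data list \<Rightarrow> expr \<Rightarrow> data \<Rightarrow> nat \<Rightarrow> bool"
  and evaluates_list :: "expr list \<Rightarrow> data list \<Rightarrow> expr list \<Rightarrow> data list \<Rightarrow> nat \<Rightarrow> bool"
  for P where
  Param: "i < length env \<Longrightarrow> evaluates P env (Param i) (env ! i) 1"
| AtomE: "evaluates P env AtomE Atom 1"
| DotE: "evaluates P env e1 v1 t1 \<Longrightarrow> evaluates P env e2 v2 t2 \<Longrightarrow>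
    evaluates P env (DotE e1 e2) (Dot v1 v2) (t1 + t2 + 1)"
| CarE: "evaluates P env e v t \<Longrightarrow> evaluates P env (CarE e) (car v) (t + 1)"
| CdrE: "evaluates P env e v t \<Longrightarrow> evaluates P env (CdrE e) (cdr v) (t + 1)"
| IfTrue: "evaluates P env e v t \<Longrightarrow> v \<noteq> Atom \<Longrightarrow> evaluates P env e1 v1 t1 \<Longrightarrow>
    evaluates P env (IfE e e1 e2) v1 (t + t1 + 1)"
| IfFalse: "evaluates P env e Atom t \<Longrightarrow> evaluates P env e2 v2 t2 \<Longrightarrow>
    evaluates P env (IfE e e1 e2) v2 (t + t2 + 1)"
| Call: "evaluates_list P env es vs t \<Longrightarrow> f < length P \<Longrightarrow> evaluates P vs (P ! f) v t' \<Longrightarrow>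
    evaluates P env (Call f es) v (t + t' + 1)"
| Nil: "evaluates_list P env [] [] 0"
| Cons: "evaluates P env e v t \<Longrightarrow> evaluates_list P env es vs t' \<Longrightarrow>
    evaluates_list P env (e # es) (v # vs) (t + t')"

inductive_cases evaluates_ParamE: "evaluates P env (Param i) v t"
inductive_cases evaluates_AtomE: "evaluates P env AtomE v t"
inductive_cases evaluates_DotE: "evaluates P env (DotE e1 e2) v t"
inductive_cases evaluates_CarE: "evaluates P env (CarE e) v t"
inductive_cases evaluates_CdrE: "evaluates P env (CdrE e) v t"
inductive_cases evaluates_IfE: "evaluates P env (IfE e e1 e2) v t"
inductive_cases evaluates_CallE: "evaluates P env (Call f es) v t"
inductive_cases evaluates_list_NilE: "evaluates_list P env [] vs t"
inductive_cases evaluates_list_ConsE: "evaluates_list P env (e # es) vs t"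

lemma evaluates_deterministic:
  "evaluates P env e v t \<Longrightarrow> evaluates P env e v' t' \<Longrightarrow> v' = v \<and> t' = t"
  "evaluates_list P env es vs s \<Longrightarrow> evaluates_list P env es vs' s' \<Longrightarrow> vs' = vs \<and> s' = s"
proof (induction arbitrary: v' t' and vs' s' rule: evaluates_evaluates_list.inducts)
qed ((erule evaluates_ParamE evaluates_AtomE evaluates_DotE evaluates_CarE evaluates_CdrE
      evaluates_IfE evaluates_CallE evaluates_list_NilE evaluates_list_ConsE; metis One_nat_def Suc_eq_plus1)+)

definition polytime_decidable ::
    "'a set \<Rightarrow> ('a \<Rightarrow> data) \<Rightarrow> ('a \<Rightarrow> nat) \<Rightarrow> ('a \<Rightarrow> bool) \<Rightarrow> bool" where
  "polytime_decidable I enc sz Q \<longleftrightarrow>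
    (\<exists>P e c k. \<forall>x\<in>I. \<exists>v t.
      evaluates P [enc x] e v t \<and> (v \<noteq> Atom \<longleftrightarrow> Q x) \<and> t \<le> c * (sz x + 1) ^ k)"

text \<open>
  Numbers are written in unary. Strand numbers are at most \<open>n\<close> and the running time may be
  polynomial in \<open>n\<close>, so this is interchangeable with binary notation.
\<close>

fun encode_nat :: "nat \<Rightarrow> data" where
  "encode_nat 0 = Atom"
| "encode_nat (Suc n) = Dot Atom (encode_nat n)"

fun encode_bool :: "bool \<Rightarrow> data" where
  "encode_bool b = (if b then Dot Atom Atom else Atom)"

fun encode_band_word :: "band_word \<Rightarrow> data" where
  "encode_band_word [] = Atom"
| "encode_band_word ((i, j, b) # w) =
    Dot (Dot (encode_nat i) (Dot (encode_nat j) (encode_bool b))) (encode_band_word w)"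

fun encode_instance :: "nat \<times> band_word \<Rightarrow> data" where
  "encode_instance (n, w) = Dot (encode_nat n) (encode_band_word w)"

text \<open>
  A quantity is bounded by a polynomial in \<open>n\<close> and the word length iff it is bounded by a
  polynomial in their sum.
\<close>

fun instance_size :: "nat \<times> band_word \<Rightarrow> nat" where
  "instance_size (n, w) = n + length w"

end

theory Submission
  imports Defs
begin

text \<open>
  The proof works with the dual Garside structure of the braid group. Its simple elements, the
  divisors of \<open>\<delta>\<close>, correspond to the noncrossing partitions of the points \<open>1, \<dots>, n\<close> on a circle, and
  divisibility among them is refinement. A partition is treated here as a relation that is closed
  under a Galois connection: chords between points on one side, chords between the gaps separating
  them on the other, related when they do not cross. The two polarities \<open>rc\<close> and \<open>lc\<close> are the Kreweras
  complements, the meet of two simple elements is the intersection, and the quotient of \<open>D\<close> by a finer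
  \<open>A\<close> is \<open>rc A \<inter> D\<close>. The only combinatorial fact behind this calculus is \<open>rc_quotient\<close>.

  Consider the monoid generated by the simple elements, with their partial product as relations. A
  word \<open>A # w\<close> has as head the product of \<open>A\<close> with the part of the head of \<open>w\<close> that \<open>A\<close> can absorb.
  Heads and tails are invariant under the relations, so \<open>\<delta>\<close> can be cancelled, the monoid embeds into
  its fractions \<open>\<delta>\<^sup>-\<^sup>m x\<close>, and the Artin relations hold for these fractions. Conversely the relations of
  the band generators make every noncrossing partition a braid (\<open>lift\<close>). Hence equal positive braids
  have equal heads, which yields the one property of normal forms that is needed (\<open>head_absorbs\<close>): if
  a simple braid divides \<open>X P\<close> on the left, where \<open>X\<close> and \<open>P\<close> are positive, then it divides \<open>X H\<close>,
  where \<open>H\<close> is the head of \<open>P\<close>.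

  Cycling conjugates \<open>x = P \<delta>\<^sup>u\<close>, with \<open>P\<close> positive with head \<open>A\<close>, to \<open>A\<^sup>-\<^sup>1 x A\<close>. It never lowers the
  infimum below \<open>u\<close> and never raises the supremum (\<open>cycle_sup\<close>). If some conjugate has infimum above
  \<open>u\<close>, take a shortest positive \<open>Q\<close> such that \<open>Q x Q\<^sup>-\<^sup>1\<close> has this property. The property above, applied
  to \<open>Q P\<close>, shows that \<open>Q\<close> ends in \<open>\<delta> A\<^sup>-\<^sup>1\<close>, so that cycling replaces \<open>Q\<close> by a shorter braid; moreover the
  length of the head of \<open>Q\<close> drops as well (\<open>raise_within_cycle\<close>). As that length is at most \<open>n - 1\<close>,
  so is the number of cyclings after which the infimum has gone up. An element of the super summit
  set therefore has the maximal infimum of its conjugacy class: otherwise cycling would shorten it.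
  This gives the equivalences, because a braid is strongly quasipositive iff its infimum is
  nonnegative.

  The algorithm writes the input as \<open>P \<delta>\<^sup>-\<^sup>m\<close>, where \<open>m\<close> counts the inverse letters, and cycles. A head
  \<open>\<delta>\<close> lowers \<open>m\<close> by one, \<open>n + 1\<close> consecutive heads different from \<open>\<delta>\<close> show that the infimum is maximal,
  and the answer is positive iff \<open>m\<close> reaches \<open>0\<close>. A partition is stored as the list of its pairs, so
  that \<open>rc A \<inter> B\<close> is a filter, and every function of the program is a loop of polynomial cost.
\<close>

section \<open>Noncrossing partitions as a Galois connection\<close>

text \<open>
  The points \<open>i\<close> not in the half-open interval between the two entries of \<open>p\<close>, in either order.
\<close>

definition outside :: "nat \<times> nat \<Rightarrow> nat \<Rightarrow> bool" where
  "outside p i \<longleftrightarrow> (fst p \<le> i) = (snd p \<le> i)"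

text \<open>
  Put the points \<open>1, \<dots>, n\<close> on a circle and read \<open>q\<close> as a chord between two points, but \<open>p\<close> as a chord
  between the gaps just before two points. The relation says that the two chords do not cross.
\<close>

definition same_side :: "nat \<times> nat \<Rightarrow> nat \<times> nat \<Rightarrow> bool" where
  "same_side p q \<longleftrightarrow> outside p (fst q) = outside p (snd q)"

lemma same_side_self: "same_side (x, y) (x, y) \<longleftrightarrow> x = y"
  by (auto simp: same_side_def outside_def)

locale dual_braid =
  fixes n :: nat
  assumes n_ge_2: "2 \<le> n"
begin

definition full :: "(nat \<times> nat) set" where
  "full = {1..n} \<times> {1..n}"

text \<open>
  The polarities of \<open>same_side\<close>. On noncrossing partitions they are the two Kreweras complements:
  \<open>A\<close> times \<open>rc A\<close> and \<open>lc A\<close> times \<open>A\<close> will both be \<open>\<delta>\<close>.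
\<close>

definition rc :: "(nat \<times> nat) set \<Rightarrow> (nat \<times> nat) set" where
  "rc A = {p \<in> full. \<forall>q\<in>A. same_side p q}"

definition lc :: "(nat \<times> nat) set \<Rightarrow> (nat \<times> nat) set" where
  "lc A = {q \<in> full. \<forall>p\<in>A. same_side p q}"

text \<open>
  The closed sets of the Galois connection are the noncrossing equivalence relations. Closedness is
  the convenient definition: intersections and complements of closed sets are closed for general
  reasons, and the combinatorial properties follow below from it.
\<close>

definition nc :: "(nat \<times> nat) set \<Rightarrow> bool" where
  "nc A \<longleftrightarrow> A \<subseteq> full \<and> lc (rc A) = A"

definition diag :: "(nat \<times> nat) set" where
  "diag = {p \<in> full. fst p = snd p}"

text \<open>
  The product of two simple elements, which is defined in the monoid if \<open>B \<subseteq> rc A\<close>. As \<open>rc\<close> is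
  injective on closed sets, it is the closed set with \<open>rc (mul A B) = rc A \<inter> rc B\<close>.
\<close>

definition mul :: "(nat \<times> nat) set \<Rightarrow> (nat \<times> nat) set \<Rightarrow> (nat \<times> nat) set" where
  "mul A B = lc (rc A \<inter> rc B)"

lemma rc_antimono: "A \<subseteq> B \<Longrightarrow> rc B \<subseteq> rc A"
  and lc_antimono: "A \<subseteq> B \<Longrightarrow> lc B \<subseteq> lc A"
  by (auto simp: rc_def lc_def)

lemma rc_sub: "rc A \<subseteq> full" and lc_sub: "lc A \<subseteq> full"
  by (auto simp: rc_def lc_def)

lemma sub_lc_rc: "A \<subseteq> full \<Longrightarrow> A \<subseteq> lc (rc A)" and sub_rc_lc: "A \<subseteq> full \<Longrightarrow> A \<subseteq> rc (lc A)"
  by (auto simp: rc_def lc_def)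

lemma finite_full: "finite full"
  by (simp add: full_def)

lemma nc_sub: "nc A \<Longrightarrow> A \<subseteq> full"
  by (simp add: nc_def)

lemma nc_finite: "nc A \<Longrightarrow> finite A"
  using nc_sub finite_full finite_subset by blast

lemma nc_lc: assumes "A \<subseteq> full" shows "nc (lc A)"
proof -
  have "lc (rc (lc A)) \<subseteq> lc A" using sub_rc_lc[OF assms] by (rule lc_antimono)
  then show ?thesis using sub_lc_rc[OF lc_sub] lc_sub by (auto simp: nc_def)
qed

text \<open>
  Moving every point one step around the circle exchanges the roles of points and gaps. So \<open>rc\<close> and
  \<open>lc\<close> differ by a rotation and have the same closed sets.
\<close>

lemma rc_conv_lc:
  assumes "A \<subseteq> full" shows "\<exists>B\<subseteq>full. rc A = lc B"
proof -
  define sh where "sh i = (if i = n then 1 else i + 1)" for i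
  define B where "B = (\<lambda>(i, j). (sh i, sh j)) ` A"
  have shift: "sh i \<le> x \<longleftrightarrow> (if i = n then True else \<not> x \<le> i)" if "i \<in> {1..n}" "x \<in> {1..n}" for i x
    using that by (auto simp: sh_def)
  have eq: "same_side p q \<longleftrightarrow> same_side (sh (fst q), sh (snd q)) p" if "p \<in> full" "q \<in> full" for p q
    using that by (auto simp: same_side_def outside_def shift full_def mem_Times_iff)
  have "B \<subseteq> full" using assms n_ge_2 by (force simp: B_def full_def sh_def)
  moreover have "rc A = lc B"
    using eq assms by (fastforce simp: rc_def lc_def B_def)
  ultimately show ?thesis by blast
qed

lemma lc_conv_rc:
  assumes "A \<subseteq> full" shows "\<exists>B\<subseteq>full. lc A = rc B"
proof -
  define sh where "sh i = (if i = 1 then n else i - 1)" for i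
  define B where "B = (\<lambda>(i, j). (sh i, sh j)) ` A"
  have shift: "x \<le> sh i \<longleftrightarrow> (if i = 1 then True else \<not> i \<le> x)" if "i \<in> {1..n}" "x \<in> {1..n}" for i x
    using that by (auto simp: sh_def)
  have eq: "same_side p q \<longleftrightarrow> same_side q (sh (fst p), sh (snd p))" if "p \<in> full" "q \<in> full" for p q
    using that by (auto simp: same_side_def outside_def shift full_def mem_Times_iff)
  have "B \<subseteq> full" using assms n_ge_2 by (force simp: B_def full_def sh_def)
  moreover have "lc A = rc B"
    using eq assms by (fastforce simp: rc_def lc_def B_def)
  ultimately show ?thesis by blast
qed

lemma nc_rc: "A \<subseteq> full \<Longrightarrow> nc (rc A)"
  using rc_conv_lc nc_lc by metis

lemma lc_rc: "nc A \<Longrightarrow> lc (rc A) = A"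
  by (simp add: nc_def)

lemma rc_lc: assumes "nc A" shows "rc (lc A) = A"
proof -
  obtain B where B: "B \<subseteq> full" "A = rc B"
    using lc_conv_rc[OF rc_sub] lc_rc[OF assms] by metis
  have "rc (lc (rc B)) \<subseteq> rc B" using sub_lc_rc[OF B(1)] by (rule rc_antimono)
  then show ?thesis using sub_rc_lc[OF rc_sub] B by blast
qed

lemma nc_rc': "nc A \<Longrightarrow> nc (rc A)" and nc_lc': "nc A \<Longrightarrow> nc (lc A)"
  by (simp_all add: nc_rc nc_lc nc_sub)

lemma nc_Int: assumes "nc A" "nc B" shows "nc (A \<inter> B)"
proof -
  have "A \<inter> B = lc (rc A \<union> rc B)"
    using lc_rc[OF assms(1)] lc_rc[OF assms(2)] by (auto simp: lc_def)
  then show ?thesis using nc_lc[of "rc A \<union> rc B"] rc_sub by simp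
qed

lemma rc_inj: "nc A \<Longrightarrow> nc B \<Longrightarrow> rc A = rc B \<Longrightarrow> A = B"
  by (metis lc_rc)

lemma sub_rc_iff: "A \<subseteq> full \<Longrightarrow> B \<subseteq> full \<Longrightarrow> A \<subseteq> rc B \<longleftrightarrow> B \<subseteq> lc A"
  by (auto simp: rc_def lc_def)

lemma nc_refl: "nc A \<Longrightarrow> x \<in> {1..n} \<Longrightarrow> (x, x) \<in> A"
  by (subst lc_rc[symmetric]) (auto simp: lc_def full_def same_side_def)

lemma nc_sym: assumes "nc A" "(x, y) \<in> A" shows "(y, x) \<in> A"
proof -
  have "(x, y) \<in> lc (rc A)" using assms lc_rc by simp
  then have "(y, x) \<in> lc (rc A)" by (auto simp: lc_def full_def same_side_def)
  then show ?thesis using assms lc_rc by simp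
qed

lemma nc_trans: assumes "nc A" "(x, y) \<in> A" "(y, z) \<in> A" shows "(x, z) \<in> A"
proof -
  have "(x, y) \<in> lc (rc A)" "(y, z) \<in> lc (rc A)" using assms lc_rc by simp_all
  then have "(x, z) \<in> lc (rc A)" by (simp add: lc_def full_def same_side_def)
  then show ?thesis using assms lc_rc by simp
qed

text \<open>
  An interval that contains \<open>x\<close> and \<open>y\<close> or neither, and likewise for \<open>k\<close> and \<open>l\<close>, cannot separate \<open>x\<close>
  from \<open>k\<close> when the four points interleave.
\<close>

lemma nc_noncrossing:
  assumes "nc A" "(x, y) \<in> A" "(k, l) \<in> A" "x < k" "k < y" "y < l"
  shows "(x, k) \<in> A"
proof -
  have *: "(x, y) \<in> lc (rc A)" "(k, l) \<in> lc (rc A)" using assms lc_rc by simp_all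
  have "same_side p (x, k)" if "p \<in> rc A" for p
  proof -
    have "same_side p (x, y)" "same_side p (k, l)" using * that by (auto simp: lc_def)
    then show ?thesis using assms(4-6) by (simp add: same_side_def outside_def) linarith
  qed
  then have "(x, k) \<in> lc (rc A)" using * by (auto simp: lc_def full_def)
  then show ?thesis using assms lc_rc by simp
qed

lemma nc_full: "nc full" and rc_diag: "rc diag = full" and lc_diag: "lc diag = full"
proof -
  show "rc diag = full" "lc diag = full" by (auto simp: rc_def lc_def diag_def same_side_def outside_def)
  then show "nc full" using nc_lc[of diag] by (auto simp: diag_def)
qed

lemma rc_full: "rc full = diag" and lc_full: "lc full = diag"
  using same_side_self by (auto simp: rc_def lc_def diag_def) (auto simp: same_side_def outside_def)

lemma nc_diag: "nc diag"
  using nc_rc'[OF nc_full] by (simp add: rc_full)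

lemma diag_sub: "nc A \<Longrightarrow> diag \<subseteq> A"
  using nc_refl by (auto simp: diag_def full_def)

lemma rc_Int_self: assumes "nc A" shows "rc A \<inter> A = diag"
proof -
  have "p \<in> diag" if "p \<in> rc A" "p \<in> A" for p
    using that same_side_self[of "fst p" "snd p"] by (auto simp: rc_def diag_def)
  then show ?thesis using diag_sub[OF assms] diag_sub[OF nc_rc'[OF assms]] by auto
qed

text \<open>
  This is the cycle of \<open>D\<close> written as the cycle of \<open>A\<close> followed by that of the quotient: \<open>z\<close> is the
  cyclic successor of \<open>i\<close> in its block of \<open>A\<close>, and from there the quotient leads to the successor \<open>j\<close> of
  \<open>i\<close> in its block of \<open>D\<close>. The two cases are whether the step from \<open>i\<close> to \<open>z\<close> wraps around.
\<close>

lemma adjacent_link: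
  assumes A: "nc A" and D: "nc D" "A \<subseteq> D"
    and ij: "(i, j) \<in> D" "i < j" and gap: "\<And>k. i < k \<Longrightarrow> k < j \<Longrightarrow> (i, k) \<notin> D"
  shows "\<exists>z. (i, z) \<in> A \<and> (z, j) \<in> rc A \<inter> D"
proof -
  have inU: "i \<in> {1..n}" "j \<in> {1..n}" using ij nc_sub[OF D(1)] by (auto simp: full_def)
  show ?thesis
  proof (cases "\<exists>z>i. (i, z) \<in> A")
    case True
    define z where "z = (LEAST z. i < z \<and> (i, z) \<in> A)"
    have z: "i < z" "(i, z) \<in> A" unfolding z_def by (rule LeastI2_ex[OF True]; simp)+
    have least: "z \<le> k" if "i < k" "(i, k) \<in> A" for k
      unfolding z_def by (rule Least_le) (use that in simp)
    have jz: "j \<le> z" using gap[of z] z D by (meson linorder_not_le subsetD)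
    have zj: "(z, j) \<in> D" using z ij D nc_sym nc_trans by blast
    \<comment> \<open>The interval from j to z is a union of blocks of A: a pair leaving it would cross (i, z),
      contradict the choice of z, or put a point between i and j into the block of i in D.\<close>
    have key: False if ass: "(a, b) \<in> A" "j \<le> a" "a < z" "b < j \<or> z \<le> b" for a b
    proof -
      have ab: "(a, b) \<in> D" "(b, a) \<in> A" using ass D nc_sym[OF A] by auto
      have a: "(i, a) \<notin> A" using least[of a] ass ij by auto
      consider "b < i" | "b = i" | "i < b" "b < j" | "b = z" | "z < b" using ass(4) by linarith
      then show False
      proof cases
        case 1 then have "(b, i) \<in> A" using nc_noncrossing[OF A ab(2) z(2)] ass ij by auto
        then show ?thesis using a ab nc_sym[OF A] nc_trans[OF A] by meson
      next
        case 2 then show ?thesis using a ab by auto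
      next
        case 3
        have "(i, b) \<in> D"
        proof (cases "a = j")
          case True then show ?thesis using ij ab nc_trans[OF D(1)] by blast
        next
          case False
          then show ?thesis
            using nc_noncrossing[OF D(1) ij(1), of b a] 3 ass ab D by auto
        qed
        then show ?thesis using gap 3 by auto
      next
        case 4 then show ?thesis using a ab z nc_trans[OF A] by blast
      next
        case 5
        then have "(i, a) \<in> A" using nc_noncrossing[OF A z(2) ass(1)] ass ij by auto
        then show ?thesis using a by auto
      qed
    qed
    have "same_side (z, j) (a, b)" if "(a, b) \<in> A" for a b
      using key[OF that] key[OF nc_sym[OF A that]] jz
      by (simp add: same_side_def outside_def) (meson le_trans not_le)
    then have "(z, j) \<in> rc A" using zj nc_sub[OF D(1)] by (auto simp: rc_def)
    then show ?thesis using z zj by blast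
  next
    case False
    define z where "z = (LEAST z. (i, z) \<in> A)"
    have z: "(i, z) \<in> A" unfolding z_def by (rule LeastI[of _ i]) (rule nc_refl[OF A inU(1)])
    have least: "z \<le> k" if "(i, k) \<in> A" for k
      unfolding z_def by (rule Least_le) (use that in simp)
    have zi: "z \<le> i" using False z by (meson linorder_not_le)
    have zj: "(z, j) \<in> D" using z ij D nc_sym nc_trans by blast
    \<comment> \<open>Now the block of i in A ends at i, and the interval from z to j contains the whole block.\<close>
    have key: False if "(a, b) \<in> A" "z \<le> a" "a < j" "b < z \<or> j \<le> b" for a b
    proof -
      have ab: "(a, b) \<in> D" "(b, a) \<in> A" using that D nc_sym[OF A] by auto
      have zi': "(z, i) \<in> A" using z nc_sym[OF A] by blast
      have na: "(i, a) \<notin> A"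
      proof
        assume "(i, a) \<in> A"
        then have "(i, b) \<in> A" using that nc_trans[OF A] by blast
        then show False using least[of b] False that ij by auto
      qed
      have za: "a \<noteq> z" "a \<noteq> i" using na z nc_refl[OF A inU(1)] by auto
      show False
      proof (cases "a < i")
        case True
        show False
        proof (cases "b < z")
          case True
          then have "(b, z) \<in> A" using nc_noncrossing[OF A ab(2) zi'] \<open>a < i\<close> that za by auto
          then show False using na ab z nc_trans[OF A] nc_sym[OF A] by meson
        next
          case F: False
          then have "(z, a) \<in> A" using nc_noncrossing[OF A zi' that(1)] \<open>a < i\<close> that za ij by auto
          then show False using na z nc_trans[OF A] by meson
        qed
      next
        case F: False
        then have "i < a" using za by simp
        have "(i, a) \<in> D"
        proof (cases "b < z")
          case True
          show ?thesis
          proof -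
            have "(b, a) \<in> D" using ab D by auto
            from nc_noncrossing[OF D(1) this ij(1)] have "(b, i) \<in> D" using True zi \<open>i < a\<close> that by auto
            then show ?thesis using \<open>(b, a) \<in> D\<close> nc_trans[OF D(1)] nc_sym[OF D(1)] by meson
          qed
        next
          case Fb: False
          then have "j \<le> b" using that by auto
          show ?thesis
          proof (cases "b = j")
            case True then show ?thesis using ab ij nc_trans[OF D(1)] nc_sym[OF D(1)] by meson
          next
            case False
            then show ?thesis using nc_noncrossing[OF D(1) ij(1) ab(1)] \<open>i < a\<close> that \<open>j \<le> b\<close> by auto
          qed
        qed
        then show False using gap \<open>i < a\<close> that by auto
      qed
    qed
    have "z < j" using zi ij by simp
    have "same_side (z, j) (a, b)" if "(a, b) \<in> A" for a b
      using key[OF that] key[OF nc_sym[OF A that]] \<open>z < j\<close>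
      by (simp add: same_side_def outside_def) (meson le_trans not_le less_imp_le)
    then have "(z, j) \<in> rc A" using zj nc_sub[OF D(1)] by (auto simp: rc_def)
    then show ?thesis using z zj by blast
  qed
qed

text \<open>
  A function that is constant on the blocks of \<open>A\<close> and of the quotient is, by \<open>adjacent_link\<close>, constant
  on neighbours in a block of \<open>D\<close>, hence on the block.
\<close>

lemma rc_quotient:
  assumes A: "nc A" and D: "nc D" and sub: "A \<subseteq> D"
  shows "rc A \<inter> rc (rc A \<inter> D) = rc D"
proof
  show "rc D \<subseteq> rc A \<inter> rc (rc A \<inter> D)" using sub by (auto simp: rc_def)
  show "rc A \<inter> rc (rc A \<inter> D) \<subseteq> rc D"
  proof
    fix p assume p: "p \<in> rc A \<inter> rc (rc A \<inter> D)"
    define f where "f = outside p"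
    have same_side: "same_side p (i, j) \<longleftrightarrow> f i = f j" for i j by (simp add: same_side_def f_def)
    have fA: "f i = f j" if "(i, j) \<in> A" for i j using p that same_side by (auto simp: rc_def)
    have fC: "f i = f j" if "(i, j) \<in> rc A \<inter> D" for i j
      using p that same_side[of i j] by (auto simp: rc_def[of "rc A \<inter> D"])
    have fD: "f i = f j" if "(i, j) \<in> D" "i < j" for i j
      using that
    proof (induction "j - i" arbitrary: i j rule: less_induct)
      case less
      show ?case
      proof (cases "\<exists>k. i < k \<and> k < j \<and> (i, k) \<in> D")
        case True
        then obtain k where k: "i < k" "k < j" "(i, k) \<in> D" by blast
        then have "(k, j) \<in> D" using less.prems nc_sym[OF D] nc_trans[OF D] by meson
        then show ?thesis using less.hyps[of k i] less.hyps[of j k] k less.prems by fastforce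
      next
        case False
        then show ?thesis
          using adjacent_link[OF A D sub less.prems] fA fC by blast
      qed
    qed
    have "f i = f j" if "(i, j) \<in> D" for i j
      using fD[of i j] fD[of j i] that nc_sym[OF D] by (cases i j rule: linorder_cases) auto
    then show "p \<in> rc D" using p same_side by (auto simp: rc_def)
  qed
qed

text \<open>
  The mirror image of taking quotients recovers \<open>B\<close>. The candidate \<open>B'\<close> contains \<open>B\<close>, and the quotient
  of \<open>B'\<close> by \<open>B\<close> consists of pairs that do not cross themselves in the sense of \<open>same_side\<close>; only
  diagonal pairs do that.
\<close>

lemma left_quotient:
  assumes B: "nc B" and G: "nc G" and sub: "B \<subseteq> G"
  shows "G \<inter> lc (rc B \<inter> G) = B"
proof -
  define C where "C = rc B \<inter> G"
  define B' where "B' = G \<inter> lc C"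
  have C: "nc C" unfolding C_def by (intro nc_Int nc_rc' B G)
  have B': "nc B'" unfolding B'_def by (intro nc_Int nc_lc' C G)
  have "B \<subseteq> lc C" using sub_rc_iff[of C B] nc_sub[OF B] nc_sub[OF C] by (auto simp: C_def)
  then have BB': "B \<subseteq> B'" using sub by (auto simp: B'_def)
  have "rc B \<inter> B' = diag"
  proof
    show "diag \<subseteq> rc B \<inter> B'" by (intro diag_sub nc_Int nc_rc' B B')
    have "p \<in> diag" if "p \<in> C" "p \<in> lc C" for p
      using that same_side_self[of "fst p" "snd p"] by (auto simp: lc_def diag_def)
    then show "rc B \<inter> B' \<subseteq> diag" by (auto simp: B'_def C_def)
  qed
  then have "rc B' = rc B" using rc_quotient[OF B B' BB'] rc_sub by (auto simp: rc_diag)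
  then show ?thesis using rc_inj[OF B' B] by (simp add: B'_def C_def)
qed

lemma nc_mul: "nc A \<Longrightarrow> nc B \<Longrightarrow> nc (mul A B)"
  unfolding mul_def by (intro nc_lc' nc_Int nc_rc')

lemma rc_mul: "nc A \<Longrightarrow> nc B \<Longrightarrow> rc (mul A B) = rc A \<inter> rc B"
  unfolding mul_def by (intro rc_lc nc_Int nc_rc')

lemma sub_mul: assumes "nc A" "nc B" shows "A \<subseteq> mul A B" "B \<subseteq> mul A B"
proof -
  have "lc (rc A) \<subseteq> mul A B" "lc (rc B) \<subseteq> mul A B"
    unfolding mul_def by (intro lc_antimono; simp)+
  then show "A \<subseteq> mul A B" "B \<subseteq> mul A B" using assms lc_rc by simp_all
qed

lemma quotient_mul:
  assumes "nc A" "nc B" "B \<subseteq> rc A" shows "rc A \<inter> mul A B = B"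
  using left_quotient[OF assms(2) nc_rc'[OF assms(1)] assms(3)] by (simp add: mul_def Int_commute)

lemma mul_quotient:
  assumes "nc A" "nc D" "A \<subseteq> D" shows "mul A (rc A \<inter> D) = D"
  using rc_quotient[OF assms] lc_rc[OF assms(2)] by (simp add: mul_def)

end

section \<open>Words in simple elements and their heads\<close>

context dual_braid
begin

text \<open>
  Conjugation by \<open>\<delta>\<close>: \<open>A\<close> times \<open>rc A\<close> and \<open>rc A\<close> times \<open>rc (rc A)\<close> are both \<open>\<delta>\<close>, so that \<open>rc (rc A)\<close> is
  \<open>\<delta>\<^sup>-\<^sup>1 A \<delta>\<close>, and \<open>rot\<close> is the inverse operation.
\<close>

definition rot :: "(nat \<times> nat) set \<Rightarrow> (nat \<times> nat) set" where
  "rot A = lc (lc A)"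

lemma nc_rot: "nc A \<Longrightarrow> nc (rot A)"
  by (simp add: rot_def nc_lc')

lemma rot_rc_rc: "nc A \<Longrightarrow> rot (rc (rc A)) = A" and rc_rc_rot: "nc A \<Longrightarrow> rc (rc (rot A)) = A"
  by (simp_all add: rot_def lc_rc rc_lc nc_rc' nc_lc')

lemma rot_diag: "rot diag = diag" and rot_full: "rot full = full"
  by (simp_all add: rot_def lc_diag lc_full)

lemma rc_rot: "nc A \<Longrightarrow> rc (rot A) = lc A" and rot_rc: "nc A \<Longrightarrow> rot (rc A) = lc A"
  by (simp_all add: rot_def rc_lc lc_rc nc_lc')

lemma rot_mono: "A \<subseteq> B \<Longrightarrow> rot A \<subseteq> rot B"
  unfolding rot_def by (intro lc_antimono)

lemma rot_Int: assumes "nc A" "nc B" shows "rot (A \<inter> B) = rot A \<inter> rot B"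
proof
  show "rot (A \<inter> B) \<subseteq> rot A \<inter> rot B" using rot_mono by blast
  have "rc (rc (rot A \<inter> rot B)) \<subseteq> A \<inter> B"
    using rc_rc_rot[OF assms(1)] rc_rc_rot[OF assms(2)] rc_antimono[OF rc_antimono] by (metis Int_greatest Int_lower1 Int_lower2)
  then have "rot (rc (rc (rot A \<inter> rot B))) \<subseteq> rot (A \<inter> B)" by (rule rot_mono)
  then show "rot A \<inter> rot B \<subseteq> rot (A \<inter> B)" using rot_rc_rc nc_Int nc_rot assms by simp
qed

lemma rot_mul: assumes "nc A" "nc B" shows "rot (mul A B) = mul (rot A) (rot B)"
proof (rule rc_inj)
  show "rc (rot (mul A B)) = rc (mul (rot A) (rot B))"
    using assms rot_Int[of "rc A" "rc B"] by (simp add: rc_rot rc_mul nc_mul nc_rot nc_rc' flip: rot_rc)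
qed (simp_all add: assms nc_rot nc_mul)

lemma nc_funpow_rot: "nc A \<Longrightarrow> nc ((rot ^^ k) A)"
  by (induction k) (simp_all add: nc_rot)

text \<open>
  Equality in the monoid presented by the simple elements and their products.
\<close>

inductive weq :: "(nat \<times> nat) set list \<Rightarrow> (nat \<times> nat) set list \<Rightarrow> bool" where
  refl: "(\<forall>A\<in>set u. nc A) \<Longrightarrow> weq u u"
| sym: "weq u v \<Longrightarrow> weq v u"
| trans: "weq u v \<Longrightarrow> weq v w \<Longrightarrow> weq u w"
| mul: "(\<forall>A\<in>set (u @ v). nc A) \<Longrightarrow> nc A \<Longrightarrow> nc B \<Longrightarrow> B \<subseteq> rc A \<Longrightarrow>
    weq (u @ [A, B] @ v) (u @ [mul A B] @ v)"
| one: "(\<forall>A\<in>set (u @ v). nc A) \<Longrightarrow> weq (u @ [diag] @ v) (u @ v)"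

declare weq.trans [trans]

lemma weq_words: "weq u v \<Longrightarrow> (\<forall>A\<in>set u. nc A) \<and> (\<forall>A\<in>set v. nc A)"
  by (induction rule: weq.induct) (auto simp: nc_mul nc_diag)

lemma weq_context:
  assumes "weq u v" "\<forall>A\<in>set x. nc A" "\<forall>A\<in>set y. nc A"
  shows "weq (x @ u @ y) (x @ v @ y)"
  using assms
proof (induction rule: weq.induct)
  case (refl u)
  then show ?case by (intro weq.refl) auto
next
  case (sym u v)
  show ?case by (rule weq.sym) (rule sym.IH[OF sym.prems])
next
  case (trans u v w)
  show ?case by (rule weq.trans) (rule trans.IH[OF trans.prems])+
next
  case (mul u v A B)
  then show ?case using weq.mul[of "x @ u" "v @ y" A B] by auto
next
  case (one u v)
  then show ?case using weq.one[of "x @ u" "v @ y"] by auto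
qed

lemma weq_append: assumes "weq u u'" "weq v v'" shows "weq (u @ v) (u' @ v')"
proof -
  have "weq (u @ v) (u' @ v)" using weq_context[OF assms(1), of "[]" v] weq_words[OF assms(2)] by auto
  moreover have "weq (u' @ v) (u' @ v')" using weq_context[OF assms(2), of u' "[]"] weq_words[OF assms(1)] by auto
  ultimately show ?thesis by (rule weq.trans)
qed

lemma weq_Cons: "nc A \<Longrightarrow> weq u v \<Longrightarrow> weq (A # u) (A # v)"
  using weq_append[of "[A]" "[A]" u v] weq.refl[of "[A]"] by simp

lemma weq_mul2: "nc A \<Longrightarrow> nc B \<Longrightarrow> B \<subseteq> rc A \<Longrightarrow> weq [A, B] [mul A B]"
  using weq.mul[of "[]" "[]" A B] by simp

lemma weq_diag: "weq [diag] []"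
  using weq.one[of "[]" "[]"] by simp

lemma weq_quotient: "nc A \<Longrightarrow> nc D \<Longrightarrow> A \<subseteq> D \<Longrightarrow> weq [A, rc A \<inter> D] [D]"
  using weq_mul2[of A "rc A \<inter> D"] by (simp add: mul_quotient nc_Int nc_rc')

text \<open>
  The greatest simple left divisor. A leading factor \<open>A\<close> absorbs from the head of the remaining word
  its meet with the complement \<open>rc A\<close>; what is left of that head starts the tail.
\<close>

fun whd :: "(nat \<times> nat) set list \<Rightarrow> (nat \<times> nat) set" where
  "whd [] = diag"
| "whd (A # w) = mul A (rc A \<inter> whd w)"

fun wtl :: "(nat \<times> nat) set list \<Rightarrow> (nat \<times> nat) set list" where
  "wtl [] = []"
| "wtl (A # w) = rc (rc A \<inter> whd w) \<inter> whd w # wtl w"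

lemma nc_whd: "\<forall>A\<in>set w. nc A \<Longrightarrow> nc (whd w)"
  by (induction w) (auto intro: nc_diag nc_mul nc_Int nc_rc')

lemma nc_wtl: "\<forall>A\<in>set w. nc A \<Longrightarrow> \<forall>A\<in>set (wtl w). nc A"
  by (induction w) (auto intro!: nc_Int nc_rc' nc_whd)

lemma weq_whd_wtl: "\<forall>A\<in>set w. nc A \<Longrightarrow> weq w (whd w # wtl w)"
proof (induction w)
  case Nil
  then show ?case using weq.sym[OF weq_diag] by simp
next
  case (Cons A w)
  let ?X = "whd w" and ?E = "rc A \<inter> whd w"
  have nc: "nc A" "nc ?X" "nc ?E" "\<forall>A\<in>set (wtl w). nc A"
    using Cons.prems nc_wtl[of w] by (auto intro!: nc_whd nc_Int nc_rc')
  have "weq (A # w) (A # ?X # wtl w)" using Cons nc by (intro weq_Cons) auto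
  also have "weq \<dots> (A # ?E # (rc ?E \<inter> ?X) # wtl w)"
    using weq_context[OF weq.sym[OF weq_quotient[OF nc(3,2)]], of "[A]" "wtl w"] nc by simp
  also have "weq \<dots> (mul A ?E # (rc ?E \<inter> ?X) # wtl w)"
    using weq.mul[of "[]" "(rc ?E \<inter> ?X) # wtl w" A ?E] nc by (simp add: nc_Int nc_rc')
  finally show ?case by simp
qed

text \<open>
  Absorbing with \<open>B\<close> and then with \<open>A\<close> has the same effect as absorbing with their product. The set \<open>F\<close>
  that \<open>A\<close> absorbs in the second step is \<open>B\<close> times the set \<open>G\<close> that the product absorbs; all the
  equations follow by comparing complements. The tails agree only up to the relations, since the
  two-step version leaves two factors where the other one leaves their product.
\<close>

lemma whd_wtl_mul:
  assumes A: "nc A" and B: "nc B" "B \<subseteq> rc A" and w: "\<forall>A\<in>set w. nc A"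
  shows "whd (A # B # w) = whd (mul A B # w)" "weq (wtl (A # B # w)) (wtl (mul A B # w))"
proof -
  define X where "X = whd w"
  define E where "E = rc B \<inter> X"
  define Y where "Y = mul B E"
  define F where "F = rc A \<inter> Y"
  define G where "G = rc A \<inter> rc B \<inter> X"
  have nc: "nc X" "nc E" "nc Y" "nc F" "nc G" using A B w
    by (auto simp: X_def E_def Y_def F_def G_def intro!: nc_mul nc_Int nc_rc' nc_whd)
  have BY: "rc B \<inter> Y = E" using quotient_mul[OF B(1) nc(2)] by (simp add: Y_def E_def)
  have rF: "rc F = rc B \<inter> rc G"
  proof -
    have "B \<subseteq> F" using B sub_mul(1)[OF B(1) nc(2)] by (simp add: F_def Y_def)
    moreover have "rc B \<inter> F = G" using BY by (auto simp: F_def G_def E_def)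
    ultimately show ?thesis using rc_quotient[OF B(1) nc(4)] by simp
  qed
  have rAB: "rc (mul A B) = rc A \<inter> rc B" by (simp add: rc_mul A B)
  show "whd (A # B # w) = whd (mul A B # w)"
  proof (rule rc_inj)
    show "rc (whd (A # B # w)) = rc (whd (mul A B # w))"
      using rF A B nc by (simp add: rc_mul nc_mul rAB flip: X_def E_def Y_def F_def G_def) blast
  qed (use A B w in \<open>auto intro!: nc_whd nc_mul nc_Int nc_rc'\<close>)
  have "G \<subseteq> E" "rc F \<inter> Y = rc G \<inter> E" using rF BY by (auto simp: G_def E_def)
  moreover have "rc (rc G \<inter> E) \<inter> (rc G \<inter> X) = rc E \<inter> X"
    using rc_quotient[OF nc(5,2) \<open>G \<subseteq> E\<close>] by blast
  ultimately have "weq [rc F \<inter> Y, rc E \<inter> X] [rc G \<inter> X]"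
    using weq_quotient[of "rc G \<inter> E" "rc G \<inter> X"] nc by (simp add: nc_Int nc_rc' E_def le_infI2)
  moreover have "wtl (A # B # w) = [rc F \<inter> Y, rc E \<inter> X] @ wtl w"
    "wtl (mul A B # w) = [rc G \<inter> X] @ wtl w"
    by (simp_all add: rAB flip: X_def E_def Y_def F_def G_def)
  ultimately show "weq (wtl (A # B # w)) (wtl (mul A B # w))"
    using weq_context[of "[rc F \<inter> Y, rc E \<inter> X]" "[rc G \<inter> X]" "[]" "wtl w"] nc_wtl[OF w] by simp
qed

lemma whd_wtl_context:
  assumes "whd v = whd v'" "weq (wtl v) (wtl v')" "\<forall>A\<in>set (u @ v). nc A"
  shows "whd (u @ v) = whd (u @ v') \<and> weq (wtl (u @ v)) (wtl (u @ v'))"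
  using assms
proof (induction u)
  case (Cons A u)
  then have "nc (rc (rc A \<inter> whd (u @ v')) \<inter> whd (u @ v'))"
    using nc_whd[of "u @ v"] by (auto intro!: nc_Int nc_rc')
  then show ?case using Cons by (auto intro: weq_Cons)
qed auto

lemma whd_wtl_cong: "weq u v \<Longrightarrow> whd u = whd v \<and> weq (wtl u) (wtl v)"
proof (induction rule: weq.induct)
  case (refl u)
  then show ?case using nc_wtl by (auto intro: weq.refl)
next
  case (sym u v)
  then show ?case by (auto intro: weq.sym)
next
  case (trans u v w)
  then show ?case using weq.trans by metis
next
  case (mul u v A B)
  then show ?case
    using whd_wtl_mul[of A B v] whd_wtl_context[of "A # B # v" "mul A B # v" u] by auto
next
  case (one u v)
  have v: "nc (whd v)" "\<forall>A\<in>set (wtl v). nc A" using one nc_whd nc_wtl by auto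
  have "rc diag \<inter> whd v = whd v" using nc_sub[OF v(1)] by (auto simp: rc_diag)
  then have "whd (diag # v) = whd v" "wtl (diag # v) = diag # wtl v"
    using mul_quotient[OF nc_diag v(1)] diag_sub[OF v(1)] rc_Int_self[OF v(1)] by simp_all
  then show ?case
    using whd_wtl_context[of "diag # v" v u] one weq.one[of "[]" "wtl v"] v nc_diag by auto
qed

text \<open>
  The letter \<open>full\<close>, which stands for \<open>\<delta>\<close>, absorbs nothing, so that the tail of \<open>full # x\<close> is \<open>x\<close> up to
  the relations; and tails respect them.
\<close>

lemma weq_cancel_full: assumes "weq (full # x) (full # y)" shows "weq x y"
proof -
  have tl: "weq (wtl (full # x)) x" if "\<forall>A\<in>set x. nc A" for x
  proof -
    have "rc full \<inter> whd x = diag" using diag_sub[OF nc_whd[OF that]] by (auto simp: rc_full)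
    then have "wtl (full # x) = whd x # wtl x"
      using nc_sub[OF nc_whd[OF that]] by (auto simp: rc_diag)
    then show ?thesis using weq_whd_wtl[OF that] by (auto intro: weq.sym)
  qed
  have "weq (wtl (full # x)) (wtl (full # y))" using whd_wtl_cong[OF assms] by blast
  moreover have "\<forall>A\<in>set x. nc A" "\<forall>A\<in>set y. nc A" using weq_words[OF assms] by auto
  ultimately show ?thesis using weq.trans[OF weq.sym[OF tl] weq.trans[OF _ tl]] by blast
qed

lemma weq_cancel_fulls: "weq (replicate k full @ x) (replicate k full @ y) \<Longrightarrow> weq x y"
proof (induction k)
  case (Suc k)
  then show ?case using weq_cancel_full[of "replicate k full @ x" "replicate k full @ y"] by simp
qed simp

lemma weq_rot: "weq u v \<Longrightarrow> weq (map rot u) (map rot v)"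
proof (induction rule: weq.induct)
  case (refl u)
  then show ?case by (intro weq.refl) (auto simp: nc_rot)
next
  case (sym u v)
  show ?case by (rule weq.sym) (rule sym.IH)
next
  case (trans u v w)
  show ?case by (rule weq.trans) (rule trans.IH)+
next
  case (mul u v A B)
  have "rot B \<subseteq> rc (rot A)" using mul(4) rot_mono[of B "rc A"] mul by (simp add: rc_rot rot_rc)
  moreover have "\<forall>A\<in>set (map rot u @ map rot v). nc A" using mul nc_rot by auto
  ultimately show ?case using weq.mul[of "map rot u" "map rot v" "rot A" "rot B"] mul by (simp add: nc_rot rot_mul)
next
  case (one u v)
  then have "\<forall>A\<in>set (map rot u @ map rot v). nc A" using nc_rot by auto
  then show ?case using weq.one[of "map rot u" "map rot v"] by (simp add: rot_diag)
qed

lemma weq_funpow_rot: "weq u v \<Longrightarrow> weq (map (rot ^^ k) u) (map (rot ^^ k) v)"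
proof (induction k)
  case (Suc k)
  then show ?case using weq_rot[of "map (rot ^^ k) u" "map (rot ^^ k) v"] by (simp add: o_def)
qed simp

lemma weq_complement: assumes "nc A" shows "weq [rot A, lc A] [full]" "weq [lc A, A] [full]"
  using weq_quotient[OF nc_rot[OF assms] nc_full] weq_quotient[OF nc_lc'[OF assms] nc_full] assms
  by (auto simp: rc_rot rc_lc nc_rot nc_sub lc_sub Int_absorb2)

lemma weq_full_commute1: assumes "nc A" shows "weq [rot A, full] [full, A]"
proof -
  have "weq ([rot A] @ [full]) ([rot A] @ [lc A, A])"
    by (intro weq_append weq.refl weq.sym[OF weq_complement(2)[OF assms]]) (simp add: nc_rot assms)
  also have "\<dots> = [rot A, lc A] @ [A]" by simp
  also have "weq \<dots> ([full] @ [A])"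
    by (intro weq_append weq.refl weq_complement assms) (simp add: assms)
  finally show ?thesis by simp
qed

lemma weq_full_commute: "\<forall>A\<in>set x. nc A \<Longrightarrow> weq (map rot x @ [full]) (full # x)"
proof (induction x)
  case Nil
  show ?case using weq.refl[of "[full]"] by (simp add: nc_full)
next
  case (Cons A x)
  have "weq (rot A # map rot x @ [full]) (rot A # full # x)" using Cons by (intro weq_Cons) (auto simp: nc_rot)
  also have "weq \<dots> ([full, A] @ x)"
    using weq_append[OF weq_full_commute1[of A] weq.refl[of x]] Cons.prems by simp
  finally show ?case by simp
qed

lemma weq_fulls_commute:
  "\<forall>A\<in>set x. nc A \<Longrightarrow> weq (map (rot ^^ k) x @ replicate k full) (replicate k full @ x)"
proof (induction k arbitrary: x)
  case 0
  then show ?case by (auto intro: weq.refl)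
next
  case (Suc k)
  have "weq (map (rot ^^ k) (map rot x) @ replicate k full @ [full]) ((replicate k full @ map rot x) @ [full])"
    using weq_append[OF Suc.IH[of "map rot x"] weq.refl[of "[full]"]] Suc.prems by (auto simp: nc_rot nc_full)
  also have "\<dots> = replicate k full @ (map rot x @ [full])" by simp
  also have "weq \<dots> (replicate k full @ full # x)"
    using weq_full_commute[OF Suc.prems] by (intro weq_append weq.refl) (auto simp: nc_full)
  finally show ?case by (simp add: funpow_Suc_right o_def replicate_append_same replicate_app_Cons_same del: funpow.simps)
qed

lemma fulls_add: "replicate k full @ replicate l full @ x = replicate (k + l) full @ x"
  by (simp add: replicate_add)

text \<open>
  A pair \<open>(m, x)\<close> stands for the fraction \<open>\<delta>\<^sup>-\<^sup>m x\<close>. Two fractions are compared after multiplication by a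
  power of \<open>\<delta>\<close>, and in a product the denominator of the second factor is moved to the left by \<open>rot\<close>.
\<close>

definition feq :: "nat \<times> (nat \<times> nat) set list \<Rightarrow> nat \<times> (nat \<times> nat) set list \<Rightarrow> bool" where
  "feq p q \<longleftrightarrow> weq (replicate (fst q) full @ snd p) (replicate (fst p) full @ snd q)"

definition fmul ::
    "nat \<times> (nat \<times> nat) set list \<Rightarrow> nat \<times> (nat \<times> nat) set list \<Rightarrow> nat \<times> (nat \<times> nat) set list" where
  "fmul p q = (fst p + fst q, map (rot ^^ fst q) (snd p) @ snd q)"

lemma feq_words: "feq p q \<Longrightarrow> (\<forall>A\<in>set (snd p). nc A) \<and> (\<forall>A\<in>set (snd q). nc A)"
  using weq_words by (auto simp: feq_def)

lemma weq_fulls: "weq x y \<Longrightarrow> weq (replicate k full @ x) (replicate k full @ y)"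
  by (intro weq_append weq.refl) (auto simp: nc_full)

lemma feq_refl: "\<forall>A\<in>set (snd p). nc A \<Longrightarrow> feq p p"
  unfolding feq_def by (rule weq.refl) (auto simp: nc_full)

lemma feq_sym: "feq p q \<Longrightarrow> feq q p"
  by (auto simp: feq_def intro: weq.sym)

lemma feq_trans: assumes "feq p q" "feq q r" shows "feq p r"
proof -
  obtain m x l y k z where [simp]: "p = (m, x)" "q = (l, y)" "r = (k, z)" by (metis surj_pair)
  have "weq (replicate k full @ replicate l full @ x) (replicate k full @ replicate m full @ y)"
    using assms(1) weq_fulls by (simp add: feq_def)
  also have "\<dots> = replicate m full @ replicate k full @ y"
    by (simp add: fulls_add add.commute)
  also have "weq \<dots> (replicate m full @ replicate l full @ z)"
    using assms(2) weq_fulls by (simp add: feq_def)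
  finally have "weq (replicate l full @ replicate k full @ x) (replicate l full @ replicate m full @ z)"
    by (simp add: fulls_add add.commute)
  then show ?thesis using weq_cancel_fulls by (auto simp: feq_def)
qed

lemma feq_fmul: assumes "feq p p'" "feq q q'" shows "feq (fmul p q) (fmul p' q')"
proof -
  obtain m x m' x' l y l' y' where [simp]: "p = (m, x)" "p' = (m', x')" "q = (l, y)" "q' = (l', y')"
    by (metis surj_pair)
  have w: "\<forall>A\<in>set x. nc A" "\<forall>A\<in>set x'. nc A" "\<forall>A\<in>set y. nc A" "\<forall>A\<in>set y'. nc A"
    using feq_words assms by auto
  have Tx: "\<forall>A\<in>set (map (rot ^^ k) x). nc A" for k using w by (auto intro: nc_funpow_rot)
  have full: "(rot ^^ k) full = full" for k
    by (induction k) (simp_all add: rot_full)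
  have f1: "weq (replicate l' full @ map (rot ^^ l) x) (map (rot ^^ (l' + l)) x @ replicate l' full)"
    using weq.sym[OF weq_fulls_commute[OF Tx[of l], of l']] by (simp add: funpow_add comp_assoc)
  have f2: "weq (map (rot ^^ (l + l')) x @ replicate l full) (replicate l full @ map (rot ^^ l') x)"
    using weq_fulls_commute[OF Tx[of l'], of l] by (simp add: funpow_add comp_assoc)
  have e1: "weq (replicate l' full @ y) (replicate l full @ y')" using assms(2) by (simp add: feq_def)
  have e2: "weq (replicate m' full @ map (rot ^^ l') x) (replicate m full @ map (rot ^^ l') x')"
    using weq_funpow_rot[of "replicate m' full @ x" "replicate m full @ x'" l'] assms(1) by (simp add: feq_def full)
  have "weq ((replicate l' full @ map (rot ^^ l) x) @ y) ((map (rot ^^ (l' + l)) x @ replicate l' full) @ y)"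
    using f1 weq.refl[OF w(3)] by (rule weq_append)
  also have "\<dots> = map (rot ^^ (l' + l)) x @ (replicate l' full @ y)" by simp
  also have "weq \<dots> (map (rot ^^ (l' + l)) x @ (replicate l full @ y'))"
    using weq.refl[OF Tx] e1 by (rule weq_append)
  also have "\<dots> = (map (rot ^^ (l + l')) x @ replicate l full) @ y'" by (simp add: add.commute)
  also have "weq \<dots> ((replicate l full @ map (rot ^^ l') x) @ y')"
    using f2 weq.refl[OF w(4)] by (rule weq_append)
  finally have "weq (replicate m' full @ replicate l' full @ map (rot ^^ l) x @ y)
      (replicate m' full @ replicate l full @ map (rot ^^ l') x @ y')"
    using weq_fulls[of _ _ m'] by simp
  also have "\<dots> = replicate l full @ ((replicate m' full @ map (rot ^^ l') x) @ y')"
    by (simp add: fulls_add add.commute)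
  also have "weq \<dots> (replicate l full @ ((replicate m full @ map (rot ^^ l') x') @ y'))"
    using weq_fulls[OF weq_append[OF e2 weq.refl[OF w(4)]]] .
  finally show ?thesis
    by (simp add: feq_def fmul_def fulls_add add.commute)
qed

text \<open>
  The partition whose only nontrivial block is \<open>{i, j}\<close>, obtained as a closure.
\<close>

definition chord :: "nat \<Rightarrow> nat \<Rightarrow> (nat \<times> nat) set" where
  "chord i j = lc (rc {(i, j)})"

lemma nc_chord: "nc (chord i j)"
  unfolding chord_def by (intro nc_lc rc_sub)

lemma rc_chord: "(i, j) \<in> full \<Longrightarrow> rc (chord i j) = rc {(i, j)}"
  unfolding chord_def by (intro rc_lc nc_rc) simp

lemma chord_sub_iff: assumes "nc A" "(i, j) \<in> full" shows "chord i j \<subseteq> A \<longleftrightarrow> (i, j) \<in> A"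
proof
  assume "chord i j \<subseteq> A"
  then show "(i, j) \<in> A" using sub_lc_rc[of "{(i, j)}"] assms by (auto simp: chord_def)
next
  assume "(i, j) \<in> A"
  then have "lc (rc {(i, j)}) \<subseteq> lc (rc A)" by (intro lc_antimono rc_antimono) simp
  then show "chord i j \<subseteq> A" using lc_rc[OF assms(1)] by (simp add: chord_def)
qed

lemma weq_tr2:
  assumes "(i, j) \<in> full" "(k, l) \<in> full" "(i', j') \<in> full" "(k', l') \<in> full"
    and "same_side (k, l) (i, j)" "same_side (k', l') (i', j')"
    and "rc {(i, j), (k, l)} = rc {(i', j'), (k', l')}"
  shows "weq [chord i j, chord k l] [chord i' j', chord k' l']"
proof -
  have sub: "chord k l \<subseteq> rc (chord i j)" if "(i, j) \<in> full" "(k, l) \<in> full" "same_side (k, l) (i, j)" for i j k l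
  proof -
    have "(k, l) \<in> rc {(i, j)}" using that by (simp add: rc_def)
    then show ?thesis using chord_sub_iff[OF nc_rc, of "{(i, j)}"] that by (simp add: rc_chord)
  qed
  have "mul (chord i j) (chord k l) = mul (chord i' j') (chord k' l')"
  proof (rule rc_inj)
    have "rc {a, b} = rc {a} \<inter> rc {b}" for a b by (auto simp: rc_def)
    then show "rc (mul (chord i j) (chord k l)) = rc (mul (chord i' j') (chord k' l'))"
      using assms by (simp add: rc_mul nc_chord rc_chord)
  qed (intro nc_mul nc_chord)+
  moreover have "chord k l \<subseteq> rc (chord i j)" "chord k' l' \<subseteq> rc (chord i' j')"
    using sub assms by blast+
  ultimately show ?thesis
    using weq_mul2[OF nc_chord nc_chord, of k l i j] weq.sym[OF weq_mul2[OF nc_chord nc_chord, of k' l' i' j']]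
    by (auto intro: weq.trans)
qed

text \<open>
  The three factorisations of the partition with single block \<open>{x, y, z}\<close>.
\<close>

lemma weq_triangle:
  assumes "1 \<le> x" "x < y" "y < z" "z \<le> n"
  shows "weq [chord y z, chord x y] [chord x y, chord x z]" "weq [chord x y, chord x z] [chord x z, chord y z]"
  by (rule weq_tr2; use assms in \<open>auto simp: full_def same_side_def outside_def rc_def\<close>)+

lemma weq_far:
  assumes "1 \<le> x" "x < y" "y < z" "z < w" "w \<le> n"
  shows "weq [chord x y, chord z w] [chord z w, chord x y]" "weq [chord x w, chord y z] [chord y z, chord x w]"
  by (rule weq_tr2; use assms in \<open>auto simp: full_def same_side_def outside_def rc_def\<close>)+

text \<open>
  The inverse of a generator is \<open>\<delta>\<^sup>-\<^sup>1\<close> times the left complement of its chord.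
\<close>

fun frac :: "artin_word \<Rightarrow> nat \<times> (nat \<times> nat) set list" where
  "frac [] = (0, [])"
| "frac ((i, b) # w) = fmul (if b then (0, [chord i (Suc i)]) else (1, [lc (chord i (Suc i))])) (frac w)"

lemma fmul_assoc: "fmul (fmul p q) r = fmul p (fmul q r)"
  by (simp add: fmul_def add.commute add.left_commute flip: funpow_add)

lemma frac_append: "frac (u @ v) = fmul (frac u) (frac v)"
  by (induction u rule: frac.induct) (auto simp: fmul_assoc, simp add: fmul_def)

lemma nc_frac: "\<forall>A\<in>set (snd (frac w)). nc A"
  by (induction w rule: frac.induct) (auto simp: fmul_def intro!: nc_funpow_rot nc_chord nc_lc' split: if_splits)

lemma feq_pos: "feq (0, u) (0, v) \<longleftrightarrow> weq u v"
  by (simp add: feq_def)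

text \<open>
  For the braid relation, \<open>t s t = t r s = s t s\<close> where \<open>r\<close> is the third side of the triangle of \<open>t\<close> and
  \<open>s\<close>; the other relations hold because disjoint chords commute and a chord and its complement make
  up \<open>\<delta>\<close>.
\<close>

lemma artin_eq_feq: "artin_eq n u v \<Longrightarrow> feq (frac u) (frac v)"
proof (induction rule: artin_eq.induct)
  case (refl u)
  then show ?case using nc_frac feq_refl by blast
next
  case (cancel i b)
  then show ?case using weq_complement[OF nc_chord[of i "Suc i"]]
    by (cases b) (simp_all add: fmul_def feq_def)
next
  case (far i j)
  then show ?case using weq_far(1)[of i "Suc i" j "Suc j"] by (simp add: fmul_def feq_pos)
next
  case (braid i)
  let ?t = "chord i (Suc i)" and ?s = "chord (Suc i) (Suc (Suc i))" and ?r = "chord i (Suc (Suc i))"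
  note tri = weq_triangle[of i "Suc i" "Suc (Suc i)"]
  have "weq [?t, ?s, ?t] ([?t] @ [?r, ?s])"
    using weq_append[OF weq.refl[of "[?t]"] weq.trans[OF tri]] nc_chord braid by auto
  also have "[?t] @ [?r, ?s] = [?t, ?r] @ [?s]" by simp
  also have "weq \<dots> ([?s, ?t] @ [?s])"
    using weq_append[OF weq.sym[OF tri(1)] weq.refl[of "[?s]"]] nc_chord braid by auto
  finally show ?case by (simp add: fmul_def feq_pos)
next
  case (trans u v w)
  then show ?case by (blast intro: feq_trans)
qed (auto intro: feq_sym feq_fmul simp: frac_append)

end

section \<open>Relations between the band generators\<close>

lemma (in group) l_inv_assoc: "x \<in> carrier G \<Longrightarrow> y \<in> carrier G \<Longrightarrow> inv x \<otimes> (x \<otimes> y) = y"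
  and r_inv_assoc: "x \<in> carrier G \<Longrightarrow> y \<in> carrier G \<Longrightarrow> x \<otimes> (inv x \<otimes> y) = y"
  by (simp_all flip: m_assoc)

lemma (in group) commute_inv:
  assumes "x \<in> carrier G" "z \<in> carrier G" "z \<otimes> x = x \<otimes> z"
  shows "z \<otimes> inv x = inv x \<otimes> z"
proof -
  have "inv x \<otimes> (z \<otimes> x) \<otimes> inv x = inv x \<otimes> (x \<otimes> z) \<otimes> inv x" using assms by simp
  then show ?thesis using assms(1,2) by (simp add: m_assoc l_inv_assoc)
qed

lemma (in group) commute_mult:
  assumes "x \<in> carrier G" "y \<in> carrier G" "z \<in> carrier G" "z \<otimes> x = x \<otimes> z" "z \<otimes> y = y \<otimes> z"
  shows "z \<otimes> (x \<otimes> y) = x \<otimes> y \<otimes> z"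
proof -
  have "z \<otimes> (x \<otimes> y) = x \<otimes> z \<otimes> y" using assms by (simp flip: m_assoc)
  also have "\<dots> = x \<otimes> (y \<otimes> z)" using assms by (simp add: m_assoc)
  finally show ?thesis using assms by (simp add: m_assoc)
qed

lemma (in group) commute_conj:
  assumes "x \<in> carrier G" "y \<in> carrier G" "z \<in> carrier G" "z \<otimes> x = x \<otimes> z" "z \<otimes> y = y \<otimes> z"
  shows "z \<otimes> (x \<otimes> y \<otimes> inv x) = x \<otimes> y \<otimes> inv x \<otimes> z"
  using assms by (intro commute_mult commute_inv) simp_all

lemma (in group) conj_mult:
  assumes "x \<in> carrier G" "y \<in> carrier G" "z \<in> carrier G"
  shows "x \<otimes> y \<otimes> inv x \<otimes> (x \<otimes> z \<otimes> inv x) = x \<otimes> (y \<otimes> z) \<otimes> inv x"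
  using assms by (simp add: m_assoc l_inv_assoc)

lemma (in group) conj_eqI:
  assumes "x \<in> carrier G" "y \<in> carrier G" "z \<in> carrier G" "x \<otimes> y = z \<otimes> x"
  shows "x \<otimes> y \<otimes> inv x = z"
  using assms by (simp add: m_assoc)

context dual_braid
begin

sublocale G: group "braid_group n"
  by (rule group_braid_group)

abbreviation gmult :: "braid \<Rightarrow> braid \<Rightarrow> braid" (infixl "\<cdot>" 70) where
  "x \<cdot> y \<equiv> x \<otimes>\<^bsub>braid_group n\<^esub> y"

abbreviation ginv :: "braid \<Rightarrow> braid" where
  "ginv x \<equiv> inv\<^bsub>braid_group n\<^esub> x"

abbreviation idB :: "braid" where
  "idB \<equiv> \<one>\<^bsub>braid_group n\<^esub>"

abbreviation Bn :: "braid set" where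
  "Bn \<equiv> carrier (braid_group n)"

abbreviation sig :: "nat \<Rightarrow> braid" where
  "sig \<equiv> artin_gen n"

abbreviation band :: "nat \<Rightarrow> nat \<Rightarrow> braid" where
  "band \<equiv> band_gen n"

lemma Bn_eq: "Bn = braid_class n ` artin_words n"
  by (simp add: braid_group_def)

lemma one_eq: "idB = braid_class n []"
  by (simp add: braid_group_def)

lemma words_append: "u \<in> artin_words n \<Longrightarrow> v \<in> artin_words n \<Longrightarrow> u @ v \<in> artin_words n"
  by (auto simp: artin_words_def)

lemma class_eq_iff:
  assumes "u \<in> artin_words n"
  shows "braid_class n u = braid_class n v \<longleftrightarrow> artin_eq n u v"
  using assms by (auto simp: braid_class_def intro: artin_eq.refl artin_eq.sym artin_eq.trans)

lemma gen_word: "1 \<le> i \<Longrightarrow> i < n \<Longrightarrow> [(i, b)] \<in> artin_words n"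
  by (simp add: artin_words_def)

lemma sig_closed [simp]: "1 \<le> i \<Longrightarrow> i < n \<Longrightarrow> sig i \<in> Bn"
  using gen_word[of i True] by (auto simp: Bn_eq artin_gen_def)

lemma sig_inv: assumes "1 \<le> i" "i < n" shows "ginv (sig i) = braid_class n [(i, False)]"
proof (rule G.inv_equality)
  have w: "[(i, b)] \<in> artin_words n" for b using assms by (rule gen_word)
  show "braid_class n [(i, False)] \<cdot> sig i = idB"
    using w artin_eq.cancel[OF assms, of False]
    by (simp add: artin_gen_def braid_class_mult one_eq class_eq_iff words_append[OF w w, simplified])
  show "braid_class n [(i, False)] \<in> Bn" using w by (auto simp: Bn_eq)
qed (use assms in simp)

lemma sig_far: assumes "1 \<le> i" "i + 2 \<le> j" "j < n" shows "sig i \<cdot> sig j = sig j \<cdot> sig i"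
proof -
  have w: "[(i, True)] \<in> artin_words n" "[(j, True)] \<in> artin_words n"
    using assms gen_word by auto
  then show ?thesis using artin_eq.far[OF assms] words_append[OF w]
    by (simp add: artin_gen_def braid_class_mult class_eq_iff)
qed

lemma sig_braid: assumes "1 \<le> i" "i + 1 < n"
  shows "sig i \<cdot> sig (i + 1) \<cdot> sig i = sig (i + 1) \<cdot> sig i \<cdot> sig (i + 1)"
proof -
  have w: "[(i, True)] \<in> artin_words n" "[(i + 1, True)] \<in> artin_words n"
    using assms gen_word by auto
  then show ?thesis using artin_eq.braid[OF assms] words_append[OF words_append[OF w] w(1)]
      words_append[OF w] words_append[OF w(2,1)]
    by (simp add: artin_gen_def braid_class_mult class_eq_iff)
qed

lemma braid_prod_Cons: "braid_prod n (x # xs) = x \<cdot> braid_prod n xs"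
  by (simp add: braid_prod_def)

lemma braid_prod_Nil: "braid_prod n [] = idB"
  by (simp add: braid_prod_def)

lemma braid_prod_closed: "set xs \<subseteq> Bn \<Longrightarrow> braid_prod n xs \<in> Bn"
  by (induction xs) (auto simp: braid_prod_Cons braid_prod_Nil)

lemma band_Suc_self: "1 \<le> i \<Longrightarrow> i < n \<Longrightarrow> band i (Suc i) = sig i"
  by (simp add: band_gen_def braid_prod_Nil)

lemma conj_word_closed: "1 \<le> i \<Longrightarrow> j \<le> n \<Longrightarrow> braid_prod n (map sig (rev [i..<j])) \<in> Bn"
  by (intro braid_prod_closed) auto

lemma band_closed [simp]: "1 \<le> i \<Longrightarrow> i < j \<Longrightarrow> j \<le> n \<Longrightarrow> band i j \<in> Bn"
  using conj_word_closed[of "i + 1" j] by (simp add: band_gen_def Let_def)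

lemma band_Suc:
  assumes "1 \<le> i" "i < j" "j < n"
  shows "band i (Suc j) = sig j \<cdot> band i j \<cdot> ginv (sig j)"
proof -
  define c where "c = braid_prod n (map sig (rev [i + 1..<j]))"
  have c: "c \<in> Bn" unfolding c_def using assms conj_word_closed[of "i + 1" j] by simp
  have "braid_prod n (map sig (rev [i + 1..<Suc j])) = sig j \<cdot> c"
    using assms by (simp add: c_def braid_prod_Cons)
  moreover have "band i j = c \<cdot> sig i \<cdot> ginv c" by (simp add: band_gen_def Let_def c_def)
  ultimately show ?thesis
    using c assms unfolding band_gen_def Let_def by (simp add: G.m_assoc G.inv_mult_group)
qed

lemma band_induct [consumes 1, case_names base step]:
  assumes "i < j" "P (Suc i)" "\<And>j. i < j \<Longrightarrow> P j \<Longrightarrow> P (Suc j)" shows "P (j::nat)"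
  using assms(1)
proof (induction j)
  case (Suc j)
  then show ?case using assms(2,3) by (cases "i = j") auto
qed simp

lemma band_commute_above:
  assumes "i < j" "1 \<le> i" "j < k" "k < n" shows "sig k \<cdot> band i j = band i j \<cdot> sig k"
  using assms(1,3)
proof (induction j rule: band_induct)
  case base
  then show ?case using assms sig_far[of i k] by (simp add: band_Suc_self)
next
  case (step j)
  then show ?case using assms sig_far[of j k] by (simp add: band_Suc G.commute_conj)
qed

text \<open>
  The base case \<open>j = k + 2\<close> is where something happens: there the generator is \<open>w b w\<^sup>-\<^sup>1\<close> for
  \<open>w = \<sigma>\<^sub>k\<^sub>+\<^sub>1 \<sigma>\<^sub>k\<close>, and \<open>\<sigma>\<^sub>k w = w \<sigma>\<^sub>k\<^sub>+\<^sub>1\<close> by the braid relation, while \<open>\<sigma>\<^sub>k\<^sub>+\<^sub>1\<close> commutes with \<open>b\<close>.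
\<close>

lemma band_commute_inside:
  assumes "1 \<le> i" "i < k" "Suc k < j" "j \<le> n" shows "sig k \<cdot> band i j = band i j \<cdot> sig k"
  using assms(3,4)
proof (induction j rule: band_induct)
  case base
  define x y b where "x = sig k" "y = sig (Suc k)" "b = band i k"
  have cl: "x \<in> Bn" "y \<in> Bn" "b \<in> Bn" using base assms by (auto simp: x_y_b_def)
  have yb: "y \<cdot> b = b \<cdot> y" using band_commute_above[of i k "Suc k"] base assms by (simp add: x_y_b_def)
  have br: "x \<cdot> (y \<cdot> x) = y \<cdot> x \<cdot> y"
    using sig_braid[of k] base assms cl by (simp add: x_y_b_def G.m_assoc)
  define w where "w = y \<cdot> x"
  have w: "w \<in> Bn" "x \<cdot> w = w \<cdot> y" using br cl by (auto simp: w_def)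
  have yw: "y \<cdot> ginv w = ginv w \<cdot> x"
  proof -
    have "ginv w \<cdot> (x \<cdot> w) \<cdot> ginv w = ginv w \<cdot> (w \<cdot> y) \<cdot> ginv w" using w by simp
    then show ?thesis using w(1) cl by (simp add: G.m_assoc G.l_inv_assoc)
  qed
  have "x \<cdot> (w \<cdot> b \<cdot> ginv w) = x \<cdot> w \<cdot> (b \<cdot> ginv w)" using w(1) cl by (simp add: G.m_assoc)
  also have "\<dots> = w \<cdot> (y \<cdot> b) \<cdot> ginv w" unfolding w(2) using w(1) cl by (simp add: G.m_assoc)
  also have "\<dots> = w \<cdot> b \<cdot> (y \<cdot> ginv w)" using w(1) cl by (simp add: yb G.m_assoc)
  also have "\<dots> = w \<cdot> b \<cdot> ginv w \<cdot> x" using w(1) cl by (simp add: yw G.m_assoc)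
  finally have "x \<cdot> (w \<cdot> b \<cdot> ginv w) = w \<cdot> b \<cdot> ginv w \<cdot> x" .
  moreover have "band i (Suc (Suc k)) = w \<cdot> b \<cdot> ginv w"
    using base assms cl by (simp add: band_Suc w_def G.inv_mult_group G.m_assoc flip: x_y_b_def)
  ultimately show ?case by (simp add: x_y_b_def)
next
  case (step j)
  then show ?case using assms sig_far[of k j] by (simp add: band_Suc G.commute_conj)
qed

lemma band_commuteI:
  assumes "i < j" "1 \<le> i" "j \<le> n" "z \<in> Bn" "\<And>m. i \<le> m \<Longrightarrow> m < j \<Longrightarrow> sig m \<cdot> z = z \<cdot> sig m"
  shows "band i j \<cdot> z = z \<cdot> band i j"
proof -
  have "z \<cdot> band i j = band i j \<cdot> z"
    using assms(1,3,5)
  proof (induction j rule: band_induct)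
    case base
    then show ?case using assms(2) by (simp add: band_Suc_self)
  next
    case (step j)
    then show ?case using assms(2,4) by (simp add: band_Suc G.commute_conj)
  qed
  then show ?thesis by simp
qed

lemma band_far:
  assumes "1 \<le> x" "x < y" "y < z" "z < w" "w \<le> n"
  shows "band x y \<cdot> band z w = band z w \<cdot> band x y" "band x w \<cdot> band y z = band y z \<cdot> band x w"
proof -
  show "band x y \<cdot> band z w = band z w \<cdot> band x y"
    by (rule band_commuteI[symmetric]) (use assms band_commute_above[of x y] in simp_all)
  show "band x w \<cdot> band y z = band y z \<cdot> band x w"
    by (rule band_commuteI[symmetric]) (use assms band_commute_inside[of x _ w] in simp_all)
qed

text \<open>
  In the step, the generator is \<open>b = y x y\<^sup>-\<^sup>1 = x\<^sup>-\<^sup>1 y x\<close> where \<open>x\<close> commutes with \<open>z\<close>; conjugation by \<open>x\<close> thus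
  reduces the claim for \<open>b\<close> and \<open>z\<close> to the braid relation of \<open>y\<close> and \<open>z\<close>.
\<close>

lemma band_braid:
  assumes "i < j" "1 \<le> i" "j < n" shows "band i j \<cdot> sig j \<cdot> band i j = sig j \<cdot> band i j \<cdot> sig j"
  using assms(1,3)
proof (induction j rule: band_induct)
  case base
  then show ?case using assms sig_braid[of i] by (simp add: band_Suc_self)
next
  case (step j)
  define x y z where "x = band i j" "y = sig j" "z = sig (Suc j)"
  have cl: "x \<in> Bn" "y \<in> Bn" "z \<in> Bn" using step assms by (auto simp: x_y_z_def)
  have xyx: "x \<cdot> y \<cdot> x = y \<cdot> x \<cdot> y" using step by (simp add: x_y_z_def)
  have zx: "z \<cdot> x = x \<cdot> z" using band_commute_above[of i j "Suc j"] step assms by (simp add: x_y_z_def)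
  have yzy: "y \<cdot> z \<cdot> y = z \<cdot> y \<cdot> z" using sig_braid[of j] step assms by (simp add: x_y_z_def)
  define b where "b = y \<cdot> x \<cdot> ginv y"
  have b: "b \<in> Bn" using cl by (simp add: b_def)
  \<comment> \<open>the braid relation between x and y moves the conjugation from y to x\<close>
  have b2: "b = ginv x \<cdot> y \<cdot> x"
  proof -
    have "ginv x \<cdot> (x \<cdot> y \<cdot> x) \<cdot> ginv y = ginv x \<cdot> (y \<cdot> x \<cdot> y) \<cdot> ginv y" using xyx by simp
    then show ?thesis using cl by (simp add: b_def G.m_assoc G.l_inv_assoc)
  qed
  have zx': "z = ginv x \<cdot> z \<cdot> x" using zx cl by (simp add: G.m_assoc G.l_inv_assoc)
  have cm: "ginv x \<cdot> u \<cdot> x \<cdot> (ginv x \<cdot> v \<cdot> x) = ginv x \<cdot> (u \<cdot> v) \<cdot> x" if "u \<in> Bn" "v \<in> Bn" for u v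
    using that cl by (simp add: G.m_assoc G.r_inv_assoc)
  have "ginv x \<cdot> y \<cdot> x \<cdot> (ginv x \<cdot> z \<cdot> x) \<cdot> (ginv x \<cdot> y \<cdot> x) = ginv x \<cdot> (y \<cdot> z \<cdot> y) \<cdot> x"
    using cl by (simp add: cm)
  also have "\<dots> = ginv x \<cdot> z \<cdot> x \<cdot> (ginv x \<cdot> y \<cdot> x) \<cdot> (ginv x \<cdot> z \<cdot> x)"
    using cl by (simp add: cm yzy)
  finally have "b \<cdot> z \<cdot> b = z \<cdot> b \<cdot> z" by (simp only: b2[symmetric] zx'[symmetric])
  then show ?case using step assms by (simp add: band_Suc b_def x_y_z_def)
qed

lemma band_triangle:
  assumes "y < z" "1 \<le> x" "x < y" "z \<le> n"
  shows "band y z \<cdot> band x y = band x z \<cdot> band y z \<and> band x y \<cdot> band x z = band y z \<cdot> band x y"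
  using assms(1,4)
proof (induction z rule: band_induct)
  case base
  have cl: "sig y \<in> Bn" "band x y \<in> Bn" using assms base by auto
  have br: "band x y \<cdot> sig y \<cdot> band x y = sig y \<cdot> band x y \<cdot> sig y" using band_braid[of x y] assms base by simp
  have "band x y \<cdot> (sig y \<cdot> band x y \<cdot> ginv (sig y)) = (band x y \<cdot> sig y \<cdot> band x y) \<cdot> ginv (sig y)"
    using cl by (simp add: G.m_assoc)
  also have "\<dots> = sig y \<cdot> band x y" using cl by (simp add: br G.m_assoc)
  finally show ?case using assms base cl by (simp add: band_Suc band_Suc_self G.m_assoc)
next
  case (step z)
  have cl: "sig z \<in> Bn" "band x y \<in> Bn" "band y z \<in> Bn" "band x z \<in> Bn" using assms step by auto
  have "sig z \<cdot> band x y = band x y \<cdot> sig z" using band_commute_above[of x y z] assms step by simp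
  then have "sig z \<cdot> band x y \<cdot> ginv (sig z) = band x y" using cl by (intro G.conj_eqI) auto
  then show ?case
    using G.conj_mult[OF cl(1,3,2)] G.conj_mult[OF cl(1,4,3)] G.conj_mult[OF cl(1,2,4)] step assms cl
    by (simp add: band_Suc)
qed

section \<open>Simple braids\<close>

text \<open>
  The exponent sum, which is the length for positive words, is invariant under the Artin relations.
  It will bound the infimum and measure the shortening of positive braids.
\<close>

fun wexp :: "artin_word \<Rightarrow> int" where
  "wexp [] = 0"
| "wexp ((i, b) # w) = (if b then 1 else - 1) + wexp w"

lemma wexp_append: "wexp (u @ v) = wexp u + wexp v"
  by (induction u rule: wexp.induct) auto

lemma wexp_cong: "artin_eq n u v \<Longrightarrow> wexp u = wexp v"
  by (induction rule: artin_eq.induct) (auto simp: wexp_append)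

definition bexp :: "braid \<Rightarrow> int" where
  "bexp x = wexp (SOME w. w \<in> x)"

lemma bexp_class: assumes "w \<in> artin_words n" shows "bexp (braid_class n w) = wexp w"
proof -
  have "(SOME v. v \<in> braid_class n w) \<in> braid_class n w"
    by (rule someI[of _ w]) (simp add: braid_class_def artin_eq.refl assms)
  then show ?thesis by (simp add: bexp_def braid_class_def wexp_cong)
qed

lemma bexp_mult: "x \<in> Bn \<Longrightarrow> y \<in> Bn \<Longrightarrow> bexp (x \<cdot> y) = bexp x + bexp y"
  by (auto simp: Bn_eq braid_class_mult bexp_class words_append wexp_append)

lemma bexp_one: "bexp idB = 0"
  using bexp_mult[of idB idB] by simp

lemma bexp_inv: "x \<in> Bn \<Longrightarrow> bexp (ginv x) = - bexp x"
  using bexp_mult[of x "ginv x"] by (simp add: bexp_one)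

lemma bexp_sig: "1 \<le> i \<Longrightarrow> i < n \<Longrightarrow> bexp (sig i) = 1"
  using gen_word[of i True] by (simp add: artin_gen_def bexp_class)

lemma bexp_band: assumes "i < j" "1 \<le> i" "j \<le> n" shows "bexp (band i j) = 1"
  using assms(1,3)
proof (induction j rule: band_induct)
  case base
  then show ?case using assms by (simp add: band_Suc_self bexp_sig)
next
  case (step j)
  then show ?case using assms by (simp add: band_Suc bexp_mult bexp_inv)
qed

text \<open>
  An arbitrary chord of a nontrivial partition, used to peel off one band generator at a time.
\<close>

definition pick :: "(nat \<times> nat) set \<Rightarrow> nat \<times> nat" where
  "pick A = (SOME p. p \<in> A \<and> fst p < snd p)"

lemma pick: assumes "nc A" "A \<noteq> diag" shows "pick A \<in> A" "fst (pick A) < snd (pick A)"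
proof -
  obtain p where "p \<in> A" "p \<notin> diag" using assms diag_sub by blast
  then have p: "p \<in> A" "fst p \<noteq> snd p" using nc_sub[OF assms(1)] by (auto simp: diag_def)
  have "\<exists>p. p \<in> A \<and> fst p < snd p"
  proof (cases "fst p < snd p")
    case False
    then have "(snd p, fst p) \<in> A \<and> snd p < fst p" using p nc_sym[OF assms(1), of "fst p" "snd p"] by auto
    then show ?thesis by (metis fst_conv snd_conv)
  qed (use p in blast)
  from someI_ex[OF this] show "pick A \<in> A" "fst (pick A) < snd (pick A)" by (simp_all add: pick_def)
qed

lemma quotient_smaller:
  assumes "nc A" "p \<in> A" "fst p < snd p"
  shows "nc (rc {p} \<inter> A)" "card (rc {p} \<inter> A) < card A"
proof -
  show "nc (rc {p} \<inter> A)" using assms nc_sub by (intro nc_Int nc_rc) auto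
  have "p \<notin> rc {p}" using assms(3) same_side_self[of "fst p" "snd p"] by (simp add: rc_def)
  then have "rc {p} \<inter> A \<subset> A" using assms(2) by blast
  then show "card (rc {p} \<inter> A) < card A" by (rule psubset_card_mono[OF nc_finite[OF assms(1)]])
qed

text \<open>
  The simple braid of a noncrossing partition. That the choice of chords is irrelevant is \<open>lift_step\<close>.
\<close>

function lift :: "(nat \<times> nat) set \<Rightarrow> braid" where
  "lift A = (if nc A \<and> A \<noteq> diag then band (fst (pick A)) (snd (pick A)) \<cdot> lift (rc {pick A} \<inter> A) else idB)"
  by auto
termination
  by (relation "measure card") (auto dest: quotient_smaller(2)[OF _ pick])

declare lift.simps [simp del]

lemma lift_diag: "lift diag = idB"
  by (subst lift.simps) simp

lemma in_nc: "nc A \<Longrightarrow> p \<in> A \<Longrightarrow> fst p \<in> {1..n} \<and> snd p \<in> {1..n}"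
  using nc_sub by (fastforce simp: full_def)

lemma band_closed_nc: "nc A \<Longrightarrow> (i, j) \<in> A \<Longrightarrow> i < j \<Longrightarrow> band i j \<in> Bn"
  using in_nc[of A "(i, j)"] by simp

lemma lift_closed [simp]: "lift A \<in> Bn"
proof (induction A rule: lift.induct)
  case (1 A)
  then show ?case
    using pick[of A] band_closed_nc[of A "fst (pick A)" "snd (pick A)"] by (subst lift.simps) auto
qed

text \<open>
  It must be shown that peeling off different chords first gives the same braid; the common value is
  called \<open>P\<close> below. If the chords share an endpoint, or are disjoint and do not cross, the induction
  hypothesis lets one peel off a second chord on each side, and a triangle or commutation relation
  applies. Crossing chords lie in one block of \<open>A\<close>, which therefore contains a chord that shares an
  endpoint with both.
\<close>

lemma lift_step:
  "nc A \<Longrightarrow> (i, j) \<in> A \<Longrightarrow> i < j \<Longrightarrow> lift A = band i j \<cdot> lift (rc {(i, j)} \<inter> A)"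
proof (induction "card A" arbitrary: A i j rule: less_induct)
  case less
  note A = less.prems(1)
  define P where "P i j = band i j \<cdot> lift (rc {(i, j)} \<inter> A)" for i j
  have two: "P i j = band i j \<cdot> band k l \<cdot> lift (rc {(k, l)} \<inter> (rc {(i, j)} \<inter> A))"
    if "(i, j) \<in> A" "i < j" "(k, l) \<in> A" "k < l" "same_side (k, l) (i, j)" for i j k l
  proof -
    have "(k, l) \<in> rc {(i, j)} \<inter> A" using that nc_sub[OF A] by (auto simp: rc_def)
    then have "lift (rc {(i, j)} \<inter> A) = band k l \<cdot> lift (rc {(k, l)} \<inter> (rc {(i, j)} \<inter> A))"
      using less.hyps[of "rc {(i, j)} \<inter> A"] quotient_smaller[OF A that(1)] that by simp
    then show ?thesis using that A by (simp add: P_def G.m_assoc band_closed_nc)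
  qed
  have eq2: "P i j = P i' j'"
    if "(i, j) \<in> A" "i < j" "(k, l) \<in> A" "k < l" "same_side (k, l) (i, j)"
      "(i', j') \<in> A" "i' < j'" "(k', l') \<in> A" "k' < l'" "same_side (k', l') (i', j')"
      "band i j \<cdot> band k l = band i' j' \<cdot> band k' l'" "rc {(i, j), (k, l)} = rc {(i', j'), (k', l')}"
    for i j k l i' j' k' l'
  proof -
    have "rc {(k, l)} \<inter> (rc {(i, j)} \<inter> A) = rc {(i, j), (k, l)} \<inter> A" for i j k l
      by (auto simp: rc_def)
    then show ?thesis using two[OF that(1-5)] two[OF that(6-10)] that by simp
  qed
  have tri: "P x y = P x z" "P y z = P x z" if "x < y" "y < z" "(x, y) \<in> A" "(y, z) \<in> A" for x y z
  proof -
    have xz: "(x, z) \<in> A" using that A nc_trans by blast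
    have b: "1 \<le> x" "z \<le> n" using in_nc[OF A] that by auto
    show "P y z = P x z"
      by (rule eq2[of y z x y x z y z])
        (use that xz b band_triangle[of y z x] in \<open>auto simp: same_side_def outside_def rc_def\<close>)
    show "P x y = P x z"
      by (rule eq2[of x y x z x z y z])
        (use that xz b band_triangle[of y z x] in \<open>auto simp: same_side_def outside_def rc_def\<close>)
  qed
  have share: "P i j = P k l" if ass: "(i, j) \<in> A" "i < j" "(k, l) \<in> A" "k < l" "{i, j} \<inter> {k, l} \<noteq> {}" for i j k l
  proof -
    have e: "(p, q) \<in> A" if "{p, q} \<subseteq> {i, j, k, l}" for p q
    proof -
      have "(i, k) \<in> A" "(i, j) \<in> A" "(k, l) \<in> A" "(i, i) \<in> A"
        using \<open>(i, j) \<in> A\<close> \<open>(k, l) \<in> A\<close> \<open>{i, j} \<inter> {k, l} \<noteq> {}\<close>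
        by (auto intro: nc_trans[OF A] nc_sym[OF A])
      then have "(i, p) \<in> A" "(i, q) \<in> A" using \<open>{p, q} \<subseteq> {i, j, k, l}\<close> by (auto intro: nc_trans[OF A])
      then show ?thesis by (auto intro: nc_trans[OF A] nc_sym[OF A])
    qed
    show ?thesis
    proof (cases "i = k \<and> j = l")
      case False
      then consider "i = k" "j < l" | "i = k" "l < j" | "j = l" "i < k" | "j = l" "k < i" | "j = k" | "i = l"
        using ass by force
      then show ?thesis
      proof cases
        case 1 then show ?thesis using tri(1)[of i j l] e[of j l] ass by simp
      next
        case 2 then show ?thesis using tri(1)[of i l j] e[of l j] ass by simp
      next
        case 3 then show ?thesis using tri(2)[of i k j] e[of i k] ass by simp
      next
        case 4 then show ?thesis using tri(2)[of k i j] e[of k i] ass by simp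
      next
        case 5 then show ?thesis using tri[of i j l] ass by simp
      next
        case 6 then show ?thesis using tri[of k i j] ass by simp
      qed
    qed simp
  qed
  have all: "P i j = P k l" if ij: "(i, j) \<in> A" "i < j" and kl: "(k, l) \<in> A" "k < l" and ik: "i < k" for i j k l
  proof (cases "{i, j} \<inter> {k, l} = {}")
    case True
    have b: "1 \<le> i" "j \<le> n" "l \<le> n" using in_nc[OF A] ij kl by auto
    consider "j < k" | "k < j" "l < j" | "k < j" "j < l" using True by force
    then show ?thesis
    proof cases
      case 1
      show ?thesis
        by (rule eq2[of i j k l k l i j])
          (use 1 ij kl b band_far[of i j k l] in \<open>auto simp: same_side_def outside_def rc_def\<close>)
    next
      case 2
      show ?thesis
        by (rule eq2[of i j k l k l i j])
          (use 2 ij kl b ik band_far[of i k l j] in \<open>auto simp: same_side_def outside_def rc_def\<close>)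
    next
      case 3
      then have "(i, k) \<in> A" using nc_noncrossing[OF A ij(1) kl(1)] ik by simp
      then show ?thesis using share[of i j i k] share[of i k k l] ij kl ik by simp
    qed
  next
    case False
    then show ?thesis using share ij kl by blast
  qed
  have same: "P i j = P k l" if "(i, j) \<in> A" "i < j" "(k, l) \<in> A" "k < l" for i j k l
  proof (cases i k rule: linorder_cases)
    case less
    then show ?thesis by (rule all[OF that])
  next
    case equal
    then show ?thesis by (intro share[OF that]) simp
  next
    case greater
    then show ?thesis by (rule all[OF that(3,4,1,2), symmetric])
  qed
  have "A \<noteq> diag" using less.prems by (auto simp: diag_def)
  then have "lift A = P (fst (pick A)) (snd (pick A))" using A by (subst lift.simps) (simp add: P_def)
  also have "\<dots> = P i j" using same[of "fst (pick A)" "snd (pick A)" i j] pick[OF A \<open>A \<noteq> diag\<close>] less.prems by simp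
  finally show ?case by (simp add: P_def)
qed

text \<open>
  Peel a chord \<open>p\<close> off \<open>A\<close>. The quotient of \<open>mul A C\<close> by \<open>p\<close> is again a product, of the quotient of \<open>A\<close>
  by \<open>p\<close> with \<open>C\<close>.
\<close>

lemma lift_mul:
  "nc A \<Longrightarrow> nc C \<Longrightarrow> C \<subseteq> rc A \<Longrightarrow> lift (mul A C) = lift A \<cdot> lift C"
proof (induction "card A" arbitrary: A rule: less_induct)
  case less
  note A = less.prems(1) and C = less.prems(2,3)
  show ?case
  proof (cases "A = diag")
    case True
    have "mul diag C = C" using C(1) lc_rc nc_sub[OF nc_rc'[OF C(1)]] by (simp add: mul_def rc_diag Int_absorb1)
    then show ?thesis using True by (simp add: lift_diag)
  next
    case False
    define p where "p = pick A"
    have p: "p \<in> A" "fst p < snd p" using pick[OF A False] by (auto simp: p_def)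
    define t where "t = chord (fst p) (snd p)"
    have pU: "(fst p, snd p) \<in> full" using p nc_sub[OF A] by auto
    have t: "nc t" "rc t = rc {p}" using rc_chord[OF pU] by (simp_all add: t_def nc_chord)
    have tA: "t \<subseteq> A" using chord_sub_iff[OF A pU] p by (simp add: t_def)
    define A' where "A' = rc {p} \<inter> A"
    have A': "nc A'" "card A' < card A" using quotient_smaller[OF A p] by (auto simp: A'_def)
    have rA: "rc {p} \<inter> rc A' = rc A" using rc_quotient[OF t(1) A tA] t(2) by (simp add: A'_def)
    define D where "D = mul A C"
    have D: "nc D" "A \<subseteq> D" unfolding D_def using A C by (auto intro: nc_mul sub_mul[THEN subsetD])
    define E where "E = rc {p} \<inter> D"
    have E: "nc E" unfolding E_def using D pU by (intro nc_Int nc_rc) auto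
    have "rc A' \<inter> E = C" using quotient_mul[OF A C] rA by (auto simp: E_def D_def)
    moreover have "A' \<subseteq> E" using D by (auto simp: A'_def E_def)
    ultimately have "E = mul A' C" using mul_quotient[OF A'(1) E] by simp
    moreover have "C \<subseteq> rc A'" using C rA by auto
    ultimately have "lift E = lift A' \<cdot> lift C" using less.hyps[OF A'(2,1) C(1)] by simp
    moreover have "lift A = band (fst p) (snd p) \<cdot> lift A'"
      using lift_step[OF A, of "fst p" "snd p"] p by (simp add: A'_def)
    moreover have "lift D = band (fst p) (snd p) \<cdot> lift E"
      using lift_step[OF D(1), of "fst p" "snd p"] p D by (auto simp: E_def)
    moreover have "band (fst p) (snd p) \<in> Bn" using band_closed_nc[OF A, of "fst p" "snd p"] p by simp
    ultimately show ?thesis by (simp add: D_def[symmetric] G.m_assoc)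
  qed
qed

end

section \<open>Positive braids and their heads\<close>

context dual_braid
begin

text \<open>
  The graph of the homomorphism from the braid group to the group of fractions. As a relation it
  needs no choice of representatives; \<open>rep_unique\<close> says that it is well-defined.
\<close>

definition rep :: "braid \<Rightarrow> nat \<times> (nat \<times> nat) set list \<Rightarrow> bool" where
  "rep x p \<longleftrightarrow> (\<exists>w\<in>artin_words n. x = braid_class n w \<and> feq (frac w) p)"

lemma rep_unique: assumes "rep x p" "rep x q" shows "feq p q"
proof -
  obtain u v where "u \<in> artin_words n" "braid_class n u = braid_class n v"
    "feq (frac u) p" "feq (frac v) q"
    using assms by (auto simp: rep_def)
  then show ?thesis using artin_eq_feq class_eq_iff feq_sym feq_trans by metis
qed

lemma rep_mult: assumes "rep x p" "rep y q" shows "rep (x \<cdot> y) (fmul p q)"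
proof -
  obtain u v where uv: "u \<in> artin_words n" "v \<in> artin_words n" "x = braid_class n u" "y = braid_class n v"
    "feq (frac u) p" "feq (frac v) q"
    using assms by (auto simp: rep_def)
  then have "x \<cdot> y = braid_class n (u @ v)" "feq (frac (u @ v)) (fmul p q)"
    by (simp_all add: braid_class_mult frac_append feq_fmul)
  then show ?thesis using words_append uv unfolding rep_def by blast
qed

lemma rep_feq: "rep x p \<Longrightarrow> feq p q \<Longrightarrow> rep x q"
  unfolding rep_def using feq_trans by blast

lemma rep_one: "rep idB (0, [])"
  unfolding rep_def one_eq by (rule bexI[of _ "[]"]) (auto simp: artin_words_def intro: feq_refl)

lemma rep_sig: assumes "1 \<le> i" "i < n"
  shows "rep (sig i) (0, [chord i (Suc i)])" "rep (ginv (sig i)) (1, [lc (chord i (Suc i))])"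
proof -
  have nc: "nc (chord i (Suc i))" by (rule nc_chord)
  show "rep (sig i) (0, [chord i (Suc i)])"
    unfolding rep_def artin_gen_def using gen_word[OF assms, of True] nc
    by (intro bexI[of _ "[(i, True)]"]) (auto simp: fmul_def intro: feq_refl)
  show "rep (ginv (sig i)) (1, [lc (chord i (Suc i))])"
    unfolding rep_def sig_inv[OF assms] using gen_word[OF assms, of False] nc
    by (intro bexI[of _ "[(i, False)]"]) (auto simp: fmul_def nc_lc' intro: feq_refl)
qed

lemma rep_band: assumes "i < j" "1 \<le> i" "j \<le> n" shows "rep (band i j) (0, [chord i j])"
  using assms(1,3)
proof (induction j rule: band_induct)
  case base
  then show ?case using rep_sig assms by (simp add: band_Suc_self)
next
  case (step j)
  let ?t = "chord j (Suc j)" and ?r = "chord i (Suc j)"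
  have j: "1 \<le> j" "j < n" using step assms by auto
  have "rep (sig j \<cdot> band i j \<cdot> ginv (sig j)) (fmul (fmul (0, [?t]) (0, [chord i j])) (1, [lc ?t]))"
    using step j by (intro rep_mult rep_sig) auto
  moreover have "feq (fmul (fmul (0, [?t]) (0, [chord i j])) (1, [lc ?t])) (0, [?r])"
  proof -
    have "weq [?t, chord i j] [?r, ?t]"
      using weq.trans[OF weq_triangle[of i j "Suc j"]] step assms by simp
    then have "weq (map rot [?t, chord i j] @ [lc ?t]) (map rot [?r, ?t] @ [lc ?t])"
      by (intro weq_append weq_rot weq.refl) (auto intro: nc_lc' nc_chord)
    also have "\<dots> = [rot ?r] @ [rot ?t, lc ?t]" by simp
    also have "weq \<dots> ([rot ?r] @ [full])"
      by (intro weq_append weq.refl weq_complement nc_chord) (simp add: nc_rot nc_chord)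
    also have "weq ([rot ?r] @ [full]) [full, ?r]"
      using weq_full_commute1[OF nc_chord] by simp
    finally show ?thesis by (simp add: feq_def fmul_def)
  qed
  ultimately show ?case using rep_feq step assms by (simp add: band_Suc)
qed

lemma rep_lift: "nc A \<Longrightarrow> rep (lift A) (0, [A])"
proof (induction "card A" arbitrary: A rule: less_induct)
  case less
  note A = less.prems
  show ?case
  proof (cases "A = diag")
    case True
    have "feq (0, []) (0, [diag])" using weq.sym[OF weq_diag] by (simp add: feq_pos)
    then show ?thesis using True rep_feq[OF rep_one] by (simp add: lift_diag)
  next
    case False
    obtain i j where p: "(i, j) \<in> A" "i < j" using pick[OF A False] by (metis prod.collapse)
    have b: "1 \<le> i" "j \<le> n" using in_nc[OF A p(1)] by auto
    have full: "(i, j) \<in> full" using p nc_sub[OF A] by auto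
    have q: "nc (rc {(i, j)} \<inter> A)" "card (rc {(i, j)} \<inter> A) < card A"
      using quotient_smaller[OF A p(1)] p(2) by auto
    have "rep (lift A) (fmul (0, [chord i j]) (0, [rc {(i, j)} \<inter> A]))"
      unfolding lift_step[OF A p] by (intro rep_mult rep_band less.hyps q p b)
    moreover have "weq [chord i j, rc {(i, j)} \<inter> A] [A]"
      using weq_quotient[OF nc_chord A, of i j] chord_sub_iff[OF A full] p rc_chord[OF full] by simp
    ultimately show ?thesis using rep_feq by (simp add: fmul_def feq_pos)
  qed
qed

definition ev :: "(nat \<times> nat) set list \<Rightarrow> braid" where
  "ev w = braid_prod n (map lift w)"

lemma ev_Nil [simp]: "ev [] = idB" and ev_Cons [simp]: "ev (A # w) = lift A \<cdot> ev w"
  by (simp_all add: ev_def braid_prod_Nil braid_prod_Cons)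

lemma ev_closed [simp]: "ev w \<in> Bn"
  by (induction w) auto

lemma ev_append: "ev (u @ v) = ev u \<cdot> ev v"
  by (induction u) (simp_all add: G.m_assoc)

lemma rep_ev: "\<forall>A\<in>set w. nc A \<Longrightarrow> rep (ev w) (0, w)"
proof (induction w)
  case (Cons A w)
  then show ?case using rep_mult[OF rep_lift[of A], of "ev w" "(0, w)"] by (simp add: fmul_def)
qed (simp add: rep_one)

text \<open>
  The monoid of the simple elements embeds into the braid group.
\<close>

lemma ev_eq_imp_weq:
  assumes "ev u = ev v" "\<forall>A\<in>set u. nc A" "\<forall>A\<in>set v. nc A" shows "weq u v"
  using rep_unique[OF rep_ev[OF assms(2)], of "(0, v)"] rep_ev[OF assms(3)] assms(1) by (simp add: feq_pos)

lemma weq_imp_ev: "weq u v \<Longrightarrow> ev u = ev v"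
  by (induction rule: weq.induct) (auto simp: ev_append lift_mul lift_diag G.m_assoc)

lemma lift_chord: assumes "1 \<le> i" "i < j" "j \<le> n" shows "lift (chord i j) = band i j"
proof -
  have full: "(i, j) \<in> full" using assms by (simp add: full_def)
  have "(i, j) \<in> chord i j" using chord_sub_iff[OF nc_chord full] by blast
  moreover have "rc {(i, j)} \<inter> chord i j = diag" using rc_Int_self[OF nc_chord] rc_chord[OF full] by metis
  ultimately show ?thesis using lift_step[OF nc_chord, of i j i j] assms by (simp add: lift_diag)
qed

abbreviation Pos :: "braid set" where
  "Pos \<equiv> SQP n"

lemma band_eval_Nil: "band_eval n [] = idB"
  by (simp add: band_eval_def braid_prod_Nil)

lemma band_eval_Cons:
  "band_eval n ((i, j, b) # w) = (if b then band i j else ginv (band i j)) \<cdot> band_eval n w"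
  by (simp add: band_eval_def braid_prod_Cons)

lemma Pos_one: "idB \<in> Pos"
  unfolding SQP_def using band_eval_Nil by (auto simp: band_words_def intro!: exI[of _ "[]"])

lemma Pos_Cons: assumes "1 \<le> i" "i < j" "j \<le> n" "x \<in> Pos" shows "band i j \<cdot> x \<in> Pos"
proof -
  obtain w where "x = band_eval n w" "w \<in> band_words n" "\<forall>(i, j, b)\<in>set w. b"
    using assms by (auto simp: SQP_def)
  then show ?thesis using assms unfolding SQP_def
    by (auto intro!: exI[of _ "(i, j, True) # w"] simp: band_eval_Cons band_words_def)
qed

lemma Pos_induct [consumes 1, case_names one band]:
  assumes "x \<in> Pos" "P idB"
    and "\<And>i j x. 1 \<le> i \<Longrightarrow> i < j \<Longrightarrow> j \<le> n \<Longrightarrow> x \<in> Pos \<Longrightarrow> P x \<Longrightarrow> P (band i j \<cdot> x)"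
  shows "P x"
proof -
  have "P (band_eval n w) \<and> band_eval n w \<in> Pos" if "w \<in> band_words n" "\<forall>(i, j, b)\<in>set w. b" for w
    using that
  proof (induction w)
    case (Cons l w)
    obtain i j b where "l = (i, j, b)" by (metis surj_pair)
    with Cons assms(3)[of i j] show ?case by (auto simp: band_eval_Cons band_words_def Pos_Cons)
  qed (simp add: band_eval_Nil assms(2) Pos_one)
  then show ?thesis using assms(1) by (auto simp: SQP_def)
qed

lemma Pos_closed: "x \<in> Pos \<Longrightarrow> x \<in> Bn"
  by (induction rule: Pos_induct) auto

lemma Pos_mult: "x \<in> Pos \<Longrightarrow> y \<in> Pos \<Longrightarrow> x \<cdot> y \<in> Pos"
  by (induction rule: Pos_induct) (simp_all add: Pos_closed Pos_Cons G.m_assoc)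

lemma lift_Pos: "nc A \<Longrightarrow> lift A \<in> Pos"
proof (induction "card A" arbitrary: A rule: less_induct)
  case less
  note A = less.prems
  show ?case
  proof (cases "A = diag")
    case True
    then show ?thesis by (simp add: lift_diag Pos_one)
  next
    case False
    obtain i j where p: "(i, j) \<in> A" "i < j" using pick[OF A False] by (metis prod.collapse)
    have b: "1 \<le> i" "j \<le> n" using in_nc[OF A p(1)] by auto
    show ?thesis
      unfolding lift_step[OF A p] using quotient_smaller[OF A p(1)] p b by (intro Pos_Cons less.hyps) auto
  qed
qed

lemma ev_Pos: "\<forall>A\<in>set w. nc A \<Longrightarrow> ev w \<in> Pos"
  by (induction w) (auto simp: Pos_one Pos_mult lift_Pos)

lemma Pos_ev: "x \<in> Pos \<Longrightarrow> \<exists>w. (\<forall>A\<in>set w. nc A) \<and> x = ev w"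
proof (induction rule: Pos_induct)
  case (band i j x)
  then obtain w where "\<forall>A\<in>set w. nc A" "x = ev w" by blast
  then show ?case using band by (intro exI[of _ "chord i j # w"]) (simp add: nc_chord lift_chord)
qed (auto intro: exI[of _ "[]"])

lemma bexp_Pos: assumes "x \<in> Pos" shows "bexp x \<ge> 0" "bexp x = 0 \<Longrightarrow> x = idB"
proof -
  have "bexp x \<ge> 0 \<and> (bexp x = 0 \<longrightarrow> x = idB)"
    using assms by (induction rule: Pos_induct) (auto simp: bexp_one bexp_mult bexp_band Pos_closed)
  then show "bexp x \<ge> 0" "bexp x = 0 \<Longrightarrow> x = idB" by auto
qed

abbreviation dlt :: braid where
  "dlt \<equiv> delta n"

text \<open>
  The factors \<open>\<sigma>\<^sub>k \<dots> \<sigma>\<^sub>1\<close> of \<open>\<delta>\<close> are simple, with single nontrivial block \<open>{1, \<dots>, k + 1}\<close>.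
\<close>

definition initial_block :: "nat \<Rightarrow> (nat \<times> nat) set" where
  "initial_block k = {p \<in> full. fst p = snd p \<or> fst p \<le> k \<and> snd p \<le> k}"

lemma nc_initial_block: assumes "1 \<le> k" shows "nc (initial_block k)"
proof -
  have same_side: "same_side (1, y) p \<longleftrightarrow> (y \<le> fst p) = (y \<le> snd p)" if "p \<in> full" for y p
    using that by (auto simp: same_side_def outside_def full_def)
  have "lc {(1, y) |y. k < y \<and> y \<le> n} = initial_block k"
  proof (intro subset_antisym subsetI)
    fix p assume p: "p \<in> lc {(1, y) |y. k < y \<and> y \<le> n}"
    then have pU: "p \<in> full" by (simp add: lc_def)
    have *: "(z \<le> fst p) = (z \<le> snd p)" if "k < z" "z \<le> n" for z
      using p that same_side[OF pU] by (auto simp: lc_def)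
    show "p \<in> initial_block k"
    proof (cases "fst p" "snd p" rule: linorder_cases)
      case less
      then have "\<not> k < snd p" using *[of "snd p"] pU by (auto simp: full_def)
      then show ?thesis using less pU by (simp add: initial_block_def)
    next
      case greater
      then have "\<not> k < fst p" using *[of "fst p"] pU by (auto simp: full_def)
      then show ?thesis using greater pU by (simp add: initial_block_def)
    qed (simp add: initial_block_def pU)
  next
    fix p assume p: "p \<in> initial_block k"
    then have "p \<in> full" by (simp add: initial_block_def)
    then show "p \<in> lc {(1, y) |y. k < y \<and> y \<le> n}"
      using p same_side by (auto simp: lc_def initial_block_def)
  qed
  moreover have "nc (lc {(1, y) |y. k < y \<and> y \<le> n})"
    using n_ge_2 by (intro nc_lc) (auto simp: full_def)
  ultimately show ?thesis by simp
qed

lemma lift_initial_block: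
  assumes "k < n" shows "lift (initial_block (Suc k)) = braid_prod n (map sig (rev [1..<Suc k]))"
  using assms
proof (induction k)
  case 0
  have "initial_block (Suc 0) = diag" by (auto simp: initial_block_def diag_def full_def)
  then show ?case by (simp add: lift_diag braid_prod_Nil)
next
  case (Suc k)
  let ?p = "(Suc k, Suc (Suc k))"
  have "same_side q ?p \<longleftrightarrow> (fst q = Suc (Suc k)) = (snd q = Suc (Suc k))" for q
    by (auto simp: same_side_def outside_def le_Suc_eq)
  then have "rc {?p} = {q \<in> full. (fst q = Suc (Suc k)) = (snd q = Suc (Suc k))}"
    by (simp add: rc_def)
  moreover have "(fst q = Suc (Suc k)) = (snd q = Suc (Suc k)) \<and>
      (fst q = snd q \<or> fst q \<le> Suc (Suc k) \<and> snd q \<le> Suc (Suc k)) \<longleftrightarrow>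
      fst q = snd q \<or> fst q \<le> Suc k \<and> snd q \<le> Suc k" for q :: "nat \<times> nat"
    by linarith
  ultimately have "rc {?p} \<inter> initial_block (Suc (Suc k)) = initial_block (Suc k)"
    unfolding initial_block_def by blast
  moreover have "?p \<in> initial_block (Suc (Suc k))" using Suc.prems by (auto simp: initial_block_def full_def)
  ultimately have "lift (initial_block (Suc (Suc k))) = band (Suc k) (Suc (Suc k)) \<cdot> lift (initial_block (Suc k))"
    using lift_step[OF nc_initial_block, of "Suc (Suc k)" "Suc k" "Suc (Suc k)"] by simp
  then show ?case using Suc by (simp add: braid_prod_Cons band_Suc_self)
qed

lemma lift_full: "lift full = dlt"
proof -
  have "initial_block (Suc (n - 1)) = full" using n_ge_2 by (auto simp: initial_block_def full_def)
  then show ?thesis using lift_initial_block[of "n - 1"] n_ge_2 by (simp add: delta_def)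
qed

lemma dlt_Pos: "dlt \<in> Pos"
  using lift_Pos[OF nc_full] by (simp add: lift_full)

lemma dlt_closed [simp]: "dlt \<in> Bn"
  using dlt_Pos by (rule Pos_closed)

lemma lift_rc: assumes "nc A" shows "lift A \<cdot> lift (rc A) = dlt"
  using lift_mul[OF assms nc_rc'[OF assms]] mul_quotient[OF assms nc_full nc_sub[OF assms]] rc_sub
  by (simp add: lift_full Int_absorb2)

lemma lift_lc: assumes "nc A" shows "lift (lc A) \<cdot> lift A = dlt"
  using lift_rc[OF nc_lc'[OF assms]] by (simp add: rc_lc assms)

lemma lift_sub: assumes "nc A" "nc D" "A \<subseteq> D" shows "lift D = lift A \<cdot> lift (rc A \<inter> D)"
  using lift_mul[of A "rc A \<inter> D"] mul_quotient[OF assms] assms by (simp add: nc_Int nc_rc')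

lemma lift_rc_rc: assumes "nc A" shows "lift A \<cdot> dlt = dlt \<cdot> lift (rc (rc A))"
proof -
  have "lift A \<cdot> dlt = lift A \<cdot> (lift (rc A) \<cdot> lift (rc (rc A)))"
    by (simp add: lift_rc nc_rc' assms)
  also have "\<dots> = dlt \<cdot> lift (rc (rc A))"
    by (simp add: lift_rc assms flip: G.m_assoc)
  finally show ?thesis .
qed

lemma bexp_dlt: "bexp dlt = int n - 1"
proof -
  have "bexp (braid_prod n (map sig (rev [1..<k + 1]))) = int k" if "k < n" for k
    using that
  proof (induction k)
    case (Suc k)
    have "braid_prod n (map sig (rev [1..<Suc k + 1])) = sig (Suc k) \<cdot> braid_prod n (map sig (rev [1..<k + 1]))"
      by (simp add: braid_prod_Cons)
    then show ?case using Suc conj_word_closed[of 1 "k + 1"] by (simp add: bexp_mult bexp_sig)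
  qed (simp add: braid_prod_Nil bexp_one)
  from this[of "n - 1"] show ?thesis using n_ge_2 by (simp add: delta_def)
qed

lemma lift_eq_dlt_iff: assumes "nc A" shows "lift A = dlt \<longleftrightarrow> A = full"
proof
  assume "lift A = dlt"
  then have "ev [A] = ev [full]" by (simp add: lift_full)
  then have "whd [A] = whd [full]"
    using whd_wtl_cong[OF ev_eq_imp_weq[of "[A]" "[full]"]] assms nc_full by (simp del: whd.simps)
  moreover have "whd [C] = C" if "nc C" for C
    using mul_quotient[OF that that] diag_sub[OF nc_rc'[OF that]] rc_Int_self[OF that] by (simp add: Int_absorb1)
  ultimately show "A = full" using assms nc_full by metis
qed (simp add: lift_full)

lemma ev_whd: assumes "\<forall>A\<in>set w. nc A" shows "ev w = lift (whd w) \<cdot> ev (wtl w)"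
  using weq_imp_ev[OF weq_whd_wtl[OF assms]] by simp

lemma whd_append: "\<forall>A\<in>set w. nc A \<Longrightarrow> whd (x @ w) = whd (x @ [whd w])"
proof (induction x)
  case Nil
  have h: "nc (whd w)" using Nil nc_whd by blast
  then show ?case
    using mul_quotient[OF h h] diag_sub[OF nc_rc'[OF h]] rc_Int_self[OF h] by (simp add: Int_absorb1)
qed simp

text \<open>
  Both sides of the equation are words for the same braid, hence have the same head, and that head
  contains \<open>S\<close>. But the head of \<open>u @ w\<close> depends on \<open>w\<close> only through the head of \<open>w\<close>.
\<close>

lemma head_absorbs:
  assumes w: "\<forall>A\<in>set w. nc A" and S: "nc S" and x: "x \<in> Pos" and z: "z \<in> Pos"
    and eq: "x \<cdot> ev w = lift S \<cdot> z"
  shows "\<exists>z'\<in>Pos. x \<cdot> lift (whd w) = lift S \<cdot> z'"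
proof -
  obtain u v where u: "\<forall>A\<in>set u. nc A" "x = ev u" and v: "\<forall>A\<in>set v. nc A" "z = ev v"
    using Pos_ev x z by metis
  have "ev (u @ w) = ev (S # v)" using eq u v by (simp add: ev_append)
  then have "weq (u @ w) (S # v)" using u v w S by (intro ev_eq_imp_weq) auto
  then have "whd (u @ w) = whd (S # v)" using whd_wtl_cong by blast
  moreover have "S \<subseteq> whd (S # v)"
    using sub_mul(1)[OF S] nc_Int[OF nc_rc'[OF S] nc_whd[OF v(1)]] by simp
  ultimately have sub: "S \<subseteq> whd (u @ [whd w])" using whd_append[OF w] by metis
  define K where "K = whd (u @ [whd w])"
  have nc: "\<forall>A\<in>set (u @ [whd w]). nc A" using u nc_whd[OF w] by auto
  then have K: "nc K" "\<forall>A\<in>set (wtl (u @ [whd w])). nc A" by (simp_all add: K_def nc_whd nc_wtl del: set_append)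
  have "x \<cdot> lift (whd w) = ev (u @ [whd w])" using u by (simp add: ev_append)
  also have "\<dots> = lift K \<cdot> ev (wtl (u @ [whd w]))" using ev_whd[OF nc] by (simp add: K_def)
  also have "\<dots> = lift S \<cdot> (lift (rc S \<inter> K) \<cdot> ev (wtl (u @ [whd w])))"
    using lift_sub[OF S K(1)] sub by (simp add: K_def G.m_assoc)
  finally show ?thesis
    using K S by (intro bexI[of _ "lift (rc S \<inter> K) \<cdot> ev (wtl (u @ [whd w]))"] Pos_mult lift_Pos ev_Pos nc_Int nc_rc') auto
qed

end

section \<open>Infimum and supremum\<close>

lemma int_greatest_exists:
  fixes P :: "int \<Rightarrow> bool"
  assumes "P k" "\<And>j. P j \<Longrightarrow> j \<le> b"
  shows "\<exists>m. P m \<and> (\<forall>j. P j \<longrightarrow> j \<le> m)"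
proof -
  have bnd: "m \<le> nat (b - k)" if "P (k + int m)" for m using assms(2)[OF that] by simp
  define m where "m = (GREATEST m. P (k + int m))"
  have m: "P (k + int m)"
    unfolding m_def by (rule GreatestI_nat[where k = 0 and b = "nat (b - k)"]) (use assms(1) bnd in simp_all)
  have "j \<le> k + int m" if "P j" for j
  proof (cases "j \<le> k")
    case False
    then have "P (k + int (nat (j - k)))" using that by simp
    then have "nat (j - k) \<le> m" unfolding m_def by (rule Greatest_le_nat[where b = "nat (b - k)"]) (use bnd in simp_all)
    then show ?thesis by simp
  qed simp
  then show ?thesis using m by blast
qed

context dual_braid
begin

definition pw :: "int \<Rightarrow> braid" where
  "pw k = dlt [^]\<^bsub>braid_group n\<^esub> k"

lemma pw_closed [simp]: "pw k \<in> Bn" and pw_0 [simp]: "pw 0 = idB" and pw_1: "pw 1 = dlt"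
  by (simp_all add: pw_def G.int_pow_1)

lemma pw_add: "pw j \<cdot> pw k = pw (j + k)"
  by (simp add: pw_def G.int_pow_mult)

lemma pw_dlt: "pw k \<cdot> dlt = pw (k + 1)"
  using pw_add[of k 1] by (simp add: pw_1)

lemma pw_add_assoc: "x \<in> Bn \<Longrightarrow> pw j \<cdot> (pw k \<cdot> x) = pw (j + k) \<cdot> x"
  by (simp add: pw_add flip: G.m_assoc)

lemma ginv_pw: "ginv (pw k) = pw (- k)"
  by (rule G.inv_equality) (simp_all add: pw_add)

text \<open>
  Conjugation by powers of \<open>\<delta>\<close>. It preserves simple and positive braids, which makes it possible to
  move powers of \<open>\<delta>\<close> to the right end of any product.
\<close>

definition tau :: "int \<Rightarrow> braid \<Rightarrow> braid" where
  "tau k x = pw k \<cdot> x \<cdot> pw (- k)"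

lemma tau_closed [simp]: "x \<in> Bn \<Longrightarrow> tau k x \<in> Bn"
  by (simp add: tau_def)

lemma tau_mult: "x \<in> Bn \<Longrightarrow> y \<in> Bn \<Longrightarrow> tau k (x \<cdot> y) = tau k x \<cdot> tau k y"
  by (simp add: tau_def G.m_assoc pw_add_assoc)

lemma tau_tau: "x \<in> Bn \<Longrightarrow> tau j (tau k x) = tau (j + k) x"
  by (simp add: tau_def G.m_assoc pw_add pw_add_assoc add.commute)

lemma tau_0: "x \<in> Bn \<Longrightarrow> tau 0 x = x"
  by (simp add: tau_def)

lemma tau_one: "tau k idB = idB"
  by (simp add: tau_def pw_add)

lemma tau_pw: "tau k (pw j) = pw j"
  by (simp add: tau_def pw_add)

lemma tau_dlt: "tau k dlt = dlt"
  using tau_pw[of k 1] by (simp add: pw_1)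

lemma pw_commute: "x \<in> Bn \<Longrightarrow> pw k \<cdot> x = tau k x \<cdot> pw k"
  by (simp add: tau_def G.m_assoc pw_add)

lemma tau_lift: assumes "nc A" shows "\<exists>C. nc C \<and> tau k (lift A) = lift C"
proof (induction k rule: int_induct[where k = 0])
  case base
  then show ?case using assms by (auto simp: tau_0)
next
  case (step1 k)
  then obtain C where C: "nc C" "tau k (lift A) = lift C" by blast
  have "dlt \<cdot> lift C = lift (rot C) \<cdot> dlt" using lift_rc_rc[OF nc_rot[OF C(1)]] by (simp add: rc_rc_rot C)
  then have "tau 1 (lift C) = lift (rot C)"
    by (simp add: tau_def pw_1 G.m_assoc) (simp add: pw_add flip: pw_1)
  then show ?case using C tau_tau[of "lift A" 1 k] nc_rot
    by (intro exI[of _ "rot C"]) (simp add: add.commute)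
next
  case (step2 k)
  then obtain C where C: "nc C" "tau k (lift A) = lift C" by blast
  have "tau (- 1) (lift C) = pw (- 1) \<cdot> (lift C \<cdot> dlt)" by (simp add: tau_def pw_1 G.m_assoc)
  also have "\<dots> = pw (- 1) \<cdot> (pw 1 \<cdot> lift (rc (rc C)))" by (simp add: lift_rc_rc C pw_1)
  also have "\<dots> = lift (rc (rc C))" by (subst pw_add_assoc) simp_all
  finally have "tau (- 1) (lift C) = lift (rc (rc C))" .
  then show ?case using C tau_tau[of "lift A" "- 1" k] nc_rc' by (intro exI[of _ "rc (rc C)"]) simp
qed

lemma tau_Pos: assumes "x \<in> Pos" shows "tau k x \<in> Pos"
proof -
  obtain w where w: "\<forall>A\<in>set w. nc A" "x = ev w" using Pos_ev[OF assms] by blast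
  have "tau k (ev w) \<in> Pos" using w(1)
  proof (induction w)
    case (Cons A w)
    then obtain C where "nc C" "tau k (lift A) = lift C" using tau_lift by force
    then show ?case using Cons by (simp add: tau_mult Pos_mult lift_Pos)
  qed (simp add: tau_one Pos_one)
  then show ?thesis using w by simp
qed

lemma bexp_tau: "x \<in> Bn \<Longrightarrow> bexp (tau k x) = bexp x"
  using bexp_inv[of "pw k"] by (simp add: tau_def bexp_mult ginv_pw)

lemma pw_Pos: "0 \<le> k \<Longrightarrow> pw k \<in> Pos"
proof (induction k rule: int_ge_induct)
  case (step k)
  then show ?case using Pos_mult[OF _ dlt_Pos, of "pw k"] by (simp add: pw_add flip: pw_1)
qed (simp add: Pos_one)

lemma bexp_pw: "bexp (pw k) = k * (int n - 1)"
proof (induction k rule: int_induct[where k = 0])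
  case (step1 k)
  then show ?case using bexp_mult[of "pw k" dlt] by (simp add: pw_dlt bexp_dlt algebra_simps)
next
  case (step2 k)
  then show ?case using bexp_mult[of "pw (k - 1)" dlt] by (simp add: pw_dlt bexp_dlt algebra_simps)
qed (simp add: bexp_one)

text \<open>
  A one-sided form of the condition \<open>\<delta>\<^sup>k \<le> x\<close>, see \<open>braid_le_pw_iff\<close>. Bounds on the supremum are bounds
  on the infimum of the inverse (\<open>sup_le_iff\<close>).
\<close>

definition infge :: "braid \<Rightarrow> int \<Rightarrow> bool" where
  "infge x k \<longleftrightarrow> x \<cdot> pw (- k) \<in> Pos"

lemma infge_mono: assumes "x \<in> Bn" "infge x k" "j \<le> k" shows "infge x j"
proof -
  have "x \<cdot> pw (- j) = x \<cdot> pw (- k) \<cdot> pw (k - j)" using assms by (simp add: G.m_assoc pw_add)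
  then show ?thesis using assms Pos_mult pw_Pos by (simp add: infge_def)
qed

lemma infge_0: "x \<in> Bn \<Longrightarrow> infge x 0 \<longleftrightarrow> x \<in> Pos"
  by (simp add: infge_def)

lemma infge_pw: "x \<in> Bn \<Longrightarrow> infge (x \<cdot> pw k) k \<longleftrightarrow> x \<in> Pos"
  by (simp add: infge_def G.m_assoc pw_add)

lemma infge_tau: assumes "x \<in> Bn" "infge x k" shows "infge (tau j x) k"
proof -
  have "tau j x \<cdot> pw (- k) = tau j (x \<cdot> pw (- k))" using assms by (simp add: tau_mult tau_pw)
  then show ?thesis using assms tau_Pos by (simp add: infge_def)
qed

text \<open>
  The exponent sum of \<open>x \<delta>\<^sup>-\<^sup>k\<close> is nonnegative and that of \<open>\<delta>\<close> is \<open>n - 1 > 0\<close>. The absolute value only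
  avoids a division.
\<close>

lemma infge_bound: assumes "x \<in> Bn" "infge x k" shows "k \<le> \<bar>bexp x\<bar>"
proof -
  have "0 \<le> bexp x + - k * (int n - 1)"
    using assms bexp_Pos(1) by (force simp: infge_def bexp_mult bexp_pw)
  then have "k * (int n - 1) \<le> bexp x" by (simp add: algebra_simps)
  moreover have "\<bar>bexp x\<bar> * 1 \<le> \<bar>bexp x\<bar> * (int n - 1)"
    using n_ge_2 by (intro mult_left_mono) auto
  ultimately have "k * (int n - 1) \<le> \<bar>bexp x\<bar> * (int n - 1)" by linarith
  then show ?thesis by (rule mult_right_le_imp_le) (use n_ge_2 in simp)
qed

text \<open>
  Each inverse generator is \<open>\<delta>\<^sup>-\<^sup>1\<close> times a simple braid.
\<close>

lemma pw_times_Pos: assumes "x \<in> Bn" shows "\<exists>k. pw k \<cdot> x \<in> Pos"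
proof -
  obtain w where w: "w \<in> artin_words n" "x = braid_class n w" using assms by (auto simp: Bn_eq)
  have "\<exists>k. pw k \<cdot> braid_class n w \<in> Pos" using w(1)
  proof (induction w)
    case Nil
    have "pw 0 \<cdot> braid_class n [] \<in> Pos" by (simp add: Pos_one flip: one_eq)
    then show ?case by blast
  next
    case (Cons l w)
    obtain i b where l: "l = (i, b)" by force
    have i: "1 \<le> i" "i < n" and w: "w \<in> artin_words n" using Cons.prems l by (auto simp: artin_words_def)
    obtain k where k: "pw k \<cdot> braid_class n w \<in> Pos" using Cons.IH[OF w] by blast
    have cl: "braid_class n w \<in> Bn" using w by (auto simp: Bn_eq)
    have e: "braid_class n (l # w) = braid_class n [(i, b)] \<cdot> braid_class n w"
      using gen_word[OF i, of b] w by (simp add: braid_class_mult l)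
    let ?t = "chord i (Suc i)"
    have t: "lift ?t = sig i" using lift_chord[of i "Suc i"] i by (simp add: band_Suc_self)
    show ?case
    proof (cases b)
      case True
      have "pw k \<cdot> (sig i \<cdot> braid_class n w) = tau k (sig i) \<cdot> (pw k \<cdot> braid_class n w)"
        using i cl pw_commute[of "sig i" k] by (simp flip: G.m_assoc)
      moreover have "sig i \<in> Pos" using lift_Pos[OF nc_chord] t by metis
      ultimately have "pw k \<cdot> braid_class n (l # w) \<in> Pos"
        using True e k tau_Pos Pos_mult by (simp add: artin_gen_def)
      then show ?thesis by blast
    next
      case False
      have d: "dlt \<cdot> ginv (sig i) = lift (lc ?t)"
        using lift_lc[OF nc_chord, of i "Suc i"] i by (simp add: t G.inv_solve_right')
      have "pw (k + 1) \<cdot> (ginv (sig i) \<cdot> braid_class n w) = pw k \<cdot> (dlt \<cdot> ginv (sig i)) \<cdot> braid_class n w"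
        using i cl by (simp add: G.m_assoc pw_add_assoc flip: pw_1)
      also have "\<dots> = tau k (lift (lc ?t)) \<cdot> (pw k \<cdot> braid_class n w)"
        using i cl pw_commute[of "lift (lc ?t)" k] by (simp add: d flip: G.m_assoc)
      finally have "pw (k + 1) \<cdot> braid_class n (l # w) \<in> Pos"
        using False e k tau_Pos[OF lift_Pos[OF nc_lc'[OF nc_chord]]] Pos_mult sig_inv[OF i] by simp
      then show ?thesis by blast
    qed
  qed
  then show ?thesis using w by simp
qed

lemma infge_exists: assumes "x \<in> Bn" shows "\<exists>k. infge x k"
proof -
  obtain k where k: "pw k \<cdot> x \<in> Pos" using pw_times_Pos[OF assms] by blast
  have "tau (- k) (pw k \<cdot> x) = x \<cdot> pw k"
    using assms by (simp add: tau_def G.m_assoc pw_add_assoc)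
  then have "infge x (- k)" using tau_Pos[OF k] by (simp add: infge_def) metis
  then show ?thesis by blast
qed

lemma braid_le_pw_iff: assumes "x \<in> Bn" shows "braid_le n (pw k) x \<longleftrightarrow> infge x k"
proof
  assume "braid_le n (pw k) x"
  then obtain p q where pq: "p \<in> Pos" "q \<in> Pos" "x = p \<cdot> pw k \<cdot> q" by (auto simp: braid_le_def)
  then have "x \<cdot> pw (- k) = p \<cdot> tau k q" using Pos_closed by (simp add: tau_def G.m_assoc)
  then show "infge x k" using pq Pos_mult tau_Pos by (simp add: infge_def)
next
  assume "infge x k"
  moreover have "x = x \<cdot> pw (- k) \<cdot> pw k \<cdot> idB" using assms by (simp add: G.m_assoc pw_add)
  ultimately show "braid_le n (pw k) x" using Pos_one unfolding braid_le_def infge_def by metis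
qed

lemma braid_le_pw_iff': assumes "x \<in> Bn" shows "braid_le n x (pw k) \<longleftrightarrow> infge (ginv x) (- k)"
proof
  assume "braid_le n x (pw k)"
  then obtain p q where pq: "p \<in> Pos" "q \<in> Pos" "pw k = p \<cdot> x \<cdot> q" by (auto simp: braid_le_def)
  have cl: "p \<in> Bn" "q \<in> Bn" using pq Pos_closed by auto
  have "q \<cdot> pw (- k) \<cdot> p = q \<cdot> ginv (p \<cdot> x \<cdot> q) \<cdot> p" using pq ginv_pw by metis
  also have "\<dots> = ginv x" using cl assms by (simp add: G.inv_mult_group G.m_assoc G.r_inv_assoc)
  finally have "ginv x \<cdot> pw k = q \<cdot> pw (- k) \<cdot> p \<cdot> pw k" by simp
  also have "\<dots> = q \<cdot> tau (- k) p" using cl by (simp add: tau_def G.m_assoc)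
  finally have "ginv x \<cdot> pw k = q \<cdot> tau (- k) p" .
  then show "infge (ginv x) (- k)" using pq Pos_mult tau_Pos by (simp add: infge_def)
next
  assume "infge (ginv x) (- k)"
  moreover have "pw k = idB \<cdot> x \<cdot> (ginv x \<cdot> pw k)" using assms by (simp add: G.r_inv_assoc)
  ultimately show "braid_le n x (pw k)" using Pos_one unfolding braid_le_def infge_def by (metis minus_minus)
qed

lemma inf_ge_iff: assumes "x \<in> Bn" shows "k \<le> braid_inf n x \<longleftrightarrow> infge x k"
proof -
  obtain k0 where "infge x k0" using infge_exists[OF assms] by blast
  then obtain m where m: "infge x m" "\<And>j. infge x j \<Longrightarrow> j \<le> m"
    using int_greatest_exists[of "infge x" k0] infge_bound[OF assms] by blast
  have "braid_inf n x = m"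
    unfolding braid_inf_def using m braid_le_pw_iff[OF assms]
    by (intro Greatest_equality) (auto simp: pw_def)
  then show ?thesis using m infge_mono[OF assms m(1)] by auto
qed

lemma sup_le_iff: assumes "x \<in> Bn" shows "braid_sup n x \<le> k \<longleftrightarrow> infge (ginv x) (- k)"
proof -
  have x: "ginv x \<in> Bn" using assms by simp
  define m where "m = braid_inf n (ginv x)"
  have m: "infge (ginv x) j \<longleftrightarrow> j \<le> m" for j using inf_ge_iff[OF x] by (simp add: m_def)
  have le: "braid_le n x (dlt [^]\<^bsub>braid_group n\<^esub> j) \<longleftrightarrow> - m \<le> j" for j
    using braid_le_pw_iff'[OF assms, of j] m[of "- j"] by (simp only: pw_def) linarith
  have "braid_sup n x = - m"
    unfolding braid_sup_def by (rule Least_equality) (simp_all only: le order_refl)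
  then show ?thesis by (simp only: m) linarith
qed

lemma inf_le_sup: assumes "x \<in> Bn" shows "braid_inf n x \<le> braid_sup n x"
proof -
  have "infge x (braid_inf n x)" "infge (ginv x) (- braid_sup n x)"
    using inf_ge_iff[OF assms, of "braid_inf n x"] sup_le_iff[OF assms, of "braid_sup n x"] by simp_all
  then have "x \<cdot> pw (- braid_inf n x) \<in> Pos" "ginv x \<cdot> pw (braid_sup n x) \<in> Pos" by (simp_all add: infge_def)
  then have "0 \<le> bexp (x \<cdot> pw (- braid_inf n x)) + bexp (ginv x \<cdot> pw (braid_sup n x))"
    using bexp_Pos(1) by simp
  then have "braid_inf n x * (int n - 1) \<le> braid_sup n x * (int n - 1)"
    using assms by (simp add: bexp_mult bexp_inv bexp_pw algebra_simps)
  then show ?thesis using n_ge_2 by simp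
qed

section \<open>Cycling\<close>

definition ldvd :: "braid \<Rightarrow> braid \<Rightarrow> bool" where
  "ldvd x y \<longleftrightarrow> (\<exists>z\<in>Pos. y = x \<cdot> z)"

lemma ldvdI: "y = x \<cdot> z \<Longrightarrow> z \<in> Pos \<Longrightarrow> ldvd x y"
  unfolding ldvd_def by blast

definition Simp :: "braid set" where
  "Simp = lift ` {A. nc A}"

lemma Simp_Pos: "x \<in> Simp \<Longrightarrow> x \<in> Pos"
  by (auto simp: Simp_def lift_Pos)

lemma Simp_closed: "x \<in> Simp \<Longrightarrow> x \<in> Bn"
  by (auto simp: Simp_def)

lemma dlt_Simp: "dlt \<in> Simp"
  using nc_full lift_full unfolding Simp_def by (metis image_eqI mem_Collect_eq)

lemma tau_Simp: "x \<in> Simp \<Longrightarrow> tau k x \<in> Simp"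
  unfolding Simp_def using tau_lift by blast

lemma Simp_compl: assumes "x \<in> Simp" shows "ginv x \<cdot> dlt \<in> Pos" "dlt \<cdot> ginv x \<in> Pos"
proof -
  obtain A where A: "nc A" "x = lift A" using assms by (auto simp: Simp_def)
  have "ginv x \<cdot> dlt = lift (rc A)" using lift_rc[OF A(1)] A by (simp add: G.l_inv_assoc flip: lift_rc[OF A(1)])
  moreover have "dlt \<cdot> ginv x = lift (lc A)" using A by (simp add: G.m_assoc flip: lift_lc[OF A(1)])
  ultimately show "ginv x \<cdot> dlt \<in> Pos" "dlt \<cdot> ginv x \<in> Pos" using lift_Pos nc_rc' nc_lc' A by auto
qed

text \<open>
  The property from \<open>head_absorbs\<close>, stated for braids instead of words, since the arguments below
  only use heads through it.
\<close>

definition is_head :: "braid \<Rightarrow> braid \<Rightarrow> bool" where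
  "is_head P H \<longleftrightarrow> H \<in> Simp \<and> ldvd H P \<and>
    (\<forall>X\<in>Pos. \<forall>S\<in>Simp. ldvd S (X \<cdot> P) \<longrightarrow> ldvd S (X \<cdot> H))"

lemma is_head_whd: assumes "\<forall>A\<in>set w. nc A" shows "is_head (ev w) (lift (whd w))"
  unfolding is_head_def
proof (intro conjI ballI impI)
  show "lift (whd w) \<in> Simp" using nc_whd[OF assms] by (auto simp: Simp_def)
  show "ldvd (lift (whd w)) (ev w)" by (rule ldvdI[OF ev_whd[OF assms]]) (intro ev_Pos nc_wtl assms)
  fix X S assume "X \<in> Pos" "S \<in> Simp" "ldvd S (X \<cdot> ev w)"
  then show "ldvd S (X \<cdot> lift (whd w))"
    using head_absorbs[OF assms] by (fastforce simp: Simp_def ldvd_def)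
qed

lemma head_exists: "P \<in> Pos \<Longrightarrow> \<exists>H. is_head P H"
  using Pos_ev is_head_whd by blast

lemma ldvd_tau: assumes "ldvd x y" "x \<in> Bn" shows "ldvd (tau k x) (tau k y)"
proof -
  obtain z where z: "z \<in> Pos" "y = x \<cdot> z" using assms by (auto simp: ldvd_def)
  then show ?thesis using assms Pos_closed tau_Pos by (intro ldvdI[of _ _ "tau k z"]) (auto simp: tau_mult)
qed

lemma is_head_tau: assumes "is_head P H" "P \<in> Pos" shows "is_head (tau k P) (tau k H)"
proof -
  have cl: "P \<in> Bn" "H \<in> Bn" using assms Pos_closed Simp_closed by (auto simp: is_head_def)
  have "ldvd S (X \<cdot> tau k H)" if X: "X \<in> Pos" and S: "S \<in> Simp" and d: "ldvd S (X \<cdot> tau k P)" for X S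
  proof -
    have clX: "X \<in> Bn" "S \<in> Bn" using X S Pos_closed Simp_closed by auto
    have "ldvd (tau (- k) S) (tau (- k) (X \<cdot> tau k P))" by (rule ldvd_tau[OF d clX(2)])
    then have "ldvd (tau (- k) S) (tau (- k) X \<cdot> P)" using cl clX by (simp add: tau_mult tau_tau tau_0)
    then have "ldvd (tau (- k) S) (tau (- k) X \<cdot> H)"
      using assms(1) tau_Pos[OF X] tau_Simp[OF S] by (auto simp: is_head_def)
    from ldvd_tau[OF this, of k] show ?thesis using cl clX by (simp add: tau_mult tau_tau tau_0)
  qed
  then show ?thesis using assms ldvd_tau[of H P k] tau_Simp cl by (simp add: is_head_def)
qed

lemma is_headD: "is_head P H \<Longrightarrow> X \<in> Pos \<Longrightarrow> S \<in> Simp \<Longrightarrow> ldvd S (X \<cdot> P) \<Longrightarrow> ldvd S (X \<cdot> H)"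
  by (simp add: is_head_def)

lemma is_headD1: "is_head P H \<Longrightarrow> P \<in> Pos \<Longrightarrow> S \<in> Simp \<Longrightarrow> ldvd S P \<Longrightarrow> ldvd S H"
  using is_headD[of P H idB S] Pos_one Simp_closed Pos_closed by (simp add: is_head_def)

text \<open>
  A nontrivial positive braid is divisible by a band generator, which then divides the head.
\<close>

lemma is_head_one: assumes "is_head P idB" "P \<in> Pos" shows "P = idB"
proof (rule ccontr)
  assume "P \<noteq> idB"
  moreover have "P = idB \<or> (\<exists>i j x. 1 \<le> i \<and> i < j \<and> j \<le> n \<and> x \<in> Pos \<and> P = band i j \<cdot> x)"
    using assms(2) by (induction rule: Pos_induct) blast+
  ultimately obtain i j x where "1 \<le> i" "i < j" "j \<le> n" "x \<in> Pos" "P = band i j \<cdot> x" by blast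
  then have "band i j \<in> Simp" "ldvd (band i j) P"
    using lift_chord[of i j] nc_chord unfolding Simp_def ldvd_def by blast+
  then have "ldvd (band i j) idB" using is_headD1[OF assms] by blast
  then obtain z where "z \<in> Pos" "idB = band i j \<cdot> z" by (auto simp: ldvd_def)
  then show False using bexp_Pos(1)[of z] bexp_mult[of "band i j" z] bexp_band[of i j] bexp_one Pos_closed
      \<open>1 \<le> i\<close> \<open>i < j\<close> \<open>j \<le> n\<close> by auto
qed

definition conj_by :: "braid \<Rightarrow> braid \<Rightarrow> braid" where
  "conj_by g x = g \<cdot> x \<cdot> ginv g"

lemma conj_by_closed [simp]: "g \<in> Bn \<Longrightarrow> x \<in> Bn \<Longrightarrow> conj_by g x \<in> Bn"
  by (simp add: conj_by_def)

lemma conj_by_mult: "g \<in> Bn \<Longrightarrow> h \<in> Bn \<Longrightarrow> x \<in> Bn \<Longrightarrow> conj_by (g \<cdot> h) x = conj_by g (conj_by h x)"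
  by (simp add: conj_by_def G.m_assoc G.inv_mult_group)

lemma conj_by_pw: "conj_by (pw k) x = tau k x"
  by (simp add: conj_by_def tau_def ginv_pw)

lemma conj_by_ginv: "g \<in> Bn \<Longrightarrow> x \<in> Bn \<Longrightarrow> conj_by (ginv g) (conj_by g x) = x"
  by (simp add: conj_by_def G.m_assoc G.l_inv_assoc)

definition raisers :: "braid \<Rightarrow> int \<Rightarrow> braid set" where
  "raisers x k = {Q \<in> Pos. infge (conj_by Q x) k}"

definition minimal_raiser :: "braid \<Rightarrow> int \<Rightarrow> braid \<Rightarrow> bool" where
  "minimal_raiser x k Q \<longleftrightarrow> Q \<in> raisers x k \<and> (\<forall>R\<in>raisers x k. bexp Q \<le> bexp R)"

text \<open>
  The bound \<open>m\<close> is on the length of the head of a shortest raiser. It starts at \<open>n - 1\<close> at most and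
  drops with every cycling, so that it bounds the number of cyclings needed.
\<close>

definition raise_within :: "nat \<Rightarrow> braid \<Rightarrow> int \<Rightarrow> bool" where
  "raise_within m x k \<longleftrightarrow> (\<exists>Q H. minimal_raiser x k Q \<and> is_head Q H \<and> bexp H \<le> int m)"

lemma raise_within_start:
  assumes x: "x \<in> Bn" and g: "g \<in> Bn" "infge (conj_by g x) k"
  shows "raise_within (n - 1) x k"
proof -
  obtain j where "pw j \<cdot> g \<in> Pos" using pw_times_Pos[OF g(1)] by blast
  moreover have "infge (conj_by (pw j \<cdot> g) x) k"
    using infge_tau[OF _ g(2)] x g by (simp add: conj_by_mult conj_by_pw)
  ultimately have "pw j \<cdot> g \<in> raisers x k" by (simp add: raisers_def)
  from ex_has_least_nat[of "\<lambda>Q. Q \<in> raisers x k", OF this, of "\<lambda>Q. nat (bexp Q)"]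
  obtain Q where Q: "Q \<in> raisers x k" "\<forall>R. R \<in> raisers x k \<longrightarrow> nat (bexp Q) \<le> nat (bexp R)" by blast
  have "bexp Q \<le> bexp R" if "R \<in> raisers x k" for R
    using Q that bexp_Pos(1)[of Q] bexp_Pos(1)[of R] by (fastforce simp: raisers_def)
  then have m: "minimal_raiser x k Q" using Q by (simp add: minimal_raiser_def)
  have "Q \<in> Pos" using Q by (simp add: raisers_def)
  then obtain H where H: "is_head Q H" using head_exists by blast
  then have "H \<in> Simp" by (simp add: is_head_def)
  then have "bexp H \<le> int (n - 1)"
    using bexp_Pos(1)[OF Simp_compl(1)[of H]] n_ge_2 Simp_closed[of H] by (simp add: bexp_mult bexp_inv bexp_dlt)
  then show ?thesis using m H by (auto simp: raise_within_def)
qed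

lemma raise_within_0: assumes "raise_within 0 x k" "x \<in> Bn" shows "infge x k"
proof -
  obtain Q H where Q: "Q \<in> Pos" "infge (conj_by Q x) k" "is_head Q H" "bexp H \<le> 0"
    using assms by (auto simp: raise_within_def minimal_raiser_def raisers_def)
  then have "H \<in> Pos" using Simp_Pos by (simp add: is_head_def)
  then have "H = idB" using bexp_Pos[of H] Q by simp
  then have "Q = idB" using is_head_one Q by blast
  then show ?thesis using Q assms(2) by (simp add: conj_by_def)
qed

text \<open>
  Write \<open>Q x Q\<^sup>-\<^sup>1 = X \<delta>\<^sup>u\<^sup>+\<^sup>1\<close> with \<open>X\<close> positive. Then \<open>\<delta>\<close> divides \<open>Q P\<close>, hence \<open>Q A\<close>; let \<open>Q A = \<delta> Q'\<close>. The
  braid \<open>Q'\<close> conjugates the cycled braid \<open>y\<close> to a conjugate of \<open>Q x Q\<^sup>-\<^sup>1\<close> by \<open>\<delta>\<close>, and all raisers of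
  \<open>y\<close> correspond to raisers of \<open>x\<close> with the same difference of lengths, so \<open>Q'\<close> is a shortest one.

  For the heads, let \<open>H'\<close> be the head of \<open>Q'\<close>, so that \<open>\<delta> H' \<delta>\<^sup>-\<^sup>1\<close> divides the head \<open>H\<close> of \<open>Q\<close>. If the two
  were equal, \<open>head_absorbs\<close> applied to the two factorisations of \<open>Q P\<close> would show that after removing
  \<open>H'\<close> from \<open>Q'\<close> one still has a raiser of \<open>y\<close>, contradicting minimality.
\<close>

lemma raise_within_cycle:
  assumes P: "P \<in> Pos" and A: "is_head P A" and P1: "P1 \<in> Pos" "P = A \<cdot> P1"
    and low: "\<not> infge (P \<cdot> pw u) (u + 1)" and r: "raise_within (Suc m) (P \<cdot> pw u) (u + 1)"
  shows "raise_within m (P1 \<cdot> pw u \<cdot> A) (u + 1)"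
proof -
  define x y where "x = P \<cdot> pw u" "y = P1 \<cdot> pw u \<cdot> A"
  obtain Q H where Q: "Q \<in> Pos" "infge (conj_by Q x) (u + 1)"
      and min: "\<And>R. R \<in> Pos \<Longrightarrow> infge (conj_by R x) (u + 1) \<Longrightarrow> bexp Q \<le> bexp R"
      and H: "is_head Q H" "bexp H \<le> int (Suc m)"
    using r by (auto simp: raise_within_def minimal_raiser_def raisers_def x_y_def)
  have AS: "A \<in> Simp" "H \<in> Simp" using A H by (simp_all add: is_head_def)
  have cl: "P \<in> Bn" "A \<in> Bn" "P1 \<in> Bn" "Q \<in> Bn" "H \<in> Bn" "x \<in> Bn" "y \<in> Bn"
    using P AS P1 Q Simp_closed Pos_closed by (auto simp: x_y_def)
  define X where "X = conj_by Q x \<cdot> pw (- (u + 1))"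
  have X: "X \<in> Pos" using Q by (simp add: X_def infge_def)
  have clX: "X \<in> Bn" using X by (rule Pos_closed)
  define X' where "X' = tau (- 1) X"
  have X': "X' \<in> Pos" "X' \<in> Bn" using X tau_Pos Pos_closed by (auto simp: X'_def)
  have cQx: "conj_by Q x = X \<cdot> pw (u + 1)" using cl by (simp add: X_def G.m_assoc pw_add)
  have dX: "X \<cdot> dlt = dlt \<cdot> X'"
    using pw_commute[of X' 1] clX by (simp add: X'_def tau_tau tau_0 pw_1)
  \<comment> \<open>The first factorisation of Q P; the second one, through Q', follows further down.\<close>
  have QP: "Q \<cdot> P = dlt \<cdot> (X' \<cdot> tau u Q)"
  proof -
    have "Q \<cdot> P = conj_by Q x \<cdot> (Q \<cdot> pw (- u))"
      using cl by (simp add: conj_by_def x_y_def G.m_assoc G.l_inv_assoc pw_add)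
    also have "\<dots> = X \<cdot> (pw 1 \<cdot> pw u) \<cdot> (Q \<cdot> pw (- u))" by (simp add: cQx pw_add add.commute)
    also have "\<dots> = X \<cdot> dlt \<cdot> tau u Q" using cl clX by (simp add: pw_1 tau_def G.m_assoc)
    also have "\<dots> = dlt \<cdot> (X' \<cdot> tau u Q)" using cl X' by (simp add: dX G.m_assoc)
    finally show ?thesis .
  qed
  have "ldvd dlt (Q \<cdot> A)"
    by (rule is_headD[OF A Q(1) dlt_Simp], rule ldvdI[OF QP]) (intro Pos_mult X' tau_Pos Q)
  then obtain Q' where Q': "Q' \<in> Pos" "Q \<cdot> A = dlt \<cdot> Q'" by (auto simp: ldvd_def)
  have clQ': "Q' \<in> Bn" using Q' by (simp add: Pos_closed)
  have Qeq: "Q = dlt \<cdot> Q' \<cdot> ginv A" using cl Q'(2)[symmetric] by (simp add: G.m_assoc)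
  have Ay: "conj_by (ginv A) x = y"
    using cl by (simp add: conj_by_def x_y_def P1 G.m_assoc G.l_inv_assoc)
  \<comment> \<open>Raisers R of y and braids of the form \<open>\<delta> R A\<^sup>-\<^sup>1\<close> that raise x correspond to each other.\<close>
  have conj_y: "conj_by (dlt \<cdot> R \<cdot> ginv A) x = tau 1 (conj_by R y)" if "R \<in> Bn" for R
    using that cl conj_by_pw[of 1] by (simp add: conj_by_mult Ay pw_1)
  have tau1: "infge (tau 1 z) k \<longleftrightarrow> infge z k" if "z \<in> Bn" for z k
    using infge_tau[OF that, of k 1] infge_tau[of "tau 1 z" k "- 1"] that by (auto simp: tau_tau tau_0)
  have bA: "bexp (dlt \<cdot> R \<cdot> ginv A) = bexp R + (int n - 1) - bexp A" if "R \<in> Bn" for R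
    using that cl by (simp add: bexp_mult bexp_inv bexp_dlt)
  have Q'r: "infge (conj_by Q' y) (u + 1)"
    using Q(2) conj_y[OF clQ'] tau1[of "conj_by Q' y"] clQ' cl by (simp flip: Qeq)
  have min': "bexp Q' \<le> bexp R" if R: "R \<in> Pos" "infge (conj_by R y) (u + 1)" for R
  proof -
    have clR: "R \<in> Bn" using R by (simp add: Pos_closed)
    have "dlt \<cdot> R = tau 1 R \<cdot> dlt" using pw_commute[OF clR, of 1] by (simp add: pw_1)
    then have "dlt \<cdot> R \<cdot> ginv A = tau 1 R \<cdot> (dlt \<cdot> ginv A)" using clR cl by (simp add: G.m_assoc)
    then have "dlt \<cdot> R \<cdot> ginv A \<in> Pos" using Simp_compl(2)[OF AS(1)] tau_Pos[OF R(1)] by (simp add: Pos_mult)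
    moreover have "infge (conj_by (dlt \<cdot> R \<cdot> ginv A) x) (u + 1)" using conj_y tau1 R clR cl by simp
    ultimately have "bexp Q \<le> bexp (dlt \<cdot> R \<cdot> ginv A)" by (rule min)
    then show ?thesis using bA[OF clR] bA[OF clQ'] Qeq by simp
  qed
  obtain H' where H': "is_head Q' H'" using head_exists[OF Q'(1)] by blast
  have H'S: "H' \<in> Simp" "ldvd H' Q'" using H' by (simp_all add: is_head_def)
  have clH': "H' \<in> Bn" using H'S Simp_closed by blast
  have "bexp H' \<le> int m"
  proof (cases "H' = idB")
    case True
    then show ?thesis by (simp add: bexp_one)
  next
    case False
    have pos: "0 < bexp H'" using bexp_Pos[OF Simp_Pos[OF H'S(1)]] False by linarith
    obtain Q'' where Q'': "Q'' \<in> Pos" "Q' = H' \<cdot> Q''" using H'S by (auto simp: ldvd_def)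
    have clQ'': "Q'' \<in> Bn" using Q'' by (simp add: Pos_closed)
    have "ldvd (tau 1 H') Q"
    proof (rule ldvdI)
      have "dlt \<cdot> Q' = tau 1 Q' \<cdot> dlt" using pw_commute[OF clQ', of 1] by (simp add: pw_1)
      then have "Q = tau 1 Q' \<cdot> dlt \<cdot> ginv A" using Qeq by simp
      also have "tau 1 Q' = tau 1 H' \<cdot> tau 1 Q''" using Q''(2) clQ'' clH' by (simp add: tau_mult)
      finally show "Q = tau 1 H' \<cdot> (tau 1 Q'' \<cdot> (dlt \<cdot> ginv A))"
        using clQ'' clH' cl by (simp add: G.m_assoc)
      show "tau 1 Q'' \<cdot> (dlt \<cdot> ginv A) \<in> Pos" using Q'' tau_Pos Simp_compl(2)[OF AS(1)] by (simp add: Pos_mult)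
    qed
    then have "ldvd (tau 1 H') H" using is_headD1[OF H(1) Q(1)] tau_Simp[OF H'S(1)] by blast
    then obtain Z where Z: "Z \<in> Pos" "H = tau 1 H' \<cdot> Z" by (auto simp: ldvd_def)
    have "Z \<noteq> idB"
    proof
      assume "Z = idB"
      then have HH: "H = tau 1 H'" using Z clH' by simp
      \<comment> \<open>Cancel \<open>\<delta>\<close> in the two factorisations of Q P.\<close>
      have "Q' \<cdot> P1 = X' \<cdot> tau u Q"
      proof -
        have "dlt \<cdot> (Q' \<cdot> P1) = dlt \<cdot> (X' \<cdot> tau u Q)"
        proof -
          have "Q \<cdot> P = Q \<cdot> A \<cdot> P1" using cl by (simp add: P1 G.m_assoc)
          also have "\<dots> = dlt \<cdot> (Q' \<cdot> P1)" using cl clQ' by (simp add: Q'(2) G.m_assoc)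
          finally show ?thesis using QP by simp
        qed
        then show ?thesis using cl clQ' X' by simp
      qed
      then have "X' \<cdot> tau u Q = H' \<cdot> (Q'' \<cdot> P1)" using clH' clQ'' cl Q'' by (simp add: G.m_assoc)
      then have "ldvd H' (X' \<cdot> tau u Q)" by (rule ldvdI) (intro Pos_mult Q'' P1)
      then have "ldvd H' (X' \<cdot> tau u H)"
        using is_headD[OF is_head_tau[OF H(1) Q(1)] X'(1) H'S(1)] by blast
      then obtain Y where Y: "Y \<in> Pos" "X' \<cdot> tau (u + 1) H' = H' \<cdot> Y"
        using clH' by (auto simp: ldvd_def HH tau_tau)
      have clY: "Y \<in> Bn" using Y by (simp add: Pos_closed)
      have "tau 1 (conj_by Q' y) = conj_by Q x" using conj_y[OF clQ'] Qeq by simp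
      then have "tau (- 1) (tau 1 (conj_by Q' y)) = tau (- 1) (X \<cdot> pw (u + 1))" by (simp add: cQx)
      then have cQ'y: "conj_by Q' y = X' \<cdot> pw (u + 1)"
        using clQ' cl clX by (simp add: tau_tau tau_0 tau_mult tau_pw X'_def)
      have "conj_by H' (conj_by Q'' y) = X' \<cdot> pw (u + 1)"
        using cQ'y Q'' clH' clQ'' cl by (simp add: conj_by_mult)
      then have "conj_by (ginv H') (conj_by H' (conj_by Q'' y)) = conj_by (ginv H') (X' \<cdot> pw (u + 1))"
        by simp
      then have "conj_by Q'' y = ginv H' \<cdot> (X' \<cdot> tau (u + 1) H') \<cdot> pw (u + 1)"
        using clH' clQ'' cl X' pw_commute[OF clH', of "u + 1"]
        by (simp add: conj_by_ginv) (simp add: conj_by_def G.m_assoc)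
      then have "conj_by Q'' y = Y \<cdot> pw (u + 1)" using Y clY clH' by (simp add: G.l_inv_assoc)
      then have "infge (conj_by Q'' y) (u + 1)" using Y clY by (simp add: infge_pw)
      then have "bexp Q' \<le> bexp Q''" using min' Q'' by blast
      then show False using Q''(2) pos clH' clQ'' by (simp add: bexp_mult)
    qed
    then have "0 < bexp Z" using bexp_Pos[OF Z(1)] by linarith
    then show ?thesis using Z Pos_closed[OF Z(1)] clH' H(2) by (simp add: bexp_mult bexp_tau)
  qed
  then show ?thesis
    using H' Q' Q'r min' by (auto simp: raise_within_def minimal_raiser_def raisers_def x_y_def)
qed

text \<open>
  Suppose \<open>P W = \<delta>\<^sup>k\<close> with \<open>W\<close> positive and \<open>k > 0\<close>. Then also \<open>W V = \<delta>\<^sup>k\<close> for a conjugate \<open>V\<close> of \<open>P\<close> by a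
  power of \<open>\<delta>\<close>, so \<open>\<delta>\<close> divides \<open>W V\<close> and hence \<open>W\<close> times the head of \<open>V\<close>, which is the corresponding
  conjugate of \<open>A\<close>. This says that \<open>P1\<^sup>-\<^sup>1 \<delta>\<^sup>k\<^sup>-\<^sup>1\<close> is positive. If \<open>k\<close> is not positive, lengths force \<open>A\<close> to
  be trivial.
\<close>

lemma cycle_sup:
  assumes P: "P \<in> Pos" and A: "is_head P A" and P1: "P1 \<in> Pos" "P = A \<cdot> P1"
    and sup: "infge (ginv (P \<cdot> pw u)) (- t)"
  shows "infge (ginv (P1 \<cdot> pw u \<cdot> A)) (- t)"
proof (cases "A = idB")
  case True
  then show ?thesis using sup P1 Pos_closed by simp
next
  case False
  have AS: "A \<in> Simp" using A by (simp add: is_head_def)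
  have cl: "P \<in> Bn" "A \<in> Bn" "P1 \<in> Bn" using P AS P1 Simp_closed Pos_closed by auto
  define k where "k = t - u"
  define W where "W = ginv P \<cdot> pw k"
  have "tau u (ginv (P \<cdot> pw u) \<cdot> pw t) = W"
    using cl by (simp add: tau_def W_def k_def G.inv_mult_group ginv_pw G.m_assoc pw_add pw_add_assoc)
  then have W: "W \<in> Pos" using tau_Pos[of "ginv (P \<cdot> pw u) \<cdot> pw t" u] sup by (simp add: infge_def)
  have clW: "W \<in> Bn" using W by (rule Pos_closed)
  define V where "V = tau (- k) P"
  have V: "is_head V (tau (- k) A)" unfolding V_def by (rule is_head_tau[OF A P])
  have WV: "W \<cdot> V = dlt \<cdot> pw (k - 1)"
  proof -
    have "W \<cdot> V = pw k" using cl by (simp add: W_def V_def tau_def G.m_assoc pw_add_assoc G.l_inv_assoc)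
    then show ?thesis using pw_add[of 1 "k - 1"] by (simp add: pw_1)
  qed
  have "0 < bexp A" using bexp_Pos[OF Simp_Pos[OF AS]] False by linarith
  then have "0 < bexp (P \<cdot> W)" using bexp_Pos(1)[OF W] bexp_Pos(1)[OF P1(1)] cl clW by (simp add: P1 bexp_mult)
  moreover have "P \<cdot> W = pw k" using cl by (simp add: W_def G.r_inv_assoc)
  ultimately have "0 < k * (int n - 1)" by (simp add: bexp_pw)
  then have "0 < k" using n_ge_2 by (simp add: zero_less_mult_iff)
  then have "ldvd dlt (W \<cdot> V)" by (intro ldvdI[OF WV] pw_Pos) simp
  then have "ldvd dlt (W \<cdot> tau (- k) A)" by (rule is_headD[OF V W dlt_Simp])
  then obtain Z where Z: "Z \<in> Pos" "W \<cdot> tau (- k) A = dlt \<cdot> Z" by (auto simp: ldvd_def)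
  have clZ: "Z \<in> Bn" using Z by (simp add: Pos_closed)
  have P1Z: "ginv P1 \<cdot> pw k = dlt \<cdot> Z"
    using cl by (simp add: W_def tau_def P1 G.inv_mult_group G.m_assoc pw_add_assoc G.l_inv_assoc flip: Z(2))
  have "ginv (P1 \<cdot> pw u \<cdot> A) \<cdot> pw t = ginv A \<cdot> tau (- u) (ginv P1 \<cdot> pw k)"
    using cl by (simp add: tau_def k_def G.inv_mult_group ginv_pw G.m_assoc pw_add)
  also have "\<dots> = ginv A \<cdot> dlt \<cdot> tau (- u) Z" using cl clZ by (simp add: P1Z tau_mult tau_dlt G.m_assoc)
  also have "\<dots> \<in> Pos" using Simp_compl(1)[OF AS] Z tau_Pos by (simp add: Pos_mult)
  finally show ?thesis by (simp add: infge_def)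
qed

lemma cycling_raises_inf:
  assumes "x \<in> Bn" "infge x u" "raise_within m x (u + 1)"
  shows "\<exists>g\<in>Bn. infge (conj_by g x) (u + 1) \<and>
    (\<forall>t. infge (ginv x) (- t) \<longrightarrow> infge (ginv (conj_by g x)) (- t))"
  using assms
proof (induction m arbitrary: x)
  case 0
  then have "infge x (u + 1)" using raise_within_0 by blast
  then show ?case using 0 by (intro bexI[of _ idB]) (auto simp: conj_by_def)
next
  case (Suc m)
  show ?case
  proof (cases "infge x (u + 1)")
    case True
    then show ?thesis using Suc.prems by (intro bexI[of _ idB]) (auto simp: conj_by_def)
  next
    case False
    define P where "P = x \<cdot> pw (- u)"
    have P: "P \<in> Pos" using Suc.prems by (simp add: P_def infge_def)
    have xP: "x = P \<cdot> pw u" using Suc.prems by (simp add: P_def G.m_assoc pw_add)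
    obtain A where A: "is_head P A" using head_exists[OF P] by blast
    then obtain P1 where P1: "P1 \<in> Pos" "P = A \<cdot> P1" by (auto simp: is_head_def ldvd_def)
    have AS: "A \<in> Simp" using A by (simp add: is_head_def)
    have cl: "A \<in> Bn" "P1 \<in> Bn" using AS P1 Simp_closed Pos_closed by auto
    define y where "y = P1 \<cdot> pw u \<cdot> A"
    have y: "y = conj_by (ginv A) x" "y \<in> Bn"
      using cl by (simp_all add: y_def xP P1 conj_by_def G.m_assoc G.l_inv_assoc)
    have "y = P1 \<cdot> tau u A \<cdot> pw u" using cl by (simp add: y_def G.m_assoc pw_commute)
    then have "infge y u" using P1 AS cl by (simp add: infge_pw Pos_mult tau_Pos Simp_Pos)
    moreover have "raise_within m y (u + 1)"
      unfolding y_def using raise_within_cycle[OF P A P1] False Suc.prems xP by simp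
    ultimately obtain g where g: "g \<in> Bn" "infge (conj_by g y) (u + 1)"
      "\<forall>t. infge (ginv y) (- t) \<longrightarrow> infge (ginv (conj_by g y)) (- t)"
      using Suc.IH y by blast
    have "conj_by g y = conj_by (g \<cdot> ginv A) x" using g y cl Suc.prems by (simp add: conj_by_mult)
    moreover have "infge (ginv y) (- t)" if "infge (ginv x) (- t)" for t
      using cycle_sup[OF P A P1, of u t] that by (simp add: xP y_def)
    ultimately show ?thesis using g cl by (intro bexI[of _ "g \<cdot> ginv A"]) auto
  qed
qed

lemma conj_class_eq: "conj_class n x = (\<lambda>g. conj_by g x) ` Bn"
  by (auto simp: conj_class_def conj_by_def)

text \<open>
  Otherwise cycling would raise the infimum without raising the supremum, and so decrease the
  canonical length.
\<close>

lemma SSS_inf_maximal: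
  assumes x: "x \<in> Bn" and y: "y \<in> SSS n (conj_class n x)" and z: "z \<in> conj_class n x"
    and k: "infge z k"
  shows "infge y k"
proof (rule ccontr)
  assume low: "\<not> infge y k"
  obtain g h where g: "g \<in> Bn" "y = conj_by g x" and h: "h \<in> Bn" "z = conj_by h x"
    using y z by (auto simp: SSS_def conj_class_eq)
  have yB: "y \<in> Bn" using g x by simp
  define u where "u = braid_inf n y"
  have u: "infge y u" "\<not> infge y (u + 1)" using inf_ge_iff[OF yB, of u] inf_ge_iff[OF yB, of "u + 1"] by (simp_all add: u_def)
  have "z = conj_by (h \<cdot> ginv g) y" using g h x by (simp add: conj_by_mult conj_by_ginv)
  moreover have "u + 1 \<le> k" using low inf_ge_iff[OF yB, of k] by (simp add: u_def)
  moreover have "z \<in> Bn" using h x by simp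
  ultimately have "infge (conj_by (h \<cdot> ginv g) y) (u + 1)" using k infge_mono by metis
  then have "raise_within (n - 1) y (u + 1)" using g h yB by (intro raise_within_start) auto
  from cycling_raises_inf[OF yB u(1) this] obtain f where f: "f \<in> Bn" "infge (conj_by f y) (u + 1)"
    "\<forall>t. infge (ginv y) (- t) \<longrightarrow> infge (ginv (conj_by f y)) (- t)" by blast
  have fB: "conj_by f y \<in> Bn" using f yB by simp
  have "conj_by f y = conj_by (f \<cdot> g) x" using f g x by (simp add: conj_by_mult)
  then have "conj_by f y \<in> conj_class n x" using f g by (auto simp: conj_class_eq)
  then have "canonical_length n y \<le> canonical_length n (conj_by f y)" using y by (simp add: SSS_def)
  moreover have "braid_sup n (conj_by f y) \<le> braid_sup n y"
    using f(3) sup_le_iff[OF fB] sup_le_iff[OF yB] by blast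
  moreover have "u + 1 \<le> braid_inf n (conj_by f y)" using inf_ge_iff[OF fB] f(2) by blast
  ultimately show False by (simp add: canonical_length_def u_def)
qed

text \<open>
  Canonical lengths are nonnegative, so they have a minimum on the conjugacy class.
\<close>

lemma SSS_nonempty: assumes "x \<in> Bn" shows "SSS n (conj_class n x) \<noteq> {}"
proof -
  have cl: "y \<in> Bn" if "y \<in> conj_class n x" for y using that assms by (auto simp: conj_class_eq)
  have pos: "0 \<le> canonical_length n y" if "y \<in> conj_class n x" for y
    using inf_le_sup[OF cl[OF that]] by (simp add: canonical_length_def)
  have "x \<in> conj_class n x" using assms by (auto simp: conj_class_eq conj_by_def intro!: image_eqI[of _ _ idB])
  from ex_has_least_nat[of "\<lambda>y. y \<in> conj_class n x", OF this, of "\<lambda>y. nat (canonical_length n y)"]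
  obtain y where y: "y \<in> conj_class n x"
    "\<forall>z. z \<in> conj_class n x \<longrightarrow> nat (canonical_length n y) \<le> nat (canonical_length n z)" by blast
  have "canonical_length n y \<le> canonical_length n z" if "z \<in> conj_class n x" for z
    using y(2)[rule_format, OF that] pos[OF that] by linarith
  then show ?thesis using y by (auto simp: SSS_def)
qed

lemma SSS_SQP:
  assumes "x \<in> Bn"
  shows "conj_to_SQP n x \<longleftrightarrow> (\<forall>y\<in>SSS n (conj_class n x). braid_inf n y \<ge> 0)"
    and "(\<forall>y\<in>SSS n (conj_class n x). braid_inf n y \<ge> 0) \<longleftrightarrow> (\<exists>y\<in>SSS n (conj_class n x). braid_inf n y \<ge> 0)"
proof -
  let ?S = "SSS n (conj_class n x)"
  have cl: "y \<in> Bn" if "y \<in> conj_class n x" for y using that assms by (auto simp: conj_class_eq)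
  have sub: "y \<in> conj_class n x" if "y \<in> ?S" for y using that by (simp add: SSS_def)
  have inf: "braid_inf n y \<ge> 0 \<longleftrightarrow> y \<in> Pos" if "y \<in> conj_class n x" for y
    using inf_ge_iff[OF cl[OF that], of 0] infge_0[OF cl[OF that]] by simp
  have 1: "\<forall>y\<in>?S. braid_inf n y \<ge> 0" if ass: "conj_to_SQP n x"
  proof
    fix y assume y: "y \<in> ?S"
    obtain z where z: "z \<in> conj_class n x" "z \<in> Pos" using ass by (auto simp: conj_to_SQP_def)
    then have "infge z 0" using infge_0 cl by simp
    then have "infge y 0" using SSS_inf_maximal[OF assms y z(1)] by simp
    then show "braid_inf n y \<ge> 0" using inf_ge_iff[OF cl[OF sub[OF y]]] by blast
  qed
  have 2: "\<exists>y\<in>?S. braid_inf n y \<ge> 0" if "\<forall>y\<in>?S. braid_inf n y \<ge> 0"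
    using that SSS_nonempty[OF assms] by blast
  have 3: "conj_to_SQP n x" if "\<exists>y\<in>?S. braid_inf n y \<ge> 0"
    using that inf sub by (auto simp: conj_to_SQP_def)
  show "conj_to_SQP n x \<longleftrightarrow> (\<forall>y\<in>?S. braid_inf n y \<ge> 0)" using 1 2 3 by blast
  show "(\<forall>y\<in>?S. braid_inf n y \<ge> 0) \<longleftrightarrow> (\<exists>y\<in>?S. braid_inf n y \<ge> 0)" using 1 2 3 by blast
qed

end

section \<open>The decision procedure on lists\<close>

text \<open>
  With partitions as lists of pairs, this is the quotient \<open>rc a \<inter> b\<close>; for \<open>b\<close> the list of all pairs
  it is the complement of \<open>a\<close>.
\<close>

definition filt :: "(nat \<times> nat) list \<Rightarrow> (nat \<times> nat) list \<Rightarrow> (nat \<times> nat) list" where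
  "filt b band = filter (\<lambda>p. \<forall>q\<in>set band. same_side p q) b"

text \<open>
  Turns the left complement into a right one: the gap before point \<open>x\<close> is the position just after
  \<open>x - 1\<close>, so exchanging the two kinds of chords shifts the indices by one (\<open>same_side_swap\<close>).
\<close>

definition down :: "(nat \<times> nat) list \<Rightarrow> (nat \<times> nat) list" where
  "down = map (\<lambda>(i, j). (i - 1, j - 1))"

text \<open>
  One sweep from right to left that moves as much as possible of every factor into its left
  neighbour. It does not compute a normal form, but its first entry is the head. The nested filters
  compute the product of \<open>A\<close> and the absorbed part \<open>filt H A\<close> as the left complement of the
  intersection of their right complements.
\<close>

fun pass :: "(nat \<times> nat) list \<Rightarrow> (nat \<times> nat) list list \<Rightarrow> (nat \<times> nat) list list" where
  "pass grid [] = []"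
| "pass grid (A # xs) = (case pass grid xs of [] \<Rightarrow> [A]
    | H # r \<Rightarrow> filt grid (down (filt (filt grid A) (filt H A))) # filt H (filt H A) # r)"

text \<open>
  Conjugation by \<open>\<delta>\<^sup>-\<^sup>m\<close>, needed to move a cycled head across \<open>\<delta>\<^sup>-\<^sup>m\<close>.
\<close>

fun twist :: "(nat \<times> nat) list \<Rightarrow> nat \<Rightarrow> (nat \<times> nat) list \<Rightarrow> (nat \<times> nat) list" where
  "twist grid 0 A = A"
| "twist grid (Suc m) A = twist grid m (filt grid (filt grid A))"

text \<open>
  The state stands for the braid \<open>P \<delta>\<^sup>-\<^sup>m\<close> with \<open>P\<close> the product of \<open>xs\<close>. A partition is a list without
  repetitions of pairs from \<open>grid\<close>, so comparing lengths tests whether the head is \<open>\<delta>\<close>. The argument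
  \<open>fuel\<close> limits the number of cyclings until the next head \<open>\<delta>\<close>.
\<close>

function loop :: "(nat \<times> nat) list \<Rightarrow> nat \<Rightarrow> nat \<Rightarrow> nat \<Rightarrow> (nat \<times> nat) list list \<Rightarrow> bool" where
  "loop grid n m fuel xs = (if m = 0 then True else (case pass grid xs of [] \<Rightarrow> False
    | H # r \<Rightarrow> if length grid \<le> length H then loop grid n (m - 1) n r
      else if fuel = 0 then False else loop grid n m (fuel - 1) (r @ [twist grid m H])))"
  by pat_completeness auto
termination
  by (relation "measures [\<lambda>(grid, n, m, fuel, xs). m, \<lambda>(grid, n, m, fuel, xs). fuel]") auto

declare loop.simps [simp del]

definition chord_list :: "(nat \<times> nat) list \<Rightarrow> nat \<Rightarrow> nat \<Rightarrow> (nat \<times> nat) list" where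
  "chord_list grid i j = filt grid (down (filt grid [(i, j)]))"

text \<open>
  An inverse band generator is its right complement times \<open>\<delta>\<^sup>-\<^sup>1\<close>, and this \<open>\<delta>\<^sup>-\<^sup>1\<close> is moved to the right
  end across the factors already computed, rotating them.
\<close>

fun translate :: "(nat \<times> nat) list \<Rightarrow> band_word \<Rightarrow> (nat \<times> nat) list list" where
  "translate grid [] = []"
| "translate grid ((i, j, b) # w) = (if b then chord_list grid i j # translate grid w
    else filt grid (chord_list grid i j) # map (\<lambda>A. filt grid (filt grid A)) (translate grid w))"

fun negatives :: "band_word \<Rightarrow> nat" where
  "negatives [] = 0"
| "negatives ((i, j, b) # w) = (if b then negatives w else Suc (negatives w))"

fun row :: "nat \<Rightarrow> nat \<Rightarrow> (nat \<times> nat) list \<Rightarrow> (nat \<times> nat) list" where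
  "row i 0 acc = acc"
| "row i (Suc j) acc = (i, Suc j) # row i j acc"

fun rows :: "nat \<Rightarrow> nat \<Rightarrow> (nat \<times> nat) list" where
  "rows 0 k = []"
| "rows (Suc i) k = row (Suc i) k (rows i k)"

definition decide :: "nat \<Rightarrow> band_word \<Rightarrow> bool" where
  "decide n w = loop (rows n n) n (negatives w) n (translate (rows n n) w)"

lemma row_eq: "row i j acc = map (\<lambda>k. (i, k)) (rev [1..<Suc j]) @ acc"
  by (induction j) auto

lemma set_rows: "set (rows i k) = {1..i} \<times> {1..k}"
  by (induction i) (auto simp: row_eq)

lemma distinct_rows: "distinct (rows i k)"
  by (induction i) (auto simp: row_eq set_rows distinct_map inj_on_def)

lemma same_side_swap: "1 \<le> fst p \<Longrightarrow> 1 \<le> snd p \<Longrightarrow> same_side p q \<longleftrightarrow> same_side q (fst p - 1, snd p - 1)"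
  by (cases p) (auto simp: same_side_def outside_def)

lemma distinct_filt: "distinct b \<Longrightarrow> distinct (filt b band)"
  by (simp add: filt_def)

context dual_braid
begin

definition grid :: "(nat \<times> nat) list" where
  "grid = rows n n"

lemma set_grid: "set grid = full" and distinct_grid: "distinct grid"
  by (simp_all add: grid_def full_def set_rows distinct_rows)

lemma set_filt: "set ys \<subseteq> full \<Longrightarrow> set (filt ys zs) = rc (set zs) \<inter> set ys"
  by (auto simp: filt_def rc_def)

lemma set_filt_grid: "set (filt grid zs) = rc (set zs)"
  using set_filt[of grid zs] rc_sub by (auto simp: set_grid)

lemma set_lc: assumes "set c \<subseteq> full" shows "set (filt grid (down c)) = lc (set c)"
proof -
  have "same_side q (case p of (i, j) \<Rightarrow> (i - 1, j - 1)) \<longleftrightarrow> same_side p q" if "p \<in> set c" for p q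
    using same_side_swap[of p q] that assms by (auto simp: full_def split: prod.split)
  then show ?thesis unfolding set_filt_grid by (auto simp: rc_def lc_def down_def)
qed

definition good :: "(nat \<times> nat) list \<Rightarrow> bool" where
  "good A \<longleftrightarrow> nc (set A) \<and> distinct A"

lemma full_iff: assumes "good A" shows "length grid \<le> length A \<longleftrightarrow> set A = full"
proof
  have d: "card (set A) = length A" "card full = length grid"
    using assms distinct_grid distinct_card set_grid unfolding good_def by metis+
  show "set A = full" if "length grid \<le> length A"
    using that assms d nc_sub by (intro card_seteq finite_full) (auto simp: good_def)
  show "length grid \<le> length A" if "set A = full" using that d by simp
qed

lemma good_filt: "good A \<Longrightarrow> good C \<Longrightarrow> good (filt C A)"
  using nc_sub by (auto simp: good_def set_filt distinct_filt intro!: nc_Int nc_rc')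

lemma good_grid: "good grid"
  by (simp add: good_def set_grid nc_full distinct_grid)

lemma good_lc: "good c \<Longrightarrow> good (filt grid (down c))"
  using nc_sub by (auto simp: good_def set_lc distinct_filt distinct_grid intro!: nc_lc')

lemma pass_correct:
  assumes "\<forall>A\<in>set xs. good A"
  shows "(\<forall>A\<in>set (pass grid xs). good A) \<and>
    (xs = [] \<and> pass grid xs = [] \<or>
     xs \<noteq> [] \<and> (\<exists>H r. pass grid xs = H # r \<and> set H = whd (map set xs) \<and>
       ev (map set (H # r)) = ev (map set xs)))"
  using assms
proof (induction xs)
  case (Cons A xs)
  have A: "good A" "nc (set A)" and xs: "\<forall>A\<in>set xs. good A" using Cons.prems by (auto simp: good_def)
  have xs': "\<forall>A\<in>set (map set xs). nc A" using xs by (auto simp: good_def)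
  show ?case
  proof (cases xs)
    case Nil
    have "whd [set A] = set A"
      using mul_quotient[OF A(2) A(2)] diag_sub[OF nc_rc'[OF A(2)]] rc_Int_self[OF A(2)] by (simp add: Int_absorb1)
    then show ?thesis using Nil A by simp
  next
    case (Cons _ _)
    then obtain H r where p: "pass grid xs = H # r" "set H = whd (map set xs)"
        "ev (map set (H # r)) = ev (map set xs)" and g: "good H" "\<forall>A\<in>set r. good A"
      using Cons.IH[OF xs] by auto
    define E where "E = filt H A"
    define D where "D = filt (filt grid A) E"
    have E: "good E" "set E = rc (set A) \<inter> set H" "nc (set E)"
      using A g nc_sub good_filt by (auto simp: E_def set_filt good_def)
    have D: "good D" "set D = rc (set A) \<inter> rc (set E)"
      using A E good_filt good_grid rc_sub by (auto simp: D_def set_filt set_filt_grid)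
    have D': "set (filt grid (down D)) = mul (set A) (set E)"
      using D nc_sub by (simp add: set_lc good_def mul_def)
    have R: "good (filt H E)" "set (filt H E) = rc (set E) \<inter> set H"
      using good_filt[OF E(1) g(1)] set_filt[of H E] g nc_sub by (auto simp: good_def)
    have eq: "pass grid (A # xs) = filt grid (down D) # filt H E # r" by (simp add: p D_def E_def)
    have "lift (mul (set A) (set E)) = lift (set A) \<cdot> lift (set E)"
      using A E by (intro lift_mul) auto
    moreover have "lift (set H) = lift (set E) \<cdot> lift (rc (set E) \<inter> set H)"
      using E g by (intro lift_sub) (auto simp: good_def)
    ultimately have "ev (map set (filt grid (down D) # filt H E # r)) = lift (set A) \<cdot> ev (map set (H # r))"
      by (simp add: D' R G.m_assoc)
    then have "ev (map set (pass grid (A # xs))) = ev (map set (A # xs))"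
      unfolding eq p(3) by simp
    moreover have "whd (map set (A # xs)) = mul (set A) (set E)" using E p by simp
    ultimately show ?thesis using eq D D' R g good_lc by auto
  qed
qed simp

lemma twist_correct:
  "good A \<Longrightarrow> good (twist grid m A) \<and> lift (set (twist grid m A)) = tau (- int m) (lift (set A))"
proof (induction m arbitrary: A)
  case 0
  then show ?case by (simp add: tau_0)
next
  case (Suc m)
  define C where "C = filt grid (filt grid A)"
  have C: "good C" using Suc.prems good_grid good_filt by (simp add: C_def)
  have A: "nc (set A)" using Suc.prems by (simp add: good_def)
  have "set C = rc (rc (set A))" by (simp add: C_def set_filt_grid)
  then have "dlt \<cdot> lift (set C) = lift (set A) \<cdot> dlt" using lift_rc_rc[OF A] by simp
  then have "tau 1 (lift (set C)) \<cdot> dlt = lift (set A) \<cdot> dlt" using pw_commute[of "lift (set C)" 1] by (simp add: pw_1)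
  then have "tau 1 (lift (set C)) = lift (set A)" by simp
  then have "tau (- 1) (tau 1 (lift (set C))) = tau (- 1) (lift (set A))" by simp
  then have "lift (set C) = tau (- 1) (lift (set A))" by (simp add: tau_tau tau_0)
  then show ?case using Suc.IH[OF C] by (simp add: C_def tau_tau algebra_simps)
qed

lemma ev_dlt: "\<forall>A\<in>set w. nc A \<Longrightarrow> ev w \<cdot> dlt = dlt \<cdot> ev (map (\<lambda>A. rc (rc A)) w)"
proof (induction w)
  case (Cons A w)
  have "ev (A # w) \<cdot> dlt = lift A \<cdot> (ev w \<cdot> dlt)" by (simp add: G.m_assoc)
  also have "\<dots> = lift A \<cdot> dlt \<cdot> ev (map (\<lambda>A. rc (rc A)) w)" using Cons by (simp add: G.m_assoc)
  also have "\<dots> = dlt \<cdot> ev (map (\<lambda>A. rc (rc A)) (A # w))" using Cons.prems by (simp add: lift_rc_rc G.m_assoc)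
  finally show ?case .
qed simp

lemma chord_list_correct:
  assumes "1 \<le> i" "i < j" "j \<le> n" shows "good (chord_list grid i j)" "lift (set (chord_list grid i j)) = band i j"
proof -
  have eq: "set (chord_list grid i j) = chord i j" using set_lc[of "filt grid [(i, j)]"] rc_sub
    by (simp add: chord_list_def chord_def set_filt_grid)
  then show "lift (set (chord_list grid i j)) = band i j" using lift_chord assms by simp
  show "good (chord_list grid i j)" using eq nc_chord by (simp add: good_def) (simp add: chord_list_def distinct_filt distinct_grid)
qed

lemma translate_correct:
  "w \<in> band_words n \<Longrightarrow> (\<forall>A\<in>set (translate grid w). good A) \<and>
    band_eval n w = ev (map set (translate grid w)) \<cdot> pw (- int (negatives w))"
proof (induction w)
  case Nil
  then show ?case by (simp add: band_eval_Nil)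
next
  case (Cons l w)
  obtain i j b where l: "l = (i, j, b)" by (metis surj_pair)
  have ij: "1 \<le> i" "i < j" "j \<le> n" and w: "w \<in> band_words n" using Cons.prems by (auto simp: band_words_def l)
  note IH = Cons.IH[OF w]
  note g = chord_list_correct[OF ij]
  show ?case
  proof (cases b)
    case True
    then show ?thesis using IH g ij by (simp add: l band_eval_Cons G.m_assoc)
  next
    case False
    define W where "W = map set (translate grid w)"
    have W: "\<forall>A\<in>set W. nc A" using IH by (auto simp: W_def good_def)
    define t where "t = set (chord_list grid i j)"
    have t: "nc t" "lift t = band i j" using g by (auto simp: t_def good_def)
    have "ginv (band i j) = lift (rc t) \<cdot> pw (- 1)"
    proof -
      have "band i j \<cdot> lift (rc t) = dlt" using lift_rc[OF t(1)] t by simp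
      then have "band i j \<cdot> (lift (rc t) \<cdot> pw (- 1)) = idB"
        using ij pw_add[of 1 "- 1"] by (simp add: pw_1 flip: G.m_assoc)
      from G.inv_comm[OF this] show ?thesis using ij by (intro G.inv_equality) auto
    qed
    moreover have "pw (- 1) \<cdot> ev W = ev (map (\<lambda>A. rc (rc A)) W) \<cdot> pw (- 1)"
    proof -
      have "pw (- 1) \<cdot> (ev W \<cdot> dlt) \<cdot> pw (- 1) = pw (- 1) \<cdot> (dlt \<cdot> ev (map (\<lambda>A. rc (rc A)) W)) \<cdot> pw (- 1)"
        using ev_dlt[OF W] by simp
      then show ?thesis unfolding pw_1[symmetric] by (simp add: G.m_assoc pw_add pw_add_assoc)
    qed
    ultimately have "ginv (band i j) \<cdot> (ev W \<cdot> pw (- int (negatives w))) =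
        lift (rc t) \<cdot> (ev (map (\<lambda>A. rc (rc A)) W) \<cdot> pw (- 1) \<cdot> pw (- int (negatives w)))"
      by (simp add: G.m_assoc) (simp flip: G.m_assoc)
    also have "\<dots> = ev (map set (translate grid (l # w))) \<cdot> pw (- int (negatives (l # w)))"
      using False by (simp add: l W_def t_def set_filt_grid G.m_assoc pw_add o_def)
    finally have "band_eval n (l # w) = ev (map set (translate grid (l # w))) \<cdot> pw (- int (negatives (l # w)))"
      using False IH by (simp add: l band_eval_Cons W_def)
    moreover have "\<forall>A\<in>set (translate grid (l # w)). good A"
      using False IH g good_filt good_grid by (auto simp: l)
    ultimately show ?thesis by blast
  qed
qed

lemma conj_to_SQP_iff: "conj_to_SQP n x \<longleftrightarrow> (\<exists>g\<in>Bn. conj_by g x \<in> Pos)"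
  by (auto simp: conj_to_SQP_def conj_class_eq)

lemma conj_to_SQP_conj: assumes "g \<in> Bn" "x \<in> Bn" shows "conj_to_SQP n (conj_by g x) \<longleftrightarrow> conj_to_SQP n x"
proof
  assume "conj_to_SQP n (conj_by g x)"
  then obtain h where "h \<in> Bn" "conj_by h (conj_by g x) \<in> Pos" by (auto simp: conj_to_SQP_iff)
  then have "h \<cdot> g \<in> Bn" "conj_by (h \<cdot> g) x \<in> Pos" using assms by (simp_all add: conj_by_mult)
  then show "conj_to_SQP n x" unfolding conj_to_SQP_iff by blast
next
  assume "conj_to_SQP n x"
  then obtain h where h: "h \<in> Bn" "conj_by h x \<in> Pos" by (auto simp: conj_to_SQP_iff)
  have "conj_by (h \<cdot> ginv g) (conj_by g x) = conj_by h x" using h assms by (simp add: conj_by_mult conj_by_ginv)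
  then show "conj_to_SQP n (conj_by g x)" using h assms unfolding conj_to_SQP_iff by (metis G.inv_closed G.m_closed)
qed

lemma raise_within_mono: "raise_within m x k \<Longrightarrow> m \<le> m' \<Longrightarrow> raise_within m' x k"
  unfolding raise_within_def by force

text \<open>
  If \<open>P \<delta>\<^sup>u\<close> has infimum above \<open>u\<close>, then \<open>\<delta>\<close> divides \<open>P\<close> and hence its head.
\<close>

lemma head_full:
  assumes w: "\<forall>A\<in>set w. nc A" and inf: "infge (ev w \<cdot> pw u) (u + 1)" shows "whd w = full"
proof -
  have P: "ev w \<in> Pos" by (rule ev_Pos[OF w])
  have nc: "nc (whd w)" by (rule nc_whd[OF w])
  define Y where "Y = ev w \<cdot> pw (- 1)"
  have "Y = ev w \<cdot> pw u \<cdot> pw (- (u + 1))" by (simp add: Y_def G.m_assoc pw_add)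
  then have Y: "Y \<in> Pos" using inf by (simp add: infge_def)
  have clY: "Y \<in> Bn" using Y by (rule Pos_closed)
  have "ev w = Y \<cdot> dlt" using pw_add[of "- 1" 1] by (simp add: Y_def G.m_assoc pw_1)
  also have "\<dots> = dlt \<cdot> tau (- 1) Y" using pw_commute[of "tau (- 1) Y" 1] clY by (simp add: pw_1 tau_tau tau_0)
  finally have "ldvd dlt (ev w)" by (rule ldvdI) (rule tau_Pos[OF Y])
  then have "ldvd dlt (lift (whd w))" by (rule is_headD1[OF is_head_whd[OF w] P dlt_Simp])
  then obtain z where z: "z \<in> Pos" "lift (whd w) = dlt \<cdot> z" by (auto simp: ldvd_def)
  have "bexp dlt = bexp (lift (whd w)) + bexp (lift (rc (whd w)))"
    using lift_rc[OF nc] by (metis bexp_mult lift_closed)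
  moreover have "bexp (lift (whd w)) = bexp dlt + bexp z" using z by (simp add: bexp_mult Pos_closed)
  moreover have "0 \<le> bexp (lift (rc (whd w)))" "0 \<le> bexp z"
    using bexp_Pos(1) z lift_Pos nc_rc' nc by auto
  ultimately have "bexp z = 0" by linarith
  then have "lift (whd w) = dlt" using z bexp_Pos(2)[OF z(1)] by simp
  then show ?thesis using lift_eq_dlt_iff[OF nc] by simp
qed

text \<open>
  The hypothesis on \<open>fuel\<close> says that if the infimum can be raised at all, then within \<open>fuel\<close> cyclings.
  It holds trivially after each head \<open>\<delta>\<close>, when \<open>fuel\<close> is reset to \<open>n\<close>, and cycling preserves it by
  \<open>raise_within_cycle\<close>. When \<open>fuel\<close> runs out without a head \<open>\<delta>\<close>, the infimum is the maximal one.
\<close>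

lemma loop_correct:
  assumes "\<forall>A\<in>set xs. good A"
    and "\<exists>g\<in>Bn. infge (conj_by g (ev (map set xs) \<cdot> pw (- int m))) (- int m + 1) \<Longrightarrow>
      raise_within fuel (ev (map set xs) \<cdot> pw (- int m)) (- int m + 1)"
  shows "loop grid n m fuel xs \<longleftrightarrow> conj_to_SQP n (ev (map set xs) \<cdot> pw (- int m))"
  using assms
proof (induction "(m, fuel)" arbitrary: m fuel xs
    rule: wf_induct_rule[OF wf_lex_prod[OF wf_less_than wf_less_than]])
  case less: 1
  define P x where "P = ev (map set xs)" "x = P \<cdot> pw (- int m)"
  have w: "\<forall>A\<in>set (map set xs). nc A" using less.prems(1) by (auto simp: good_def)
  have P: "P \<in> Pos" unfolding P_x_def by (rule ev_Pos[OF w])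
  have cl: "P \<in> Bn" "x \<in> Bn" using P Pos_closed by (auto simp: P_x_def)
  show ?case
  proof (cases "m = 0")
    case True
    have "conj_to_SQP n P" unfolding conj_to_SQP_iff
      using P cl by (intro bexI[of _ idB]) (auto simp: conj_by_def)
    then show ?thesis using True cl by (subst loop.simps) (simp add: P_x_def)
  next
    case m: False
    show ?thesis
    proof (cases "xs = []")
      case True
      have "\<not> conj_to_SQP n (pw (- int m))"
      proof
        assume "conj_to_SQP n (pw (- int m))"
        then obtain g where "g \<in> Bn" "conj_by g (pw (- int m)) \<in> Pos" by (auto simp: conj_to_SQP_iff)
        then have "0 \<le> bexp (pw (- int m))" using bexp_Pos(1)[of "conj_by g (pw (- int m))"]
          by (simp add: conj_by_def bexp_mult bexp_inv)
        then show False using m n_ge_2 by (simp add: bexp_pw mult_le_0_iff)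
      qed
      then show ?thesis using True m by (subst loop.simps) simp
    next
      case xs: False
      then obtain H r where p: "pass grid xs = H # r" "set H = whd (map set xs)"
          "ev (map set (H # r)) = P" and g: "good H" "\<forall>A\<in>set r. good A"
        using pass_correct[OF less.prems(1)] by (auto simp: P_x_def)
      define A P1 where "A = lift (set H)" "P1 = ev (map set r)"
      have r: "\<forall>A\<in>set (map set r). nc A" using g by (auto simp: good_def)
      have PA: "P = A \<cdot> P1" using p by (simp add: A_P1_def)
      have clA: "A \<in> Bn" "P1 \<in> Bn" by (simp_all add: A_P1_def)
      have hd: "is_head P A" unfolding A_P1_def p P_x_def by (rule is_head_whd[OF w])
      show ?thesis
      proof (cases "set H = full")
        case True
        define y where "y = P1 \<cdot> pw (- int (m - 1))"
        have "A = dlt" using True by (simp add: A_P1_def lift_full)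
        then have "y = conj_by (ginv dlt) x"
          using clA m unfolding conj_by_def y_def P_x_def(2) PA
          by (simp add: G.m_assoc G.l_inv_assoc pw_dlt of_nat_diff)
        then have "conj_to_SQP n y \<longleftrightarrow> conj_to_SQP n x" using conj_to_SQP_conj cl by simp
        moreover have "loop grid n (m - 1) n r \<longleftrightarrow> conj_to_SQP n y"
          unfolding y_def A_P1_def
        proof (rule less.hyps)
          show "((m - 1, n), (m, fuel)) \<in> less_than <*lex*> less_than" using m by simp
          show "\<forall>A\<in>set r. good A" by (rule g)
          assume "\<exists>g\<in>Bn. infge (conj_by g (ev (map set r) \<cdot> pw (- int (m - 1)))) (- int (m - 1) + 1)"
          then show "raise_within n (ev (map set r) \<cdot> pw (- int (m - 1))) (- int (m - 1) + 1)"
            using raise_within_mono[OF raise_within_start] by auto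
        qed
        ultimately show ?thesis using True m p(1) full_iff[OF g(1)]
          by (subst loop.simps) (simp flip: P_x_def)
      next
        case nU: False
        have low: "\<not> infge x (- int m + 1)"
          using head_full[OF w, of "- int m"] nU p(2) by (auto simp: P_x_def)
        have raise: "\<exists>g\<in>Bn. infge (conj_by g x) (- int m + 1)" if "conj_to_SQP n x"
        proof -
          obtain g where "g \<in> Bn" "conj_by g x \<in> Pos" using \<open>conj_to_SQP n x\<close> by (auto simp: conj_to_SQP_iff)
          then have "infge (conj_by g x) 0" using infge_0 cl by simp
          then show ?thesis using infge_mono[of "conj_by g x" 0 "- int m + 1"] m cl \<open>g \<in> Bn\<close> by auto
        qed
        have within: "raise_within fuel x (- int m + 1)" if "\<exists>g\<in>Bn. infge (conj_by g x) (- int m + 1)"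
          using less.prems(2) that by (simp add: P_x_def)
        show ?thesis
        proof (cases fuel)
          case 0
          have "\<not> conj_to_SQP n x" using raise within raise_within_0[of x] low cl 0 by blast
          then show ?thesis using 0 nU m p(1) full_iff[OF g(1)]
            by (subst loop.simps) (simp flip: P_x_def)
        next
          case (Suc f)
          define C where "C = twist grid m H"
          have C: "good C" "lift (set C) = tau (- int m) A"
            using twist_correct[OF g(1), of m] by (simp_all add: C_def A_P1_def)
          define y where "y = ev (map set (r @ [C])) \<cdot> pw (- int m)"
          have y: "y = P1 \<cdot> pw (- int m) \<cdot> A"
            using clA by (simp add: y_def ev_append C A_P1_def G.m_assoc pw_commute)
          have yx: "y = conj_by (ginv A) x"
            using clA cl by (simp add: y conj_by_def P_x_def(2) PA G.m_assoc G.l_inv_assoc)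
          have "loop grid n m f (r @ [C]) \<longleftrightarrow> conj_to_SQP n y"
            unfolding y_def C_def
          proof (rule less.hyps)
            show "((m, f), (m, fuel)) \<in> less_than <*lex*> less_than" using Suc by simp
            show "\<forall>A\<in>set (r @ [twist grid m H]). good A" using g C by (simp add: C_def)
            assume "\<exists>g\<in>Bn. infge (conj_by g (ev (map set (r @ [twist grid m H])) \<cdot> pw (- int m))) (- int m + 1)"
            then obtain h where "h \<in> Bn" "infge (conj_by h y) (- int m + 1)" by (auto simp: y_def C_def)
            then have "\<exists>g\<in>Bn. infge (conj_by g x) (- int m + 1)"
              using clA cl by (intro bexI[of _ "h \<cdot> ginv A"]) (simp_all add: conj_by_mult flip: yx)
            then have "raise_within (Suc f) x (- int m + 1)" using within Suc by simp
            then have "raise_within f y (- int m + 1)"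
              using raise_within_cycle[OF P hd _ PA, of "- int m" f] low ev_Pos[OF r] y
              by (simp add: P_x_def(2) A_P1_def)
            then show "raise_within f (ev (map set (r @ [twist grid m H])) \<cdot> pw (- int m)) (- int m + 1)"
              by (simp add: y_def C_def)
          qed
          moreover have "conj_to_SQP n y \<longleftrightarrow> conj_to_SQP n x" using conj_to_SQP_conj cl clA yx by simp
          ultimately show ?thesis using Suc nU m p(1) full_iff[OF g(1)]
            by (subst loop.simps) (simp flip: P_x_def C_def)
        qed
      qed
    qed
  qed
qed

theorem decide_correct:
  assumes "w \<in> band_words n" shows "decide n w \<longleftrightarrow> conj_to_SQP n (band_eval n w)"
proof -
  have c: "\<forall>A\<in>set (translate grid w). good A" "band_eval n w = ev (map set (translate grid w)) \<cdot> pw (- int (negatives w))"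
    using translate_correct[OF assms] by auto
  show ?thesis
    unfolding decide_def grid_def[symmetric] c(2)
    using raise_within_mono[OF raise_within_start] by (intro loop_correct c) auto
qed

end

section \<open>A Lisp program and its running time\<close>

text \<open>
  Evaluation with an upper bound on the time. The rules below compute value and bound from the
  expression, so that each function body is evaluated symbolically by resolution.
\<close>

definition run :: "expr list \<Rightarrow> data list \<Rightarrow> expr \<Rightarrow> data \<Rightarrow> nat \<Rightarrow> bool" where
  "run P env e v T \<longleftrightarrow> (\<exists>t\<le>T. evaluates P env e v t)"

definition runs :: "expr list \<Rightarrow> data list \<Rightarrow> expr list \<Rightarrow> data list \<Rightarrow> nat \<Rightarrow> bool" where
  "runs P env es vs T \<longleftrightarrow> (\<exists>t\<le>T. evaluates_list P env es vs t)"

lemma run_weaken: "run P env e v T \<Longrightarrow> v = v' \<Longrightarrow> T \<le> T' \<Longrightarrow> run P env e v' T'"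
  unfolding run_def using le_trans by blast

lemma run_nth: "i < length env \<Longrightarrow> run P env (Param i) (env ! i) 1"
  unfolding run_def using evaluates_evaluates_list.Param by blast

lemma run_Param:
  "run P (d0 # env) (Param 0) d0 1"
  "run P (d0 # d1 # env) (Param 1) d1 1"
  "run P (d0 # d1 # d2 # env) (Param 2) d2 1"
  "run P (d0 # d1 # d2 # d3 # env) (Param 3) d3 1"
  "run P (d0 # d1 # d2 # d3 # d4 # env) (Param 4) d4 1"
  using run_nth[of 0 "d0 # env"] run_nth[of 1 "d0 # d1 # env"] run_nth[of 2 "d0 # d1 # d2 # env"]
    run_nth[of 3 "d0 # d1 # d2 # d3 # env"] run_nth[of 4 "d0 # d1 # d2 # d3 # d4 # env"] by simp_all

lemma run_Atom: "run P env AtomE Atom 1"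
  unfolding run_def using evaluates_evaluates_list.AtomE by blast

lemma run_Dot: "run P env e1 v1 T1 \<Longrightarrow> run P env e2 v2 T2 \<Longrightarrow> run P env (DotE e1 e2) (Dot v1 v2) (T1 + T2 + 1)"
  unfolding run_def by (meson add_le_mono le_refl evaluates_evaluates_list.DotE)

lemma run_Car: "run P env e (Dot x y) T \<Longrightarrow> run P env (CarE e) x (T + 1)"
  unfolding run_def using evaluates_evaluates_list.CarE[of P env e "Dot x y"] by (metis add_le_mono1 car.simps(2))

lemma run_Cdr: "run P env e (Dot x y) T \<Longrightarrow> run P env (CdrE e) y (T + 1)"
  unfolding run_def using evaluates_evaluates_list.CdrE[of P env e "Dot x y"] by (metis add_le_mono1 cdr.simps(2))

text \<open>
  Unlike \<open>run_Cdr\<close>, this rule leaves an encoded number folded.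
\<close>

lemma run_pred: "run P env e (encode_nat k) T \<Longrightarrow> run P env (CdrE e) (encode_nat (k - 1)) (T + 1)"
proof -
  have "cdr (encode_nat k) = encode_nat (k - 1)" by (cases k) auto
  then show "run P env e (encode_nat k) T \<Longrightarrow> run P env (CdrE e) (encode_nat (k - 1)) (T + 1)"
    unfolding run_def using evaluates_evaluates_list.CdrE[of P env e "encode_nat k"] by (metis add_le_mono1)
qed

lemma run_If:
  assumes "run P env e v T" "run P env (if v = Atom then e2 else e1) v' T'"
  shows "run P env (IfE e e1 e2) v' (T + T' + 1)"
proof -
  obtain t t' where t: "t \<le> T" "evaluates P env e v t" "t' \<le> T'"
      "evaluates P env (if v = Atom then e2 else e1) v' t'"
    using assms by (auto simp: run_def)
  then have "evaluates P env (IfE e e1 e2) v' (t + t' + 1)"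
    using evaluates_evaluates_list.IfTrue[of P env e v t e1 v' t' e2]
      evaluates_evaluates_list.IfFalse[of P env e t e2 v' t' e1] by (cases "v = Atom") auto
  then show ?thesis using t unfolding run_def by (meson add_le_mono le_refl)
qed

lemma runs_Nil: "runs P env [] [] 0"
  unfolding runs_def using evaluates_evaluates_list.Nil by blast

lemma runs_Cons: "run P env e v T \<Longrightarrow> runs P env es vs T' \<Longrightarrow> runs P env (e # es) (v # vs) (T + T')"
  unfolding run_def runs_def by (meson add_le_mono evaluates_evaluates_list.Cons)

lemma run_Call: "runs P env es vs T \<Longrightarrow> run P vs (P ! f) v T' \<Longrightarrow> f < length P \<Longrightarrow>
    run P env (Call f es) v (T + T' + 1)"
  unfolding run_def runs_def by (meson add_le_mono le_refl evaluates_evaluates_list.Call)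

abbreviation "TrueE \<equiv> DotE AtomE AtomE"

text \<open>
  Function bodies are named after the functions they implement; calls refer to the positions in
  \<open>prog\<close>. \<open>slide_body\<close> and \<open>pass_cons_body\<close> together implement the recursive case of \<open>pass\<close>, with
  intermediate results passed as arguments because the language has no local variables;
  \<open>step_body\<close> does the same for \<open>loop\<close>. \<open>le_body\<close> compares numbers as well as lengths of lists.
\<close>

definition "le_body = IfE (Param 0) (IfE (Param 1) (Call 0 [CdrE (Param 0), CdrE (Param 1)]) AtomE) TrueE"
definition "eq_body = IfE (Param 0) (Param 1) (IfE (Param 1) AtomE TrueE)"
definition "same_side_body = Call 1
  [Call 1 [Call 0 [CarE (Param 0), CarE (Param 1)], Call 0 [CdrE (Param 0), CarE (Param 1)]],
   Call 1 [Call 0 [CarE (Param 0), CdrE (Param 1)], Call 0 [CdrE (Param 0), CdrE (Param 1)]]]"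
definition "all_body = IfE (Param 1)
  (IfE (Call 2 [Param 0, CarE (Param 1)]) (Call 3 [Param 0, CdrE (Param 1)]) AtomE) TrueE"
definition "filt_body = IfE (Param 0)
  (IfE (Call 3 [CarE (Param 0), Param 1])
    (DotE (CarE (Param 0)) (Call 4 [CdrE (Param 0), Param 1])) (Call 4 [CdrE (Param 0), Param 1])) AtomE"
definition "down_body = IfE (Param 0)
  (DotE (DotE (CdrE (CarE (CarE (Param 0)))) (CdrE (CdrE (CarE (Param 0))))) (Call 5 [CdrE (Param 0)])) AtomE"
definition "slide_body = DotE (Call 4 [Param 0, Call 5 [Call 4 [Call 4 [Param 0, Param 1], Param 4]]])
  (DotE (Call 4 [Param 2, Param 4]) (Param 3))"
definition "pass_cons_body = IfE (Param 2)
  (Call 6 [Param 0, Param 1, CarE (Param 2), CdrE (Param 2), Call 4 [CarE (Param 2), Param 1]])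
  (DotE (Param 1) AtomE)"
definition "pass_body = IfE (Param 1) (Call 7 [Param 0, CarE (Param 1), Call 8 [Param 0, CdrE (Param 1)]]) AtomE"
definition "tw_body = IfE (Param 1)
  (Call 9 [Param 0, CdrE (Param 1), Call 4 [Param 0, Call 4 [Param 0, Param 2]]]) (Param 2)"
definition "snoc_body = IfE (Param 0)
  (DotE (CarE (Param 0)) (Call 10 [CdrE (Param 0), Param 1])) (DotE (Param 1) AtomE)"
definition "loop_body = IfE (Param 2)
  (Call 12 [Param 0, Param 1, Param 2, Param 3, Call 8 [Param 0, Param 4]]) TrueE"
definition "step_body = IfE (Param 4)
  (IfE (Call 0 [Param 0, CarE (Param 4)])
    (Call 11 [Param 0, Param 1, CdrE (Param 2), Param 1, CdrE (Param 4)])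
    (IfE (Param 3)
      (Call 11 [Param 0, Param 1, Param 2, CdrE (Param 3),
        Call 10 [CdrE (Param 4), Call 9 [Param 0, Param 2, CarE (Param 4)]]]) AtomE)) AtomE"
definition "gen_body = Call 4 [Param 0, Call 5 [Call 4 [Param 0, DotE (DotE (Param 1) (Param 2)) AtomE]]]"
definition "map_body = IfE (Param 1)
  (DotE (Call 4 [Param 0, Call 4 [Param 0, CarE (Param 1)]]) (Call 14 [Param 0, CdrE (Param 1)])) AtomE"
definition "letter_gen = Call 13 [Param 0, CarE (CarE (Param 1)), CarE (CdrE (CarE (Param 1)))]"
definition "conv_body = IfE (Param 1)
  (IfE (CdrE (CdrE (CarE (Param 1))))
    (DotE letter_gen (Call 15 [Param 0, CdrE (Param 1)]))
    (DotE (Call 4 [Param 0, letter_gen]) (Call 14 [Param 0, Call 15 [Param 0, CdrE (Param 1)]]))) AtomE"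
definition "negs_body = IfE (Param 0)
  (IfE (CdrE (CdrE (CarE (Param 0)))) (Call 16 [CdrE (Param 0)]) (DotE AtomE (Call 16 [CdrE (Param 0)]))) AtomE"
definition "row_body = IfE (Param 1)
  (DotE (DotE (Param 0) (Param 1)) (Call 17 [Param 0, CdrE (Param 1), Param 2])) (Param 2)"
definition "rows_body = IfE (Param 0) (Call 17 [Param 0, Param 1, Call 18 [CdrE (Param 0), Param 1]]) AtomE"
definition "decide_body = Call 11 [Param 0, Param 1, Call 16 [Param 2], Param 1, Call 15 [Param 0, Param 2]]"
definition "main_body = Call 19 [Call 18 [CarE (Param 0), CarE (Param 0)], CarE (Param 0), CdrE (Param 0)]"

definition prog :: "expr list" where
  "prog = [le_body, eq_body, same_side_body, all_body, filt_body, down_body, slide_body, pass_cons_body, pass_body,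
    tw_body, snoc_body, loop_body, step_body, gen_body, map_body, conv_body, negs_body, row_body, rows_body,
    decide_body]"

lemma prog_nth:
  "prog ! 0 = le_body" "prog ! 1 = eq_body" "prog ! 2 = same_side_body" "prog ! 3 = all_body"
  "prog ! 4 = filt_body" "prog ! 5 = down_body" "prog ! 6 = slide_body" "prog ! 7 = pass_cons_body"
  "prog ! 8 = pass_body" "prog ! 9 = tw_body" "prog ! 10 = snoc_body" "prog ! 11 = loop_body"
  "prog ! 12 = step_body" "prog ! 13 = gen_body" "prog ! 14 = map_body" "prog ! 15 = conv_body"
  "prog ! 16 = negs_body" "prog ! 17 = row_body" "prog ! 18 = rows_body" "prog ! 19 = decide_body"
  by (simp_all add: prog_def)

lemma length_prog: "length prog = 20"
  by (simp add: prog_def)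

text \<open>
  The length of the right spine: the value of an encoded number and the length of an encoded list.
\<close>

fun spine :: "data \<Rightarrow> nat" where
  "spine Atom = 0"
| "spine (Dot x y) = Suc (spine y)"

fun enc_list :: "('a \<Rightarrow> data) \<Rightarrow> 'a list \<Rightarrow> data" where
  "enc_list f [] = Atom"
| "enc_list f (x # xs) = Dot (f x) (enc_list f xs)"

fun enc_pair :: "nat \<times> nat \<Rightarrow> data" where
  "enc_pair (i, j) = Dot (encode_nat i) (encode_nat j)"

abbreviation "enc_rel \<equiv> enc_list enc_pair"
abbreviation "enc_rels \<equiv> enc_list (enc_list enc_pair)"

lemma spine_encode_nat [simp]: "spine (encode_nat k) = k"
  by (induction k) auto

lemma spine_enc_list [simp]: "spine (enc_list f xs) = length xs"
  by (induction xs) auto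

lemma encode_nat_Atom: "encode_nat k = Atom \<longleftrightarrow> k = 0"
  by (cases k) auto

lemma encode_bool_Atom: "encode_bool b = Atom \<longleftrightarrow> \<not> b"
  by simp

lemmas run_rules = run_Param run_Atom run_Dot run_Car run_Cdr run_If runs_Nil runs_Cons run_Call
lemmas branch_simps = data.distinct if_True if_False encode_nat_Atom encode_bool_Atom simp_thms

text \<open>
  This and the following specifications all have the same proof: unfold the body, evaluate it with
  the rules above and the specifications of the functions it calls, and compare the bounds.
\<close>

lemma le_spec: "run prog [d, d'] (prog ! 0) (encode_bool (spine d \<le> spine d')) (12 * (spine d + 1))"
proof (induction d arbitrary: d')
  case Atom
  show ?case unfolding prog_nth le_body_def
    by (rule run_weaken, (rule run_rules | simp only: branch_simps)+) simp_all
next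
  case (Dot x y)
  show ?case
  proof (cases d')
    case Atom
    show ?thesis unfolding prog_nth le_body_def Atom
      by (rule run_weaken, (rule run_rules | simp only: branch_simps)+) simp_all
  next
    case (Dot x' y')
    show ?thesis unfolding prog_nth le_body_def Dot
      by (rule run_weaken, (rule run_rules Dot.IH | simp only: branch_simps length_prog)+) (simp_all add: length_prog)
  qed
qed


lemma eq_spec: "run prog [encode_bool b, encode_bool c] (prog ! 1) (encode_bool (b = c)) 10"
  unfolding prog_nth eq_body_def
  by (cases b; cases c; simp only: encode_bool.simps branch_simps;
      rule run_weaken, (rule run_rules | simp only: branch_simps)+; simp)

lemma same_side_spec: "run prog [enc_pair p, enc_pair q] (prog ! 2) (encode_bool (same_side p q)) (24 * (fst p + snd p) + 200)"
  unfolding prog_nth same_side_body_def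
  by (cases p; cases q; simp only: enc_pair.simps;
      rule run_weaken, (rule run_rules le_spec eq_spec | simp only: branch_simps length_prog)+)
    (simp_all add: length_prog same_side_def outside_def)

text \<open>
  The invariant that makes all time bounds depend on a single number \<open>s\<close>, for which the size of the
  instance will be taken.
\<close>

definition small :: "nat \<Rightarrow> (nat \<times> nat) list \<Rightarrow> bool" where
  "small s A \<longleftrightarrow> length A \<le> s * s \<and> (\<forall>p\<in>set A. fst p \<le> s \<and> snd p \<le> s)"

text \<open>
  Time bounds for the functions of \<open>prog\<close>. The constants are generous; only their polynomial growth
  matters.
\<close>

definition "Tpar (s::nat) = 48 * s + 200"
definition "Tall s = (Tpar s + 40) * (s * s + 1)"
definition "Tfilt s = (Tall s + 60) * (s * s + 1)"
definition "Tdown (s::nat) = 30 * (s * s + 1)"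
definition "Tslide s = 4 * Tfilt s + Tdown s + 60"
definition "Tpass_cons s = Tslide s + Tfilt s + 60"
definition "Tpass s = (Tpass_cons s + 40) * (s + 1)"
definition "Ttw s = (2 * Tfilt s + 60) * (s + 1)"
definition "Tsnoc (s::nat) = 30 * (s + 1)"
definition "Titer s = Tpass s + 12 * (s * s + 1) + Ttw s + Tsnoc s + 200"
definition "Tgen s = 2 * Tfilt s + Tdown s + 60"
definition "Tmap s = (2 * Tfilt s + 60) * (s + 1)"
definition "Tconv s = (Tgen s + Tfilt s + Tmap s + 150) * (s + 1)"
definition "Tnegs (s::nat) = 60 * (s + 1)"
definition "Trow (s::nat) = 30 * (s + 1)"
definition "Trows s = (Trow s + 40) * (s + 1)"
definition "Tdecide s = Tnegs s + Tconv s + Titer s * (s * (s + 2) + s + 1) + 50"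
definition "Tmain s = Trows s + Tdecide s + 50"

lemma same_side_spec':
  "fst p \<le> s \<Longrightarrow> snd p \<le> s \<Longrightarrow> run prog [enc_pair p, enc_pair q] (prog ! 2) (encode_bool (same_side p q)) (Tpar s)"
  using run_weaken[OF same_side_spec] by (simp add: Tpar_def)

lemma all_spec_len:
  assumes "fst p \<le> s" "snd p \<le> s"
  shows "run prog [enc_pair p, enc_rel A] (prog ! 3) (encode_bool (\<forall>q\<in>set A. same_side p q))
    ((Tpar s + 40) * (length A + 1))"
proof (induction A)
  case Nil
  show ?case unfolding prog_nth all_body_def enc_list.simps
    by (rule run_weaken, (rule run_rules | simp only: branch_simps)+) simp_all
next
  case (Cons q A)
  show ?case unfolding prog_nth all_body_def enc_list.simps
    by (cases "same_side p q"; rule run_weaken,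
        (rule run_rules same_side_spec'[OF assms] Cons.IH | simp only: branch_simps length_prog)+; simp add: length_prog)
qed

lemma all_spec:
  assumes "fst p \<le> s" "snd p \<le> s" "small s A"
  shows "run prog [enc_pair p, enc_rel A] (prog ! 3) (encode_bool (\<forall>q\<in>set A. same_side p q)) (Tall s)"
  by (rule run_weaken[OF all_spec_len[OF assms(1,2)] HOL.refl]) (use assms(3) in \<open>simp add: Tall_def small_def\<close>)

lemma filt_spec:
  assumes "small s ys" "small s zs"
  shows "run prog [enc_rel ys, enc_rel zs] (prog ! 4) (enc_rel (filt ys zs)) (Tfilt s)"
proof -
  have "run prog [enc_rel ys, enc_rel zs] (prog ! 4) (enc_rel (filt ys zs)) ((Tall s + 60) * (length ys + 1))"
    if "\<forall>p\<in>set ys. fst p \<le> s \<and> snd p \<le> s" for ys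
    using that
  proof (induction ys)
    case Nil
    show ?case unfolding prog_nth filt_body_def enc_list.simps filt_def
      by (rule run_weaken, (rule run_rules | simp only: branch_simps)+) (simp_all)
  next
    case (Cons p ys)
    have p: "fst p \<le> s" "snd p \<le> s" using Cons.prems by auto
    have IH: "run prog [enc_rel ys, enc_rel zs] (prog ! 4) (enc_rel (filt ys zs)) ((Tall s + 60) * (length ys + 1))"
      using Cons by simp
    note test = all_spec[OF p assms(2)]
    show ?case
    proof (cases "\<forall>q\<in>set zs. same_side p q")
      case True
      then have test: "run prog [enc_pair p, enc_rel zs] (prog ! 3) (Dot Atom Atom) (Tall s)" using test by simp
      show ?thesis unfolding prog_nth filt_body_def enc_list.simps
        by (rule run_weaken, (rule run_rules test IH | simp only: branch_simps length_prog)+)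
          (simp_all add: length_prog filt_def True)
    next
      case False
      then have "encode_bool (\<forall>q\<in>set zs. same_side p q) = Atom" by (simp only: encode_bool_Atom not_False_eq_True)
      with test have test: "run prog [enc_pair p, enc_rel zs] (prog ! 3) Atom (Tall s)" by (simp only:)
      show ?thesis unfolding prog_nth filt_body_def enc_list.simps
        by (rule run_weaken, (rule run_rules test IH | simp only: branch_simps length_prog)+)
          (simp_all add: length_prog filt_def False)
    qed
  qed
  from run_weaken[OF this HOL.refl] show ?thesis
    using assms(1) by (simp add: small_def Tfilt_def)
qed

lemma down_spec:
  assumes "small s ys" shows "run prog [enc_rel ys] (prog ! 5) (enc_rel (down ys)) (Tdown s)"
proof -
  have "run prog [enc_rel ys] (prog ! 5) (enc_rel (down ys)) (30 * (length ys + 1))"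
  proof (induction ys)
    case Nil
    show ?case unfolding prog_nth down_body_def enc_list.simps down_def
      by (rule run_weaken, (rule run_rules | simp only: branch_simps)+) (simp_all)
  next
    case (Cons p ys)
    obtain i j where p: "p = (i, j)" by force
    show ?case unfolding prog_nth down_body_def enc_list.simps p enc_pair.simps
      by (rule run_weaken, (rule run_rules(1-7) run_Car run_pred run_rules(8-) Cons.IH | simp only: branch_simps length_prog)+)
        (simp_all add: length_prog down_def)
  qed
  from run_weaken[OF this HOL.refl] show ?thesis using assms by (simp add: small_def Tdown_def)
qed


lemma small_filt: "small s ys \<Longrightarrow> small s (filt ys zs)"
  unfolding small_def filt_def using le_trans[OF length_filter_le] by auto

lemma small_down: "small s ys \<Longrightarrow> small s (down ys)"
  by (auto simp: small_def down_def)

lemma slide_spec: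
  assumes "small s grid" "small s A" "small s H" "small s E"
  shows "run prog [enc_rel grid, enc_rel A, enc_rel H, enc_rels r, enc_rel E] (prog ! 6)
    (enc_rels (filt grid (down (filt (filt grid A) E)) # filt H E # r)) (Tslide s)"
  unfolding prog_nth slide_body_def enc_list.simps
  by (rule run_weaken, (rule run_rules filt_spec down_spec assms small_filt small_down | simp only: branch_simps length_prog)+)
    (simp_all add: length_prog Tslide_def)

lemma pass_cons_spec:
  assumes "small s grid" "small s A" "\<forall>H\<in>set ys. small s H"
  shows "run prog [enc_rel grid, enc_rel A, enc_rels ys] (prog ! 7)
    (enc_rels (case ys of [] \<Rightarrow> [A]
      | H # r \<Rightarrow> filt grid (down (filt (filt grid A) (filt H A))) # filt H (filt H A) # r)) (Tpass_cons s)"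
proof (cases ys)
  case Nil
  show ?thesis unfolding Nil prog_nth pass_cons_body_def enc_list.simps list.case
    by (rule run_weaken, (rule run_rules | simp only: branch_simps length_prog)+) (simp_all add: Tpass_cons_def)
next
  case (Cons H r)
  then have H: "small s H" using assms by simp
  note sl = slide_spec[OF assms(1,2) H small_filt[OF H]]
  show ?thesis unfolding Cons prog_nth pass_cons_body_def enc_list.simps(2) list.case
    by (rule run_weaken, (rule run_rules sl[unfolded enc_list.simps(2)] filt_spec[OF H assms(2)] | simp only: branch_simps length_prog)+)
      (simp_all add: length_prog Tpass_cons_def)
qed

lemma pass_small:
  assumes "small s grid" "\<forall>A\<in>set xs. small s A"
  shows "(\<forall>A\<in>set (pass grid xs). small s A) \<and> length (pass grid xs) = length xs"
  using assms(2)
proof (induction xs)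
  case (Cons A xs)
  then show ?case
    using small_filt small_filt[OF assms(1)] by (cases "pass grid xs") auto
qed simp

lemma pass_spec_len:
  assumes "small s grid" "\<forall>A\<in>set xs. small s A"
  shows "run prog [enc_rel grid, enc_rels xs] (prog ! 8) (enc_rels (pass grid xs)) ((Tpass_cons s + 40) * (length xs + 1))"
  using assms(2)
proof (induction xs)
  case Nil
  show ?case unfolding prog_nth pass_body_def enc_list.simps pass.simps
    by (rule run_weaken, (rule run_rules | simp only: branch_simps length_prog)+) simp_all
next
  case (Cons A xs)
  have A: "small s A" and p: "\<forall>H\<in>set (pass grid xs). small s H" using Cons.prems pass_small[OF assms(1)] by auto
  have IH: "run prog [enc_rel grid, enc_rels xs] (prog ! 8) (enc_rels (pass grid xs)) ((Tpass_cons s + 40) * (length xs + 1))"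
    using Cons by simp
  show ?case unfolding prog_nth pass_body_def enc_list.simps pass.simps
    by (rule run_weaken, (rule run_rules pass_cons_spec[OF assms(1) A p] IH | simp only: branch_simps length_prog)+)
      (simp_all add: length_prog)
qed

lemma pass_spec:
  assumes "small s grid" "\<forall>A\<in>set xs. small s A" "length xs \<le> s"
  shows "run prog [enc_rel grid, enc_rels xs] (prog ! 8) (enc_rels (pass grid xs)) (Tpass s)"
  by (rule run_weaken[OF pass_spec_len[OF assms(1,2)] HOL.refl]) (use assms(3) in \<open>simp add: Tpass_def\<close>)

lemma twist_spec:
  assumes "small s grid" "small s A" "m \<le> s"
  shows "run prog [enc_rel grid, encode_nat m, enc_rel A] (prog ! 9) (enc_rel (twist grid m A)) (Ttw s)"
proof -
  have "run prog [enc_rel grid, encode_nat m, enc_rel A] (prog ! 9) (enc_rel (twist grid m A)) ((2 * Tfilt s + 60) * (m + 1))"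
    using assms(2)
  proof (induction m arbitrary: A)
    case 0
    show ?case unfolding prog_nth tw_body_def encode_nat.simps twist.simps
      by (rule run_weaken, (rule run_rules | simp only: branch_simps length_prog)+) simp_all
  next
    case (Suc m)
    note IH = Suc.IH[OF small_filt[OF assms(1)], of "filt grid A"]
    note f = filt_spec[OF assms(1) Suc.prems] filt_spec[OF assms(1) small_filt[OF assms(1)]]
    show ?case unfolding prog_nth tw_body_def encode_nat.simps twist.simps
      by (rule run_weaken, (rule run_rules IH f | simp only: branch_simps length_prog)+) (simp_all add: length_prog)
  qed
  from run_weaken[OF this HOL.refl] show ?thesis using assms(3) by (simp add: Ttw_def)
qed

lemma twist_small: "small s grid \<Longrightarrow> small s A \<Longrightarrow> small s (twist grid m A)"
  by (induction m arbitrary: A) (auto simp: small_filt)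

lemma snoc_spec:
  assumes "length xs \<le> s"
  shows "run prog [enc_rels xs, enc_rel A] (prog ! 10) (enc_rels (xs @ [A])) (Tsnoc s)"
proof -
  have "run prog [enc_rels xs, enc_rel A] (prog ! 10) (enc_rels (xs @ [A])) (30 * (length xs + 1))"
  proof (induction xs)
    case Nil
    show ?case unfolding prog_nth snoc_body_def enc_list.simps append.simps
      by (rule run_weaken, (rule run_rules | simp only: branch_simps length_prog)+) simp_all
  next
    case (Cons H xs)
    show ?case unfolding prog_nth snoc_body_def enc_list.simps append.simps
      by (rule run_weaken, (rule run_rules Cons.IH | simp only: branch_simps length_prog)+) (simp_all add: length_prog)
  qed
  from run_weaken[OF this HOL.refl] show ?thesis using assms by (simp add: Tsnoc_def)
qed


text \<open>
  The number \<open>m * (s + 2) + fuel\<close> decreases with every iteration: a cycling lowers \<open>fuel\<close>, and a head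
  \<open>\<delta>\<close> lowers \<open>m\<close> while \<open>fuel\<close> is reset to \<open>n \<le> s\<close>.
\<close>

lemma loop_spec:
  assumes grid: "small s grid" and n: "n \<le> s"
  shows "\<forall>A\<in>set xs. small s A \<Longrightarrow> length xs \<le> s \<Longrightarrow> m \<le> s \<Longrightarrow>
    run prog [enc_rel grid, encode_nat n, encode_nat m, encode_nat fuel, enc_rels xs] (prog ! 11)
      (encode_bool (loop grid n m fuel xs)) (Titer s * (m * (s + 2) + fuel + 1))"
proof (induction "(m, fuel)" arbitrary: m fuel xs
    rule: wf_induct_rule[OF wf_lex_prod[OF wf_less_than wf_less_than]])
  case less: 1
  have iter: "200 \<le> Titer s" by (simp add: Titer_def)
  show ?case
  proof (cases "m = 0")
    case True
    have "loop grid n m fuel xs" by (subst loop.simps) (simp add: True)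
    then show ?thesis unfolding prog_nth loop_body_def
      by - (rule run_weaken, (rule run_rules | simp only: branch_simps True)+, use iter in simp_all)
  next
    case m: False
    define ys where "ys = pass grid xs"
    have ys: "\<forall>A\<in>set ys. small s A" "length ys \<le> s"
      using pass_small[OF grid less.prems(1)] less.prems(2) by (auto simp: ys_def)
    define N where "N = m * (s + 2) + fuel"
    have step: "run prog [enc_rel grid, encode_nat n, encode_nat m, encode_nat fuel, enc_rels ys] (prog ! 12)
        (encode_bool (loop grid n m fuel xs)) (12 * (s * s + 1) + Ttw s + Tsnoc s + 100 + Titer s * N)"
    proof (cases ys)
      case Nil
      have "\<not> loop grid n m fuel xs" by (subst loop.simps) (use m Nil in \<open>simp add: ys_def\<close>)
      then show ?thesis unfolding Nil prog_nth step_body_def enc_list.simps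
        by - (rule run_weaken, (rule run_rules | simp only: branch_simps)+, simp_all)
    next
      case (Cons H r)
      have H: "small s H" and r: "\<forall>A\<in>set r. small s A" "length r < s" using ys Cons by auto
      have le: "12 * (spine (enc_rel grid) + 1) \<le> 12 * (s * s + 1)" using grid by (simp add: small_def)
      show ?thesis
      proof (cases "length grid \<le> length H")
        case True
        have val: "loop grid n m fuel xs = loop grid n (m - 1) n r"
          by (subst loop.simps) (use m Cons True in \<open>simp add: ys_def\<close>)
        have test: "run prog [enc_rel grid, enc_rel H] (prog ! 0) (Dot Atom Atom) (12 * (s * s + 1))"
          by (rule run_weaken[OF le_spec _ le]) (simp add: True)
        have "run prog [enc_rel grid, encode_nat n, encode_nat (m - 1), encode_nat n, enc_rels r] (prog ! 11)
            (encode_bool (loop grid n (m - 1) n r)) (Titer s * ((m - 1) * (s + 2) + n + 1))"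
          by (rule less.hyps) (use m r less.prems in auto)
        moreover have "(m - 1) * (s + 2) + n + 1 \<le> N"
        proof -
          have "m * (s + 2) = (m - 1) * (s + 2) + (s + 2)" using m by (cases m) auto
          then show ?thesis using n by (simp add: N_def)
        qed
        ultimately have IH: "run prog [enc_rel grid, encode_nat n, encode_nat (m - 1), encode_nat n, enc_rels r] (prog ! 11)
            (encode_bool (loop grid n (m - 1) n r)) (Titer s * N)"
          by (meson run_weaken HOL.refl mult_le_mono2)
        have pm: "run prog (d0 # d1 # encode_nat m # env) (CdrE (Param 2)) (encode_nat (m - 1)) 2" for d0 d1 env
          by (rule run_weaken[OF run_pred[OF run_Param(3)]]) simp_all
        show ?thesis unfolding val Cons prog_nth step_body_def enc_list.simps(2)
          by (rule run_weaken, (rule pm run_rules test IH | simp only: branch_simps length_prog)+)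
      next
        case F: False
        then have "encode_bool (spine (enc_rel grid) \<le> spine (enc_rel H)) = Atom" by simp
        then have test: "run prog [enc_rel grid, enc_rel H] (prog ! 0) Atom (12 * (s * s + 1))"
          by (rule run_weaken[OF le_spec _ le])
        show ?thesis
        proof (cases "fuel = 0")
          case True
          have "\<not> loop grid n m fuel xs"
            by (subst loop.simps) (use m Cons F True in \<open>simp add: ys_def\<close>)
          then show ?thesis unfolding Cons prog_nth step_body_def enc_list.simps(2)
            by - (rule run_weaken, (rule run_rules test | simp only: branch_simps length_prog True)+, simp_all add: length_prog)
        next
          case False
          define C where "C = twist grid m H"
          have val: "loop grid n m fuel xs = loop grid n m (fuel - 1) (r @ [C])"
            by (subst loop.simps) (use m Cons F False in \<open>simp add: ys_def C_def\<close>)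
          have C: "small s C" unfolding C_def by (rule twist_small[OF grid H])
          have "run prog [enc_rel grid, encode_nat n, encode_nat m, encode_nat (fuel - 1), enc_rels (r @ [C])] (prog ! 11)
            (encode_bool (loop grid n m (fuel - 1) (r @ [C]))) (Titer s * (m * (s + 2) + (fuel - 1) + 1))"
            by (rule less.hyps) (use False r C less.prems in auto)
          then have IH: "run prog [enc_rel grid, encode_nat n, encode_nat m, encode_nat (fuel - 1), enc_rels (r @ [C])] (prog ! 11)
            (encode_bool (loop grid n m (fuel - 1) (r @ [C]))) (Titer s * N)"
            using False by (simp add: N_def del: encode_bool.simps)
          have tws: "run prog [enc_rel grid, encode_nat m, enc_rel H] (prog ! 9) (enc_rel C) (Ttw s)"
            unfolding C_def by (rule twist_spec[OF grid H less.prems(3)])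
          have sn: "run prog [enc_rels r, enc_rel C] (prog ! 10) (enc_rels (r @ [C])) (Tsnoc s)"
            by (rule snoc_spec) (use r in simp)
          have pf: "run prog (d0 # d1 # d2 # encode_nat fuel # env) (CdrE (Param 3)) (encode_nat (fuel - 1)) 2"
            for d0 d1 d2 env
            by (rule run_weaken[OF run_pred[OF run_Param(4)]]) simp_all
          show ?thesis unfolding val Cons prog_nth step_body_def enc_list.simps(2)
            by (rule run_weaken, (rule pf run_rules test IH tws sn | simp only: branch_simps length_prog False)+)
        qed
      qed
    qed
    have ps: "run prog [enc_rel grid, enc_rels xs] (prog ! 8) (enc_rels ys) (Tpass s)"
      unfolding ys_def by (rule pass_spec[OF grid less.prems(1,2)])
    have bound: "Titer s * (m * (s + 2) + fuel + 1) = Titer s * N + Titer s" by (simp add: N_def algebra_simps)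
    show ?thesis unfolding bound prog_nth loop_body_def
      by (rule run_weaken, (rule run_rules step ps | simp only: branch_simps length_prog m)+)
        (simp_all add: length_prog Titer_def)
  qed
qed

lemma chord_list_spec:
  assumes "small s grid" "i \<le> s" "j \<le> s" "1 \<le> s"
  shows "run prog [enc_rel grid, encode_nat i, encode_nat j] (prog ! 13) (enc_rel (chord_list grid i j)) (Tgen s)"
proof -
  have p: "small s [(i, j)]" using assms by (simp add: small_def)
  note f = filt_spec[OF assms(1) p, unfolded enc_list.simps enc_pair.simps]
    filt_spec[OF assms(1) small_down[OF small_filt[OF assms(1)]]] down_spec[OF small_filt[OF assms(1)]]
  show ?thesis unfolding prog_nth gen_body_def chord_list_def
    by (rule run_weaken, (rule run_rules f | simp only: branch_simps length_prog)+) (simp_all add: length_prog Tgen_def)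
qed

lemma map_spec:
  assumes grid: "small s grid" and xs: "\<forall>A\<in>set xs. small s A" "length xs \<le> s"
  shows "run prog [enc_rel grid, enc_rels xs] (prog ! 14) (enc_rels (map (\<lambda>A. filt grid (filt grid A)) xs)) (Tmap s)"
proof -
  have "run prog [enc_rel grid, enc_rels xs] (prog ! 14) (enc_rels (map (\<lambda>A. filt grid (filt grid A)) xs))
      ((2 * Tfilt s + 60) * (length xs + 1))"
    using xs(1)
  proof (induction xs)
    case Nil
    show ?case unfolding prog_nth map_body_def enc_list.simps list.map
      by (rule run_weaken, (rule run_rules | simp only: branch_simps length_prog)+) simp_all
  next
    case (Cons A xs)
    have A: "small s A" using Cons.prems by simp
    have IH: "run prog [enc_rel grid, enc_rels xs] (prog ! 14) (enc_rels (map (\<lambda>A. filt grid (filt grid A)) xs))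
        ((2 * Tfilt s + 60) * (length xs + 1))" using Cons by simp
    note f = filt_spec[OF grid A] filt_spec[OF grid small_filt[OF grid]]
    show ?case unfolding prog_nth map_body_def enc_list.simps list.map
      by (rule run_weaken, (rule run_rules f IH | simp only: branch_simps length_prog)+) (simp_all add: length_prog)
  qed
  from run_weaken[OF this HOL.refl] show ?thesis using xs(2) by (simp add: Tmap_def)
qed

lemma small_chord_list: "small s grid \<Longrightarrow> small s (chord_list grid i j)"
  by (simp add: chord_list_def small_filt)

lemma translate_small: "small s grid \<Longrightarrow> (\<forall>A\<in>set (translate grid w). small s A) \<and> length (translate grid w) = length w"
  by (induction grid w rule: translate.induct) (auto simp: small_filt small_chord_list)

lemma translate_spec:
  assumes grid: "small s grid" and w: "\<forall>(i, j, b)\<in>set w. i \<le> s \<and> j \<le> s" "length w \<le> s" and s: "1 \<le> s"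
  shows "run prog [enc_rel grid, encode_band_word w] (prog ! 15) (enc_rels (translate grid w)) (Tconv s)"
proof -
  have "run prog [enc_rel grid, encode_band_word w] (prog ! 15) (enc_rels (translate grid w))
      ((Tgen s + Tfilt s + Tmap s + 150) * (length w + 1))"
    using w
  proof (induction w)
    case Nil
    show ?case unfolding prog_nth conv_body_def encode_band_word.simps translate.simps enc_list.simps
      by (rule run_weaken, (rule run_rules | simp only: branch_simps length_prog)+) simp_all
  next
    case (Cons l w)
    obtain i j b where l: "l = (i, j, b)" by (metis surj_pair)
    have ij: "i \<le> s" "j \<le> s" using Cons.prems l by auto
    have IH: "run prog [enc_rel grid, encode_band_word w] (prog ! 15) (enc_rels (translate grid w))
        ((Tgen s + Tfilt s + Tmap s + 150) * (length w + 1))" using Cons by auto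
    have c: "\<forall>A\<in>set (translate grid w). small s A" "length (translate grid w) \<le> s"
      using translate_small[OF grid, of w] Cons.prems by auto
    note g = chord_list_spec[OF grid ij s]
    note f = filt_spec[OF grid small_chord_list[OF grid]] map_spec[OF grid c]
    show ?case
    proof (cases b)
      case True
      have e: "encode_bool b = Dot Atom Atom" using True by simp
      show ?thesis unfolding prog_nth conv_body_def letter_gen_def l encode_band_word.simps e
        by (rule run_weaken, (rule run_rules g IH | simp only: branch_simps length_prog)+)
          (simp_all add: length_prog True)
    next
      case False
      have e: "encode_bool b = Atom" using False by simp
      show ?thesis unfolding prog_nth conv_body_def letter_gen_def l encode_band_word.simps e
        by (rule run_weaken, (rule run_rules g f IH | simp only: branch_simps length_prog)+)
          (simp_all add: length_prog False)
    qed
  qed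
  from run_weaken[OF this HOL.refl] show ?thesis using w(2) by (simp add: Tconv_def)
qed

lemma negatives_spec:
  assumes "length w \<le> s"
  shows "run prog [encode_band_word w] (prog ! 16) (encode_nat (negatives w)) (Tnegs s)"
proof -
  have "run prog [encode_band_word w] (prog ! 16) (encode_nat (negatives w)) (60 * (length w + 1))"
  proof (induction w)
    case Nil
    show ?case unfolding prog_nth negs_body_def encode_band_word.simps
      by (rule run_weaken, (rule run_rules | simp only: branch_simps length_prog)+) simp_all
  next
    case (Cons l w)
    obtain i j b where l: "l = (i, j, b)" by (metis surj_pair)
    show ?case
    proof (cases b)
      case True
      have e: "encode_bool b = Dot Atom Atom" using True by simp
      show ?thesis unfolding prog_nth negs_body_def l encode_band_word.simps e
        by (rule run_weaken, (rule run_rules Cons.IH | simp only: branch_simps length_prog)+) (simp_all add: length_prog True)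
    next
      case False
      have e: "encode_bool b = Atom" using False by simp
      show ?thesis unfolding prog_nth negs_body_def l encode_band_word.simps e
        by (rule run_weaken, (rule run_rules Cons.IH | simp only: branch_simps length_prog)+) (simp_all add: length_prog False)
    qed
  qed
  from run_weaken[OF this HOL.refl] show ?thesis using assms by (simp add: Tnegs_def)
qed

lemma row_spec:
  assumes "j \<le> s"
  shows "run prog [encode_nat i, encode_nat j, enc_rel acc] (prog ! 17) (enc_rel (row i j acc)) (Trow s)"
proof -
  have "run prog [encode_nat i, encode_nat j, enc_rel acc] (prog ! 17) (enc_rel (row i j acc)) (30 * (j + 1))"
  proof (induction j)
    case 0
    show ?case unfolding prog_nth row_body_def encode_nat.simps(1)
      by (rule run_weaken, (rule run_rules | simp only: branch_simps length_prog)+) simp_all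
  next
    case (Suc j)
    show ?case unfolding prog_nth row_body_def encode_nat.simps(2)
      by (rule run_weaken, (rule run_rules Suc.IH | simp only: branch_simps length_prog)+) (simp_all add: length_prog)
  qed
  from run_weaken[OF this HOL.refl] show ?thesis using assms by (simp add: Trow_def)
qed

lemma rows_spec:
  assumes "i \<le> s" "k \<le> s"
  shows "run prog [encode_nat i, encode_nat k] (prog ! 18) (enc_rel (rows i k)) (Trows s)"
proof -
  have "run prog [encode_nat i, encode_nat k] (prog ! 18) (enc_rel (rows i k)) ((Trow s + 40) * (i + 1))"
  proof (induction i)
    case 0
    show ?case unfolding prog_nth rows_body_def encode_nat.simps(1)
      by (rule run_weaken, (rule run_rules | simp only: branch_simps length_prog)+) simp_all
  next
    case (Suc i)
    note r = row_spec[OF assms(2), of "Suc i", unfolded encode_nat.simps(2)]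
    show ?case unfolding prog_nth rows_body_def encode_nat.simps(2)
      by (rule run_weaken, (rule run_rules Suc.IH r | simp only: branch_simps length_prog)+) (simp_all add: length_prog)
  qed
  from run_weaken[OF this HOL.refl] show ?thesis using assms(1) by (simp add: Trows_def)
qed

lemma negatives_le: "negatives w \<le> length w"
  by (induction w rule: negatives.induct) auto

lemma rows_small: "n \<le> s \<Longrightarrow> small s (rows n n)"
proof -
  assume n: "n \<le> s"
  have "length (rows i k) = i * k" for i k
    by (induction i) (auto simp: row_eq)
  then show "small s (rows n n)" using n by (auto simp: small_def set_rows mult_le_mono)
qed

lemma decide_spec:
  assumes n: "n \<le> s" and w: "\<forall>(i, j, b)\<in>set w. i \<le> s \<and> j \<le> s" "length w \<le> s" and s: "1 \<le> s"
  shows "run prog [enc_rel (rows n n), encode_nat n, encode_band_word w] (prog ! 19)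
    (encode_bool (decide n w)) (Tdecide s)"
proof -
  have grid: "small s (rows n n)" by (rule rows_small[OF n])
  have c: "\<forall>A\<in>set (translate (rows n n) w). small s A" "length (translate (rows n n) w) \<le> s"
    using translate_small[OF grid, of w] w by auto
  have m: "negatives w \<le> s" using negatives_le[of w] w by simp
  have "negatives w * (s + 2) + n + 1 \<le> s * (s + 2) + s + 1" using m n by (intro add_mono mult_le_mono) auto
  then have l: "run prog [enc_rel (rows n n), encode_nat n, encode_nat (negatives w), encode_nat n, enc_rels (translate (rows n n) w)]
      (prog ! 11) (encode_bool (decide n w)) (Titer s * (s * (s + 2) + s + 1))"
    using run_weaken[OF loop_spec[OF grid n c m, of n] HOL.refl] by (simp add: decide_def del: encode_bool.simps)
  note f = negatives_spec[OF w(2)] translate_spec[OF grid w s] l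
  show ?thesis unfolding prog_nth decide_body_def
    by (rule run_weaken, (rule run_rules f | simp only: branch_simps length_prog)+) (simp_all add: length_prog Tdecide_def)
qed

lemma main_spec:
  assumes n: "n \<le> s" and w: "\<forall>(i, j, b)\<in>set w. i \<le> s \<and> j \<le> s" "length w \<le> s" and s: "1 \<le> s"
  shows "run prog [encode_instance (n, w)] main_body (encode_bool (decide n w)) (Tmain s)"
  unfolding encode_instance.simps main_body_def
  by (rule run_weaken, (rule run_rules decide_spec[OF n w s] rows_spec[OF n n] | simp only: branch_simps length_prog)+)
    (simp_all add: length_prog Tmain_def)

definition poly_bounded :: "(nat \<Rightarrow> nat) \<Rightarrow> bool" where
  "poly_bounded f \<longleftrightarrow> (\<exists>c k. \<forall>s. f s \<le> c * (s + 1) ^ k)"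

lemma poly_bounded_const: "poly_bounded (\<lambda>_. c)"
  unfolding poly_bounded_def by (rule exI[of _ c], rule exI[of _ 0]) simp

lemma poly_bounded_id: "poly_bounded (\<lambda>s. s)"
  unfolding poly_bounded_def by (rule exI[of _ 1], rule exI[of _ 1]) simp

lemma poly_bounded_mult: assumes "poly_bounded f" "poly_bounded g" shows "poly_bounded (\<lambda>s. f s * g s)"
proof -
  obtain c k d l where "\<And>s. f s \<le> c * (s + 1) ^ k" "\<And>s. g s \<le> d * (s + 1) ^ l"
    using assms by (auto simp: poly_bounded_def)
  then have "f s * g s \<le> (c * (s + 1) ^ k) * (d * (s + 1) ^ l)" for s by (intro mult_le_mono)
  then have "f s * g s \<le> (c * d) * (s + 1) ^ (k + l)" for s by (simp add: power_add ac_simps)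
  then show ?thesis unfolding poly_bounded_def by blast
qed

lemma poly_bounded_add: assumes "poly_bounded f" "poly_bounded g" shows "poly_bounded (\<lambda>s. f s + g s)"
proof -
  obtain c k d l where f: "\<And>s. f s \<le> c * (s + 1) ^ k" and g: "\<And>s. g s \<le> d * (s + 1) ^ l"
    using assms by (auto simp: poly_bounded_def)
  have "f s + g s \<le> (c + d) * (s + 1) ^ (k + l)" for s
  proof -
    have "(s + 1) ^ k \<le> (s + 1) ^ (k + l)" "(s + 1) ^ l \<le> (s + 1) ^ (k + l)"
      by (rule power_increasing; simp)+
    then have "c * (s + 1) ^ k \<le> c * (s + 1) ^ (k + l)" "d * (s + 1) ^ l \<le> d * (s + 1) ^ (k + l)"
      by (simp_all only: mult_le_mono2)
    then show ?thesis unfolding add_mult_distrib using le_trans[OF f] le_trans[OF g] by (intro add_mono)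
  qed
  then show ?thesis unfolding poly_bounded_def by blast
qed

lemma poly_bounded_Tmain: "poly_bounded Tmain"
  unfolding Tmain_def[abs_def] Tdecide_def Trows_def Trow_def Tnegs_def Tconv_def Tmap_def Tgen_def Titer_def
    Tsnoc_def Ttw_def Tpass_def Tpass_cons_def Tslide_def Tdown_def Tfilt_def Tall_def Tpar_def
  by (intro poly_bounded_add poly_bounded_mult poly_bounded_const poly_bounded_id)

text \<open>
  The equivalences are \<open>SSS_SQP\<close>; the program decides correctly by \<open>decide_correct\<close> and runs in
  polynomial time by \<open>main_spec\<close> and \<open>poly_bounded_Tmain\<close>.
\<close>

theorem lemma1p2:
  shows "(\<forall>n\<ge>3. \<forall>\<beta>\<in>carrier (braid_group n).
            (conj_to_SQP n \<beta> \<longleftrightarrow> (\<forall>\<beta>'\<in>SSS n (conj_class n \<beta>). braid_inf n \<beta>' \<ge> 0)) \<and>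
            ((\<forall>\<beta>'\<in>SSS n (conj_class n \<beta>). braid_inf n \<beta>' \<ge> 0) \<longleftrightarrow>
             (\<exists>\<beta>'\<in>SSS n (conj_class n \<beta>). braid_inf n \<beta>' \<ge> 0))) \<and>
         polytime_decidable {(n, w). n \<ge> 3 \<and> w \<in> band_words n} encode_instance instance_size
           (\<lambda>(n, w). conj_to_SQP n (band_eval n w))"
proof (intro conjI allI impI ballI)
  fix n :: nat and \<beta> assume n: "3 \<le> n" and \<beta>: "\<beta> \<in> carrier (braid_group n)"
  interpret dual_braid n by standard (use n in simp)
  show "conj_to_SQP n \<beta> \<longleftrightarrow> (\<forall>\<beta>'\<in>SSS n (conj_class n \<beta>). braid_inf n \<beta>' \<ge> 0)"
    and "(\<forall>\<beta>'\<in>SSS n (conj_class n \<beta>). braid_inf n \<beta>' \<ge> 0) \<longleftrightarrow>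
      (\<exists>\<beta>'\<in>SSS n (conj_class n \<beta>). braid_inf n \<beta>' \<ge> 0)"
    by (rule SSS_SQP[OF \<beta>])+
next
  obtain c k where poly: "\<And>s. Tmain s \<le> c * (s + 1) ^ k"
    using poly_bounded_Tmain by (auto simp: poly_bounded_def)
  have "\<exists>v t. evaluates prog [encode_instance x] main_body v t \<and>
      (v \<noteq> Atom \<longleftrightarrow> (case x of (n, w) \<Rightarrow> conj_to_SQP n (band_eval n w))) \<and> t \<le> c * (instance_size x + 1) ^ k"
    if "x \<in> {(n, w). n \<ge> 3 \<and> w \<in> band_words n}" for x
  proof -
    obtain n w where x: "x = (n, w)" "3 \<le> n" "w \<in> band_words n"
      using \<open>x \<in> {(n, w). n \<ge> 3 \<and> w \<in> band_words n}\<close> by auto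
    interpret dual_braid n by standard (use x in simp)
    define s where "s = n + length w"
    have "run prog [encode_instance (n, w)] main_body (encode_bool (decide n w)) (Tmain s)"
      by (rule main_spec) (use x in \<open>force simp: s_def band_words_def\<close>)+
    then obtain t where t: "t \<le> Tmain s" "evaluates prog [encode_instance x] main_body (encode_bool (decide n w)) t"
      unfolding run_def x by blast
    have "t \<le> c * (instance_size x + 1) ^ k" using t(1) poly[of s] by (simp add: x s_def)
    then show ?thesis using t(2) decide_correct[OF x(3)]
      by (intro exI[of _ "encode_bool (decide n w)"] exI[of _ t]) (simp add: x)
  qed
  then show "polytime_decidable {(n, w). n \<ge> 3 \<and> w \<in> band_words n} encode_instance instance_size
      (\<lambda>(n, w). conj_to_SQP n (band_eval n w))"
    unfolding polytime_decidable_def by blast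
qed

end
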